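(* Let $(V,\ast,\cdot,\sigma)$ be a unital 2-braided algebra over $K$, and let $M=(M_{pq})_{p,q\ge0}$ be the maps $M_{pq}:V^{\otimes p}\otimes V^{\otimes q}\to V$ defined inductively by $M_{00}=0$, $M_{10}=\mathrm{id}_V=M_{01}$, $M_{n0}=0=M_{0n}$ for $n\ge2$, and, for $p,q\ge1$, $$M_{pq}(u_1\otimes\cdots\otimes u_p\underline{\otimes}v_1\otimes\cdots\otimes v_q)=(u_1\cdot\cdots\cdot u_p)\ast(v_1\cdot\cdots\cdot v_q)-\sum_{k=2}^{p+q}\sum_{I_k,J_k}\cdot^{k-1}\,M_{(i_1,j_1,\ldots,i_k,j_k)}\circ\bigtriangleup^{(k-1)}_{\beta\,(i_1,j_1,\ldots,i_k,j_k)}(u_1\otimes\cdots\otimes u_p\underline{\otimes}v_1\otimes\cdots\otimes v_q),$$ where $I_k=(i_1,\ldots,i_k)$ and $J_k=(j_1,\ldots,j_k)$ run through all ordered $k$-tuples of non-negative integers with sums $p$ and $q$ respectively (terms with some $(i_s,j_s)=(0,0)$ being zero since $M_{00}=0$). Then $(V,M,\sigma)$ is a quantum multi-brace algebra.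
   Context: $K$ is a field of characteristic $0$. $T(V)=\bigoplus_{n\ge0}V^{\otimes n}$, $V^{\otimes0}=K$; $\underline{\otimes}$ denotes the tensor product between copies of $T(V)$. Braiding on $V$: an invertible $\sigma\in\mathrm{End}(V\otimes V)$ with $\sigma_1\sigma_2\sigma_1=\sigma_2\sigma_1\sigma_2$ on $V^{\otimes3}$ ($\sigma_i$ is $\sigma$ acting on factors $i,i+1$). A braided algebra $(A,m,\sigma)$ is an associative unital algebra with a braiding such that $\sigma(m\otimes\mathrm{id})=(\mathrm{id}\otimes m)\sigma_1\sigma_2$, $\sigma(\mathrm{id}\otimes m)=(m\otimes\mathrm{id})\sigma_2\sigma_1$, $\sigma(1\otimes a)=a\otimes1$, $\sigma(a\otimes1)=1\otimes a$. A unital 2-braided algebra $(V,\ast,\cdot,\sigma)$ is a braided vector space $(V,\sigma)$ with two associative algebra structures $\ast$ and $\cdot$ sharing the same unit such that both $(V,\ast,\sigma)$ and $(V,\cdot,\sigma)$ are braided algebras. $\cdot^{k}:V^{\otimes k+1}\to V$ is $v_1\otimes\cdots\otimes v_{k+1}\mapsto v_1\cdot\cdots\cdot v_{k+1}$. For $w\in\mathfrak{S}_n$ with reduced expression $s_{i_1}\cdots s_{i_l}$, $T^\sigma_w=\sigma_{i_1}\cdots\sigma_{i_l}$. Let $\chi_{ij}\in\mathfrak{S}_{i+j}$, $\chi_{ij}(k)=j+k$ ($1\le k\le i$), $\chi_{ij}(i+k)=k$ ($1\le k\le j$). The braiding $\beta$ on $T(V)$ is $\beta_{ij}=T^\sigma_{\chi_{ij}}$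 on $V^{\otimes i}\underline{\otimes}V^{\otimes j}$, with $\beta_{0i},\beta_{i0}$ the flips. $\delta$ is deconcatenation on $T(V)$: $\delta(v_1\otimes\cdots\otimes v_n)=\sum_{i=0}^n(v_1\otimes\cdots\otimes v_i)\underline{\otimes}(v_{i+1}\otimes\cdots\otimes v_n)$. $\bigtriangleup_\beta=(\mathrm{id}\otimes\beta\otimes\mathrm{id})\circ(\delta\otimes\delta)$ on $T(V)\underline{\otimes}T(V)$; $\bigtriangleup_\beta^{(0)}=\mathrm{id}$, $\bigtriangleup_\beta^{(n)}=(\bigtriangleup_\beta^{(n-1)}\otimes\mathrm{id})\bigtriangleup_\beta$. $\bigtriangleup^{(k-1)}_{\beta\,(i_1,j_1,\ldots,i_k,j_k)}$ is the component of $\bigtriangleup_\beta^{(k-1)}$ from $V^{\otimes i_1+\cdots+i_k}\underline{\otimes}V^{\otimes j_1+\cdots+j_k}$ to $V^{\otimes i_1}\underline{\otimes}V^{\otimes j_1}\underline{\otimes}\cdots\underline{\otimes}V^{\otimes i_k}\underline{\otimes}V^{\otimes j_k}$, and $M_{(i_1,j_1,\ldots,i_k,j_k)}=M_{i_1j_1}\otimes\cdots\otimes M_{i_kj_k}$. Quantum multi-brace algebra $(V,M,\sigma)$: a braided vector space with linear maps $M_{pq}:V^{\otimes p}\otimes V^{\otimes q}\to V$, $p,q\ge0$, $M=\bigoplus M_{pq}:T(V)\underline{\otimes}T(V)\to V$, such that: (1) $M_{00}=0$, $M_{10}=\mathrm{id}_V=M_{01}$, $M_{n0}=0=M_{0n}$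 for $n\ge2$; (2) for all $i,j,k\ge1$, $\beta_{1k}(M_{ij}\otimes\mathrm{id}_V^{\otimes k})=(\mathrm{id}_V^{\otimes k}\otimes M_{ij})\beta_{i+j,k}$ and $\beta_{i1}(\mathrm{id}_V^{\otimes i}\otimes M_{jk})=(M_{jk}\otimes\mathrm{id}_V^{\otimes i})\beta_{i,j+k}$; (3) for all $i,j,k\ge1$, on $V^{\otimes i}\underline{\otimes}V^{\otimes j}\underline{\otimes}V^{\otimes k}$, $\sum_{r=1}^{i+j}M_{rk}\circ\big((M^{\otimes r}\circ\bigtriangleup_\beta^{(r-1)})\otimes\mathrm{id}_V^{\otimes k}\big)=\sum_{l=1}^{j+k}M_{il}\circ\big(\mathrm{id}_V^{\otimes i}\otimes(M^{\otimes l}\circ\bigtriangleup_\beta^{(l-1)})\big)$. Here $M^{\otimes r}\circ\bigtriangleup_\beta^{(r-1)}$ takes values in $V^{\otimes r}$. *)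

theory Defs
  imports Complex_Main "HOL-Library.Function_Algebras" "HOL-Combinatorics.Permutations"
begin

section \<open>Tensor powers of a vector space\<close>

text \<open>
  A \<open>K\<close>-vector space \<open>V\<close> is a type with a scalar multiplication \<open>scale\<close>. The tensor algebra
  \<open>T(V)\<close> is modelled inside the space of functionals on functions \<open>V\<^sup>n \<rightarrow> K\<close>: the elementary
  tensor of \<open>v\<^sub>1, \<dots>, v\<^sub>n\<close> evaluates \<open>n\<close>-linear forms at \<open>(v\<^sub>1, \<dots>, v\<^sub>n)\<close>, and the \<open>n\<close>-th tensor
  power is the span of these. The lemmas \<open>multilinear_pure\<close>, \<open>lift_pure\<close>, \<open>linear_lift\<close> and
  \<open>tpow_unique\<close> show that this has the universal property of the tensor power with respect to
  every target vector space. Since \<open>V\<^sup>\<otimes>\<^sup>p \<otimes> V\<^sup>\<otimes>\<^sup>q = V\<^sup>\<otimes>\<^sup>(\<^sup>p\<^sup>+\<^sup>q\<^sup>)\<close>, homogeneous components of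
  tensor products of copies of \<open>T(V)\<close> are tensor powers of \<open>V\<close> as well; the way they are cut into
  factors is recorded in the indices of the maps below.
\<close>

type_synonym ('k, 'v) tensor = "('v list \<Rightarrow> 'k) \<Rightarrow> 'k"

definition tscale :: "'k::field \<Rightarrow> ('k, 'v) tensor \<Rightarrow> ('k, 'v) tensor" where
  "tscale c x = (\<lambda>F. c * x F)"

context
  fixes scale :: "'k::field_char_0 \<Rightarrow> 'v::ab_group_add \<Rightarrow> 'v"
begin

definition multilinear ::
    "('k \<Rightarrow> 'w::ab_group_add \<Rightarrow> 'w) \<Rightarrow> nat \<Rightarrow> ('v list \<Rightarrow> 'w) \<Rightarrow> bool" where
  "multilinear scaleW n h \<longleftrightarrow>
     (\<forall>us vs. length us + 1 + length vs = n \<longrightarrow>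
        Vector_Spaces.linear scale scaleW (\<lambda>v. h (us @ v # vs)))"

definition pure :: "'v list \<Rightarrow> ('k, 'v) tensor" where
  "pure vs = (\<lambda>F. if multilinear (*) (length vs) F then F vs else 0)"

definition tpow :: "nat \<Rightarrow> ('k, 'v) tensor set" where
  "tpow n = module.span tscale (pure ` {vs. length vs = n})"

text \<open>
  \<open>lift scaleW D h\<close> is the linear map induced by \<open>h\<close> on the sum of the \<open>V\<^sup>\<otimes>\<^sup>n\<close> with \<open>n \<in> D\<close>,
  where \<open>h\<close> is \<open>n\<close>-linear on the lists of length \<open>n\<close>. Its values elsewhere are irrelevant.
\<close>

definition lift ::
    "('k \<Rightarrow> 'w::ab_group_add \<Rightarrow> 'w) \<Rightarrow> nat set \<Rightarrow> ('v list \<Rightarrow> 'w) \<Rightarrow> ('k, 'v) tensor \<Rightarrow> 'w" where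
  "lift scaleW D h = (SOME g. Vector_Spaces.linear tscale scaleW g \<and>
                              (\<forall>vs. length vs \<in> D \<longrightarrow> g (pure vs) = h vs))"

text \<open>Linearity of a map defined on \<open>V\<^sup>\<otimes>\<^sup>n\<close>.\<close>

definition linear_on_tpow ::
    "('k \<Rightarrow> 'w::ab_group_add \<Rightarrow> 'w) \<Rightarrow> nat \<Rightarrow> (('k, 'v) tensor \<Rightarrow> 'w) \<Rightarrow> bool" where
  "linear_on_tpow scaleW n f \<longleftrightarrow>
     (\<forall>x\<in>tpow n. \<forall>y\<in>tpow n. f (x + y) = f x + f y) \<and>
     (\<forall>c. \<forall>x\<in>tpow n. f (tscale c x) = scaleW c (f x))"

lemma vector_space_tscale: "vector_space (tscale :: 'k \<Rightarrow> ('k, 'v) tensor \<Rightarrow> _)"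
  by unfold_locales (auto simp: tscale_def plus_fun_def algebra_simps)

lemma vector_space_mult: "vector_space ((*) :: 'k \<Rightarrow> 'k \<Rightarrow> 'k)"
  by unfold_locales (auto simp: algebra_simps)

lemma multilinear_pure:
  assumes "vector_space scale"
  shows "multilinear tscale n pure"
proof -
  have "pure (us @ (v + w) # vs) = pure (us @ v # vs) + pure (us @ w # vs)"
    and "pure (us @ scale c v # vs) = tscale c (pure (us @ v # vs))" for us vs v w c
    by (auto simp: pure_def multilinear_def Vector_Spaces.linear_iff tscale_def plus_fun_def
        intro!: ext)
  then show ?thesis
    using assms vector_space_tscale by (auto simp: multilinear_def Vector_Spaces.linear_iff)
qed

lemma functionals_separate:
  assumes "vector_space (scaleW :: 'k \<Rightarrow> 'w::ab_group_add \<Rightarrow> 'w)"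
    and "\<And>\<phi>. Vector_Spaces.linear scaleW (*) \<phi> \<Longrightarrow> \<phi> w = 0"
  shows "w = 0"
proof (rule ccontr)
  assume "w \<noteq> 0"
  interpret vector_space_pair scaleW "(*) :: 'k \<Rightarrow> 'k \<Rightarrow> 'k"
    using assms(1) vector_space_mult by (simp add: vector_space_pair_def)
  have "vs1.independent {w}"
    using \<open>w \<noteq> 0\<close> by (simp add: vs1.independent_insert vs1.independent_empty)
  from linear_independent_extend[OF this, of "\<lambda>_. 1"] show False
    using assms(2) by force
qed

lemma lift_exists:
  assumes V: "vector_space scale"
    and W: "vector_space (scaleW :: 'k \<Rightarrow> 'w::ab_group_add \<Rightarrow> 'w)"
    and h: "\<And>n. n \<in> D \<Longrightarrow> multilinear scaleW n h"
  shows "\<exists>g. Vector_Spaces.linear tscale scaleW g \<and>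
             (\<forall>vs. length vs \<in> D \<longrightarrow> g (pure vs) = h vs)"
proof -
  interpret T: vector_space "tscale :: 'k \<Rightarrow> ('k, 'v) tensor \<Rightarrow> _"
    by (rule vector_space_tscale)
  interpret W: vector_space scaleW
    by (rule W)
  interpret vector_space_pair "tscale :: 'k \<Rightarrow> ('k, 'v) tensor \<Rightarrow> _" scaleW ..
  define S where "S = pure ` {vs. length vs \<in> D}"
  obtain B where B: "B \<subseteq> S" "T.independent B" "S \<subseteq> T.span B"
    using T.maximal_independent_subset[of S] by blast
  have "\<exists>vs. length vs \<in> D \<and> pure vs = b" if "b \<in> B" for b
    using that B(1) by (auto simp: S_def)
  then obtain word where word: "\<And>b. b \<in> B \<Longrightarrow> length (word b) \<in> D \<and> pure (word b) = b"
    by metis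
  obtain g where g: "Vector_Spaces.linear tscale scaleW g" "\<And>b. b \<in> B \<Longrightarrow> g b = h (word b)"
    using linear_independent_extend[OF B(2), of "\<lambda>b. h (word b)"] by auto
  interpret g: Vector_Spaces.linear tscale scaleW g
    by (rule g(1))
  have "g (pure vs) = h vs" if vs: "length vs \<in> D" for vs
  proof -
    define r where "r = T.representation B (pure vs)"
    define A where "A = {b. r b \<noteq> 0}"
    have A: "A \<subseteq> B" "finite A"
      using T.finite_representation[of B "pure vs"] T.representation_ne_zero[of B "pure vs"]
      by (auto simp: A_def r_def)
    have rep: "(\<Sum>b\<in>A. tscale (r b) b) = pure vs"
      unfolding A_def r_def using B vs
      by (intro T.sum_nonzero_representation_eq) (auto simp: S_def)
    have gsum: "g (pure vs) = (\<Sum>b\<in>A. scaleW (r b) (h (word b)))"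
      unfolding rep[symmetric] g.sum using A g(2) by (auto simp: g.scale intro!: sum.cong)
    have "\<phi> (g (pure vs) - h vs) = 0" if \<phi>: "Vector_Spaces.linear scaleW (*) \<phi>" for \<phi>
    proof -
      interpret \<phi>: Vector_Spaces.linear scaleW "(*)" \<phi>
        by (rule \<phi>)
      have ml: "multilinear (*) n (\<lambda>ws. \<phi> (h ws))" if "n \<in> D" for n
        using h[OF that] Vector_Spaces.linear_compose[OF _ \<phi>]
        by (fastforce simp: multilinear_def o_def)
      have ev: "pure ws (\<lambda>ws. \<phi> (h ws)) = \<phi> (h ws)" if "length ws \<in> D" for ws
        using ml[OF that] by (simp add: pure_def)
      have sum_ev: "(\<Sum>b\<in>C. tscale (r b) b) F = (\<Sum>b\<in>C. r b * b F)" if "finite C" for C F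
        using that by (induction C) (auto simp: tscale_def)
      have "\<phi> (h vs) = (\<Sum>b\<in>A. tscale (r b) b) (\<lambda>ws. \<phi> (h ws))"
        using ev[OF vs] rep by simp
      also have "\<dots> = (\<Sum>b\<in>A. r b * b (\<lambda>ws. \<phi> (h ws)))"
        by (rule sum_ev[OF A(2)])
      also have "\<dots> = (\<Sum>b\<in>A. r b * \<phi> (h (word b)))"
      proof (rule sum.cong)
        fix b assume "b \<in> A"
        then have "length (word b) \<in> D" "pure (word b) = b"
          using A(1) word by auto
        then show "r b * b (\<lambda>ws. \<phi> (h ws)) = r b * \<phi> (h (word b))"
          using ev[of "word b"] by simp
      qed simp
      also have "\<dots> = \<phi> (g (pure vs))"
        by (simp add: gsum \<phi>.sum \<phi>.scale)
      finally show ?thesis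
        by (simp add: \<phi>.diff)
    qed
    then have "g (pure vs) - h vs = 0"
      by (rule functionals_separate[OF W])
    then show ?thesis
      by simp
  qed
  with g(1) show ?thesis
    by blast
qed

lemma
  assumes "vector_space scale" and "vector_space scaleW"
    and "\<And>n. n \<in> D \<Longrightarrow> multilinear scaleW n h"
  shows linear_lift: "Vector_Spaces.linear tscale scaleW (lift scaleW D h)"
    and lift_pure: "length vs \<in> D \<Longrightarrow> lift scaleW D h (pure vs) = h vs"
  using someI_ex[OF lift_exists[OF assms]] unfolding lift_def by blast+

lemma tpow_unique:
  assumes f: "linear_on_tpow scaleW n f" and g: "linear_on_tpow scaleW n g"
    and eq: "\<And>vs. length vs = n \<Longrightarrow> f (pure vs) = g (pure vs)"
    and W: "vector_space (scaleW :: 'k \<Rightarrow> 'w::ab_group_add \<Rightarrow> 'w)" and x: "x \<in> tpow n"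
  shows "f x = g x"
proof -
  interpret T: vector_space "tscale :: 'k \<Rightarrow> ('k, 'v) tensor \<Rightarrow> _"
    by (rule vector_space_tscale)
  interpret W: vector_space scaleW
    by (rule W)
  have zero: "(0 :: ('k, 'v) tensor) \<in> tpow n"
    unfolding tpow_def by (rule T.span_zero)
  then have f0: "f 0 = 0" and g0: "g 0 = 0"
    using f g unfolding linear_on_tpow_def by (metis T.scale_zero_left W.scale_zero_left)+
  from x have "x \<in> T.span (pure ` {vs. length vs = n})"
    by (simp add: tpow_def)
  then have "x \<in> tpow n \<and> f x = g x"
  proof (induction rule: T.span_induct_alt)
    case base
    then show ?case
      using zero f0 g0 by metis
  next
    case (step c b y)
    have b: "b \<in> tpow n"
      using step(1) unfolding tpow_def by (rule T.span_base)
    then have cb: "tscale c b \<in> tpow n"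
      unfolding tpow_def by (rule T.span_scale)
    then have "tscale c b + y \<in> tpow n"
      using step(2) unfolding tpow_def by (blast intro: T.span_add)
    moreover have "f b = g b"
      using step(1) eq by auto
    ultimately show ?case
      using f g b cb step(2) unfolding linear_on_tpow_def by (metis (no_types))
  qed
  then show ?thesis
    by simp
qed

text \<open>The concatenation product \<open>x \<otimes> y\<close> on \<open>T(V)\<close>.\<close>

definition tconc :: "('k, 'v) tensor \<Rightarrow> ('k, 'v) tensor \<Rightarrow> ('k, 'v) tensor" where
  "tconc x y =
     lift tscale UNIV (\<lambda>us. lift tscale UNIV (\<lambda>vs. pure (us @ vs)) y) x"

text \<open>\<open>f \<otimes> g\<close> for linear maps \<open>f\<close> and \<open>g\<close> from \<open>V\<^sup>\<otimes>\<^sup>p\<close> and \<open>V\<^sup>\<otimes>\<^sup>q\<close> to tensor powers of \<open>V\<close>.\<close>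

definition tmap :: "nat \<Rightarrow> nat \<Rightarrow> (('k, 'v) tensor \<Rightarrow> ('k, 'v) tensor) \<Rightarrow>
    (('k, 'v) tensor \<Rightarrow> ('k, 'v) tensor) \<Rightarrow> ('k, 'v) tensor \<Rightarrow> ('k, 'v) tensor" where
  "tmap p q f g =
     lift tscale {p + q} (\<lambda>ws. tconc (f (pure (take p ws))) (g (pure (drop p ws))))"

text \<open>A \<open>V\<close>-valued map, regarded as a map into \<open>V\<^sup>\<otimes>\<^sup>1\<close>.\<close>

definition to_tensor :: "(('k, 'v) tensor \<Rightarrow> 'v) \<Rightarrow> ('k, 'v) tensor \<Rightarrow> ('k, 'v) tensor" where
  "to_tensor f x = pure [f x]"


section \<open>Braidings\<close>

text \<open>\<open>sigma_at \<sigma> n i\<close> is \<open>\<sigma>\<^sub>i\<close> on \<open>V\<^sup>\<otimes>\<^sup>n\<close>, acting on the factors \<open>i\<close> and \<open>i + 1\<close>, where \<open>1 \<le> i < n\<close>.\<close>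

definition sigma_at :: "(('k, 'v) tensor \<Rightarrow> ('k, 'v) tensor) \<Rightarrow> nat \<Rightarrow> nat \<Rightarrow>
    ('k, 'v) tensor \<Rightarrow> ('k, 'v) tensor" where
  "sigma_at \<sigma> n i = tmap (i - 1) (n + 1 - i) id (tmap 2 (n - 1 - i) \<sigma> id)"

definition braided_vector_space :: "(('k, 'v) tensor \<Rightarrow> ('k, 'v) tensor) \<Rightarrow> bool" where
  "braided_vector_space \<sigma> \<longleftrightarrow>
     vector_space scale \<and>
     linear_on_tpow tscale 2 \<sigma> \<and> bij_betw \<sigma> (tpow 2) (tpow 2) \<and>
     (\<forall>x\<in>tpow 3. sigma_at \<sigma> 3 1 (sigma_at \<sigma> 3 2 (sigma_at \<sigma> 3 1 x)) =
                 sigma_at \<sigma> 3 2 (sigma_at \<sigma> 3 1 (sigma_at \<sigma> 3 2 x)))"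

definition unital_assoc_algebra :: "('v \<Rightarrow> 'v \<Rightarrow> 'v) \<Rightarrow> 'v \<Rightarrow> bool" where
  "unital_assoc_algebra m e \<longleftrightarrow>
     vector_space scale \<and>
     (\<forall>a. Vector_Spaces.linear scale scale (\<lambda>b. m a b)) \<and>
     (\<forall>b. Vector_Spaces.linear scale scale (\<lambda>a. m a b)) \<and>
     (\<forall>a b c. m (m a b) c = m a (m b c)) \<and>
     (\<forall>a. m e a = a \<and> m a e = a)"

text \<open>The multiplication as a linear map \<open>V \<otimes> V \<rightarrow> V\<close>.\<close>

definition mult_map :: "('v \<Rightarrow> 'v \<Rightarrow> 'v) \<Rightarrow> ('k, 'v) tensor \<Rightarrow> 'v" where
  "mult_map m = lift scale {2} (\<lambda>vs. m (vs ! 0) (vs ! 1))"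

definition braided_algebra ::
    "('v \<Rightarrow> 'v \<Rightarrow> 'v) \<Rightarrow> 'v \<Rightarrow> (('k, 'v) tensor \<Rightarrow> ('k, 'v) tensor) \<Rightarrow> bool" where
  "braided_algebra m e \<sigma> \<longleftrightarrow>
     unital_assoc_algebra m e \<and> braided_vector_space \<sigma> \<and>
     (\<forall>x\<in>tpow 3. \<sigma> (tmap 2 1 (to_tensor (mult_map m)) id x) =
        tmap 1 2 id (to_tensor (mult_map m)) (sigma_at \<sigma> 3 1 (sigma_at \<sigma> 3 2 x))) \<and>
     (\<forall>x\<in>tpow 3. \<sigma> (tmap 1 2 id (to_tensor (mult_map m)) x) =
        tmap 2 1 (to_tensor (mult_map m)) id (sigma_at \<sigma> 3 2 (sigma_at \<sigma> 3 1 x))) \<and>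
     (\<forall>a. \<sigma> (pure [e, a]) = pure [a, e]) \<and>
     (\<forall>a. \<sigma> (pure [a, e]) = pure [e, a])"

definition unital_two_braided_algebra :: "('v \<Rightarrow> 'v \<Rightarrow> 'v) \<Rightarrow> ('v \<Rightarrow> 'v \<Rightarrow> 'v) \<Rightarrow> 'v \<Rightarrow>
    (('k, 'v) tensor \<Rightarrow> ('k, 'v) tensor) \<Rightarrow> bool" where
  "unital_two_braided_algebra ast dot e \<sigma> \<longleftrightarrow>
     braided_vector_space \<sigma> \<and> braided_algebra ast e \<sigma> \<and> braided_algebra dot e \<sigma>"

text \<open>The product \<open>s\<^bsub>i\<^sub>1\<^esub> \<cdots> s\<^bsub>i\<^sub>l\<^esub>\<close> of simple transpositions, composed as functions.\<close>

definition word_perm :: "nat list \<Rightarrow> nat \<Rightarrow> nat" where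
  "word_perm is = foldr (\<lambda>i f. transpose i (Suc i) \<circ> f) is id"

definition reduced_expression :: "nat \<Rightarrow> (nat \<Rightarrow> nat) \<Rightarrow> nat list \<Rightarrow> bool" where
  "reduced_expression n w is \<longleftrightarrow>
     set is \<subseteq> {1..<n} \<and> word_perm is = w \<and>
     (\<forall>js. set js \<subseteq> {1..<n} \<and> word_perm js = w \<longrightarrow> length is \<le> length js)"

text \<open>\<open>T\<^sup>\<sigma>\<^sub>w\<close> for \<open>w \<in> S\<^sub>n\<close>; by the braid relation it does not depend on the reduced expression.\<close>

definition T_perm :: "(('k, 'v) tensor \<Rightarrow> ('k, 'v) tensor) \<Rightarrow> nat \<Rightarrow> (nat \<Rightarrow> nat) \<Rightarrow>
    ('k, 'v) tensor \<Rightarrow> ('k, 'v) tensor" where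
  "T_perm \<sigma> n w =
     foldr (\<lambda>i f. sigma_at \<sigma> n i \<circ> f) (SOME is. reduced_expression n w is) id"

definition chi :: "nat \<Rightarrow> nat \<Rightarrow> nat \<Rightarrow> nat" where
  "chi i j k = (if 1 \<le> k \<and> k \<le> i then j + k
                else if i + 1 \<le> k \<and> k \<le> i + j then k - i else k)"

text \<open>
  \<open>\<beta>\<^sub>i\<^sub>j\<close>, as a map on \<open>V\<^sup>\<otimes>\<^sup>(\<^sup>i\<^sup>+\<^sup>j\<^sup>)\<close>. If \<open>i = 0\<close> or \<open>j = 0\<close>, then \<open>chi i j = id\<close> and this is the
  identity, which is the flip under \<open>K \<otimes> V\<^sup>\<otimes>\<^sup>n = V\<^sup>\<otimes>\<^sup>n = V\<^sup>\<otimes>\<^sup>n \<otimes> K\<close>.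
\<close>

definition beta :: "(('k, 'v) tensor \<Rightarrow> ('k, 'v) tensor) \<Rightarrow> nat \<Rightarrow> nat \<Rightarrow>
    ('k, 'v) tensor \<Rightarrow> ('k, 'v) tensor" where
  "beta \<sigma> i j = T_perm \<sigma> (i + j) (chi i j)"


section \<open>The coproduct on $T(V) \otimes T(V)$\<close>

text \<open>
  The component of \<open>(id \<otimes> \<beta> \<otimes> id) \<circ> (\<delta> \<otimes> \<delta>)\<close> from \<open>V\<^sup>\<otimes>\<^sup>(\<^sup>a\<^sup>+\<^sup>c\<^sup>) \<otimes> V\<^sup>\<otimes>\<^sup>(\<^sup>b\<^sup>+\<^sup>d\<^sup>)\<close> to
  \<open>(V\<^sup>\<otimes>\<^sup>a \<otimes> V\<^sup>\<otimes>\<^sup>b) \<otimes> (V\<^sup>\<otimes>\<^sup>c \<otimes> V\<^sup>\<otimes>\<^sup>d)\<close>. The component of \<open>\<delta> \<otimes> \<delta>\<close> with values in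
  \<open>V\<^sup>\<otimes>\<^sup>a \<otimes> V\<^sup>\<otimes>\<^sup>c \<otimes> V\<^sup>\<otimes>\<^sup>b \<otimes> V\<^sup>\<otimes>\<^sup>d\<close> is the identity of \<open>V\<^sup>\<otimes>\<^sup>(\<^sup>a\<^sup>+\<^sup>c\<^sup>+\<^sup>b\<^sup>+\<^sup>d\<^sup>)\<close>.
\<close>

definition coprod :: "(('k, 'v) tensor \<Rightarrow> ('k, 'v) tensor) \<Rightarrow> nat \<times> nat \<Rightarrow> nat \<times> nat \<Rightarrow>
    ('k, 'v) tensor \<Rightarrow> ('k, 'v) tensor" where
  "coprod \<sigma> = (\<lambda>(a, b) (c, d). tmap a (c + b + d) id (tmap (c + b) d (beta \<sigma> c b) id))"

abbreviation fst_sum :: "(nat \<times> nat) list \<Rightarrow> nat" where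
  "fst_sum ps \<equiv> sum_list (map fst ps)"

abbreviation snd_sum :: "(nat \<times> nat) list \<Rightarrow> nat" where
  "snd_sum ps \<equiv> sum_list (map snd ps)"

text \<open>
  For \<open>ps = [(i\<^sub>1, j\<^sub>1), \<dots>, (i\<^sub>k, j\<^sub>k)]\<close> with \<open>k \<ge> 1\<close>, the \<open>(i\<^sub>1, j\<^sub>1, \<dots>, i\<^sub>k, j\<^sub>k)\<close> component of the
  \<open>(k - 1)\<close>-st iterated coproduct, following the recursion in which the iterate of order
  \<open>k - 2\<close> is applied to the left factor.
\<close>

function iter_coprod :: "(('k, 'v) tensor \<Rightarrow> ('k, 'v) tensor) \<Rightarrow> (nat \<times> nat) list \<Rightarrow>
    ('k, 'v) tensor \<Rightarrow> ('k, 'v) tensor" where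
  "iter_coprod \<sigma> [] = id"
| "iter_coprod \<sigma> [ij] = id"
| "ps \<noteq> [] \<Longrightarrow> iter_coprod \<sigma> (ps @ [(c, d)]) =
     tmap (fst_sum ps + snd_sum ps) (c + d) (iter_coprod \<sigma> ps) id
       \<circ> coprod \<sigma> (fst_sum ps, snd_sum ps) (c, d)"
  by (atomize_elim, metis prod.exhaust rev_exhaust append_Nil) auto
termination by (relation "measure (\<lambda>(\<sigma>, ps). length ps)") auto


section \<open>Quantum multi-brace algebras\<close>

text \<open>
  \<open>mtensor M [(i\<^sub>1, j\<^sub>1), \<dots>, (i\<^sub>k, j\<^sub>k)]\<close> is \<open>M\<^bsub>i\<^sub>1j\<^sub>1\<^esub> \<otimes> \<cdots> \<otimes> M\<^bsub>i\<^sub>kj\<^sub>k\<^esub>\<close>, with values in \<open>V\<^sup>\<otimes>\<^sup>k\<close>.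
\<close>

fun mtensor :: "(nat \<Rightarrow> nat \<Rightarrow> ('k, 'v) tensor \<Rightarrow> 'v) \<Rightarrow> (nat \<times> nat) list \<Rightarrow>
    ('k, 'v) tensor \<Rightarrow> ('k, 'v) tensor" where
  "mtensor M [] = id"
| "mtensor M ((i, j) # ps) =
     tmap (i + j) (fst_sum ps + snd_sum ps) (to_tensor (M i j)) (mtensor M ps)"

lemma mtensor_cong [fundef_cong]:
  assumes "ps = qs" and "\<And>i j. (i, j) \<in> set qs \<Longrightarrow> M i j = N i j"
  shows "mtensor M ps = mtensor N qs"
  using assms(2) unfolding assms(1) by (induction N qs rule: mtensor.induct) auto

text \<open>The pairs \<open>(I\<^sub>k, J\<^sub>k)\<close> of \<open>k\<close>-tuples with sums \<open>p\<close> and \<open>q\<close>, zipped to lists of pairs.\<close>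

definition tuples :: "nat \<Rightarrow> nat \<Rightarrow> nat \<Rightarrow> (nat \<times> nat) list set" where
  "tuples k p q = {ps. length ps = k \<and> fst_sum ps = p \<and> snd_sum ps = q}"

text \<open>The restriction of \<open>M\<^sup>\<otimes>\<^sup>r \<circ> \<Delta>\<^sub>\<beta>\<^sup>(\<^sup>r\<^sup>-\<^sup>1\<^sup>)\<close> to \<open>V\<^sup>\<otimes>\<^sup>p \<otimes> V\<^sup>\<otimes>\<^sup>q\<close>.\<close>

definition star_comp :: "(('k, 'v) tensor \<Rightarrow> ('k, 'v) tensor) \<Rightarrow>
    (nat \<Rightarrow> nat \<Rightarrow> ('k, 'v) tensor \<Rightarrow> 'v) \<Rightarrow> nat \<Rightarrow> nat \<Rightarrow> nat \<Rightarrow>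
    ('k, 'v) tensor \<Rightarrow> ('k, 'v) tensor" where
  "star_comp \<sigma> M r p q x = (\<Sum>ps\<in>tuples r p q. mtensor M ps (iter_coprod \<sigma> ps x))"

definition quantum_multi_brace_algebra :: "(nat \<Rightarrow> nat \<Rightarrow> ('k, 'v) tensor \<Rightarrow> 'v) \<Rightarrow>
    (('k, 'v) tensor \<Rightarrow> ('k, 'v) tensor) \<Rightarrow> bool" where
  "quantum_multi_brace_algebra M \<sigma> \<longleftrightarrow>
     braided_vector_space \<sigma> \<and>
     (\<forall>p q. linear_on_tpow scale (p + q) (M p q)) \<and>
     (\<forall>x\<in>tpow 0. M 0 0 x = 0) \<and>
     (\<forall>v. M 1 0 (pure [v]) = v \<and> M 0 1 (pure [v]) = v) \<and>
     (\<forall>n\<ge>2. \<forall>x\<in>tpow n. M n 0 x = 0 \<and> M 0 n x = 0) \<and>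
     (\<forall>i\<ge>1. \<forall>j\<ge>1. \<forall>k\<ge>1. \<forall>x\<in>tpow (i + j + k).
        beta \<sigma> 1 k (tmap (i + j) k (to_tensor (M i j)) id x) =
        tmap k (i + j) id (to_tensor (M i j)) (beta \<sigma> (i + j) k x)) \<and>
     (\<forall>i\<ge>1. \<forall>j\<ge>1. \<forall>k\<ge>1. \<forall>x\<in>tpow (i + j + k).
        beta \<sigma> i 1 (tmap i (j + k) id (to_tensor (M j k)) x) =
        tmap (j + k) i (to_tensor (M j k)) id (beta \<sigma> i (j + k) x)) \<and>
     (\<forall>i\<ge>1. \<forall>j\<ge>1. \<forall>k\<ge>1. \<forall>x\<in>tpow (i + j + k).
        (\<Sum>r=1..i+j. M r k (tmap (i + j) k (star_comp \<sigma> M r i j) id x)) =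
        (\<Sum>l=1..j+k. M i l (tmap i (j + k) id (star_comp \<sigma> M l j k) x)))"


section \<open>The multi-brace structure of a 2-braided algebra\<close>

fun list_prod :: "('v \<Rightarrow> 'v \<Rightarrow> 'v) \<Rightarrow> 'v list \<Rightarrow> 'v" where
  "list_prod m [] = undefined"
| "list_prod m [v] = v"
| "list_prod m (v # w # vs) = m v (list_prod m (w # vs))"

text \<open>The map \<open>V\<^sup>\<otimes>\<^sup>(\<^sup>k\<^sup>+\<^sup>1\<^sup>) \<rightarrow> V\<close> given by the \<open>k\<close>-fold product.\<close>

definition iter_mult :: "('v \<Rightarrow> 'v \<Rightarrow> 'v) \<Rightarrow> nat \<Rightarrow> ('k, 'v) tensor \<Rightarrow> 'v" where
  "iter_mult m k = lift scale {k + 1} (list_prod m)"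

text \<open>
  Tuples with an entry \<open>(0, 0)\<close> contribute \<open>0\<close> because \<open>M\<^sub>0\<^sub>0 = 0\<close>. They are left out of the sum, so
  that \<open>M\<^sub>p\<^sub>q\<close> only refers to \<open>M\<^sub>i\<^sub>j\<close> with \<open>i + j < p + q\<close>.
\<close>

function brace :: "('v \<Rightarrow> 'v \<Rightarrow> 'v) \<Rightarrow> ('v \<Rightarrow> 'v \<Rightarrow> 'v) \<Rightarrow>
    (('k, 'v) tensor \<Rightarrow> ('k, 'v) tensor) \<Rightarrow> nat \<Rightarrow> nat \<Rightarrow> ('k, 'v) tensor \<Rightarrow> 'v" where
  "brace ast dot \<sigma> p q =
     (if p = 0 \<or> q = 0 then
        (if p + q = 1 then lift scale {1} hd else (\<lambda>_. 0))
      else lift scale {p + q} (\<lambda>ws.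
        ast (list_prod dot (take p ws)) (list_prod dot (drop p ws))
        - (\<Sum>k=2..p+q. \<Sum>ps\<in>{ps \<in> tuples k p q. (0, 0) \<notin> set ps}.
             iter_mult dot (k - 1)
               (mtensor (brace ast dot \<sigma>) ps (iter_coprod \<sigma> ps (pure ws))))))"
  by pat_completeness auto
termination
proof (relation "measure (\<lambda>(ast, dot, \<sigma>, p, q). p + q)", goal_cases)
  case 1
  then show ?case
    by simp
next
  case (2 ast dot \<sigma> p q ws k ps i j)
  then have len: "length ps \<ge> 2" and sums: "fst_sum ps = p" "snd_sum ps = q"
    and nz: "(0, 0) \<notin> set ps" and ij: "(i, j) \<in> set ps"
    by (auto simp: tuples_def)
  obtain as bs where ps: "ps = as @ (i, j) # bs"
    using ij by (meson split_list)
  then obtain a b where ab: "(a, b) \<in> set (as @ bs)"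
    using len by (cases "as @ bs") auto
  have "a + b > 0"
    using ab nz ps by (cases "a + b = 0") auto
  moreover have "a \<le> fst_sum (as @ bs)"
    by (rule member_le_sum_list; use ab in force)
  moreover have "b \<le> snd_sum (as @ bs)"
    by (rule member_le_sum_list; use ab in force)
  ultimately show ?case
    using sums unfolding ps by auto
qed

declare brace.simps [simp del]

end

end

theory Submission
  imports Defs
begin

text \<open>
  Writing \<open>x \<star> y\<close> for the sum over \<open>r\<close> of \<open>M\<^sup>\<otimes>\<^sup>r \<circ> \<Delta>\<^sub>\<beta>\<^sup>(\<^sup>r\<^sup>-\<^sup>1\<^sup>)\<close>, condition (3) says that the
  \<open>V\<close>-components of \<open>(x \<star> y) \<star> z\<close> and \<open>x \<star> (y \<star> z)\<close> agree. Let \<open>\<pi>(v\<^sub>1 \<otimes> \<dots> \<otimes> v\<^sub>n)\<close> be the \<open>\<cdot>\<close>-product of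
  \<open>v\<^sub>1, \<dots>, v\<^sub>n\<close>. The recursion for \<open>M\<close> says precisely that \<open>\<pi>(x \<star> y) = \<pi>(x) \<ast> \<pi>(y)\<close>, so associativity of
  \<open>\<ast>\<close> gives \<open>\<pi>((x \<star> y) \<star> z) = \<pi>(x \<star> (y \<star> z))\<close>. Both triple products are coalgebra maps from
  \<open>T(V) \<otimes> T(V) \<otimes> T(V)\<close> with its braided coproduct to \<open>T(V)\<close> with deconcatenation, hence their components in
  \<open>V\<^sup>\<otimes>\<^sup>r\<close> for \<open>r \<ge> 2\<close> are determined by their \<open>V\<close>-components in lower degree, and \<open>\<pi>\<close> recovers the
  \<open>V\<close>-component from these: the two products agree by induction on the degree. That
  they are coalgebra maps rests on the hexagon identities for \<open>\<beta>\<close>, which come from Matsumoto's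
  theorem, and on condition (2), which says that the \<open>M\<^sub>p\<^sub>q\<close> are natural for \<open>\<beta>\<close>.
\<close>

text \<open>\<open>brace\<close> is given by a \<open>lift\<close>, about which nothing is known
  until the lifted function is multilinear, and multilinearity rests on the lower \<open>M\<close>.
  Linearity, condition (2) and the recursion as an equation of linear maps are therefore obtained by
  induction on \<open>p + q\<close>. Condition (2) passes through the recursion because maps that
  slide through the braiding are closed under composition, tensor products, sums and differences,
  and because sliding past one strand implies sliding past \<open>k\<close> strands by the hexagons.
  In the induction for associativity, a component with \<open>r >= 2\<close> splits into a factor
  with values in degree 1 and one with values in degree \<open>r - 1 >= 1\<close>. Such factors
  vanish on total degree 0, so only splittings into two parts of positive, hence smaller, total
  degree survive. The component \<open>r = 1\<close> is then isolated because the one-fold product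
  is the identity. The hexagons need no computation with braids: the word of a composite of block
  crossings has as many letters as \<open>chi\<close> has inversions, hence is reduced.\<close>

section \<open>Concatenation of tensors\<close>

text \<open>Tensors are functions, and their sums must not be unfolded pointwise.\<close>

declare zero_fun_apply [simp del] plus_fun_apply [simp del] minus_apply [simp del]

locale tensor_powers =
  fixes scale :: "'k::field_char_0 \<Rightarrow> 'v::ab_group_add \<Rightarrow> 'v"
  assumes vector_space_scale: "vector_space scale"
begin

sublocale T: vector_space "tscale :: 'k \<Rightarrow> ('k, 'v) tensor \<Rightarrow> _"
  by (rule vector_space_tscale)

abbreviation pu :: "'v list \<Rightarrow> ('k, 'v) tensor" where "pu \<equiv> pure scale"
abbreviation tp :: "nat \<Rightarrow> ('k, 'v) tensor set" where "tp \<equiv> tpow scale"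
abbreviation lin :: "nat \<Rightarrow> (('k, 'v) tensor \<Rightarrow> ('k, 'v) tensor) \<Rightarrow> bool" where
  "lin \<equiv> linear_on_tpow scale tscale"

lemma pure_in_tpow: "length vs = n \<Longrightarrow> pu vs \<in> tp n"
  unfolding tpow_def by (rule T.span_base) auto

lemma tpow_closed:
  "0 \<in> tp n" "x \<in> tp n \<Longrightarrow> y \<in> tp n \<Longrightarrow> x + y \<in> tp n" "x \<in> tp n \<Longrightarrow> tscale c x \<in> tp n"
  "x \<in> tp n \<Longrightarrow> y \<in> tp n \<Longrightarrow> x - y \<in> tp n"
  unfolding tpow_def by (auto intro: T.span_zero T.span_add T.span_scale T.span_diff)

lemma tpow_sum: "(\<And>a. a \<in> A \<Longrightarrow> F a \<in> tp n) \<Longrightarrow> sum F A \<in> tp n"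
  unfolding tpow_def by (rule T.span_sum)

lemma tpow_induct [consumes 1, case_names zero step]:
  assumes "x \<in> tp n" and "P 0"
    and "\<And>c vs y. length vs = n \<Longrightarrow> y \<in> tp n \<Longrightarrow> P y \<Longrightarrow> P (tscale c (pu vs) + y)"
  shows "P x"
proof -
  have "x \<in> T.span (pu ` {vs. length vs = n})"
    using assms(1) by (simp add: tpow_def)
  then have "x \<in> tp n \<and> P x"
  proof (induction rule: T.span_induct_alt)
    case base
    then show ?case using assms(2) tpow_closed(1) by simp
  next
    case (step c b y)
    then obtain vs where vs: "length vs = n" "b = pu vs" by auto
    then show ?case
      using step assms(3) by (auto intro!: tpow_closed pure_in_tpow)
  qed
  then show ?thesis by simp
qed

lemma linear_on_tpow_linear:
  assumes "Vector_Spaces.linear tscale scaleW g"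
  shows "linear_on_tpow scale scaleW n g"
  using assms by (simp add: linear_on_tpow_def Vector_Spaces.linear_iff)

lemma linear_on_tpow_zero:
  assumes "linear_on_tpow scale scaleW n f" "vector_space scaleW"
  shows "f 0 = 0"
proof -
  interpret W: vector_space scaleW by fact
  have "f (tscale 0 0) = scaleW 0 (f 0)"
    using assms(1) tpow_closed(1) unfolding linear_on_tpow_def by blast
  then show ?thesis by simp
qed

lemma lin_zero: "lin n f \<Longrightarrow> f 0 = 0"
  using linear_on_tpow_zero vector_space_tscale by blast

lemma lin_range:
  assumes "lin m f" and "\<And>vs. length vs = m \<Longrightarrow> f (pu vs) \<in> tp n" and "x \<in> tp m"
  shows "f x \<in> tp n"
  using assms(3)
proof (induction rule: tpow_induct)
  case zero
  then show ?case using lin_zero[OF assms(1)] tpow_closed(1) by simp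
next
  case (step c vs y)
  have "f (tscale c (pu vs) + y) = tscale c (f (pu vs)) + f y"
    using assms(1) step pure_in_tpow[OF step(1)] tpow_closed unfolding linear_on_tpow_def by metis
  then show ?case using step assms(2) by (simp add: tpow_closed(2,3))
qed

lemma lin_eqI:
  assumes "lin m f" "lin m g" and "\<And>vs. length vs = m \<Longrightarrow> f (pu vs) = g (pu vs)" and "x \<in> tp m"
  shows "f x = g x"
  using tpow_unique[OF assms(1,2,3) vector_space_tscale assms(4)] by simp

lemma lift_cong:
  assumes "\<And>vs. length vs \<in> D \<Longrightarrow> h vs = h' vs"
  shows "lift scale s D h = lift scale s D h'"
proof -
  have "(\<lambda>g. Vector_Spaces.linear tscale s g \<and> (\<forall>vs. length vs \<in> D \<longrightarrow> g (pu vs) = h vs)) =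
        (\<lambda>g. Vector_Spaces.linear tscale s g \<and> (\<forall>vs. length vs \<in> D \<longrightarrow> g (pu vs) = h' vs))"
    using assms by auto
  then show ?thesis unfolding lift_def by simp
qed

lemma multilinear_iff:
  assumes "vector_space sW"
  shows "multilinear scale sW n h \<longleftrightarrow>
    (\<forall>us vs v w. length us + 1 + length vs = n \<longrightarrow> h (us @ (v + w) # vs) = h (us @ v # vs) + h (us @ w # vs)) \<and>
    (\<forall>us vs c v. length us + 1 + length vs = n \<longrightarrow> h (us @ scale c v # vs) = sW c (h (us @ v # vs)))"
  using assms vector_space_scale by (auto simp: multilinear_def Vector_Spaces.linear_iff)

lemma pure_add: "pu (us @ (v + w) # vs) = pu (us @ v # vs) + pu (us @ w # vs)"
  and pure_scale: "pu (us @ scale c v # vs) = tscale c (pu (us @ v # vs))"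
  using multilinear_pure[OF vector_space_scale, of "length us + 1 + length vs"]
  by (auto simp: multilinear_iff vector_space_tscale)

lemma linear_on_tpow_pure:
  assumes f: "linear_on_tpow scale sW n f" and n: "length us + 1 + length vs = n"
  shows "f (pu (us @ (v + w) # vs)) = f (pu (us @ v # vs)) + f (pu (us @ w # vs))"
    and "f (pu (us @ scale c v # vs)) = sW c (f (pu (us @ v # vs)))"
proof -
  have "pu (us @ v # vs) \<in> tp n" for v
    by (rule pure_in_tpow) (use n in auto)
  then show "f (pu (us @ (v + w) # vs)) = f (pu (us @ v # vs)) + f (pu (us @ w # vs))"
    and "f (pu (us @ scale c v # vs)) = sW c (f (pu (us @ v # vs)))"
    using f unfolding pure_add pure_scale linear_on_tpow_def by blast+
qed

lemma multilinear_linear_on_tpow: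
  assumes "linear_on_tpow scale sW n f" "vector_space sW"
  shows "multilinear scale sW n (\<lambda>vs. f (pu vs))"
  unfolding multilinear_iff[OF assms(2)] using linear_on_tpow_pure[OF assms(1)] by blast

definition conc_left :: "'v list \<Rightarrow> ('k, 'v) tensor \<Rightarrow> ('k, 'v) tensor" where
  "conc_left us = lift scale tscale UNIV (\<lambda>vs. pu (us @ vs))"

lemma conc_left:
  shows conc_left_linear: "Vector_Spaces.linear tscale tscale (conc_left us)"
    and conc_left_pure: "conc_left us (pu vs) = pu (us @ vs)"
proof -
  have "multilinear scale tscale n (\<lambda>vs. pu (us @ vs))" for n
    unfolding multilinear_iff[OF vector_space_tscale]
    using pure_add[of "us @ _"] pure_scale[of "us @ _"] by simp
  from linear_lift[OF vector_space_scale vector_space_tscale this]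
    lift_pure[OF vector_space_scale vector_space_tscale this]
  show "Vector_Spaces.linear tscale tscale (conc_left us)"
    and "conc_left us (pu vs) = pu (us @ vs)"
    unfolding conc_left_def by auto
qed

text \<open>Multilinearity in the word is claimed only on tensor powers: off the span of the pure
  tensors, \<open>lift\<close> picks an arbitrary linear extension for each word, and these choices
  are unrelated.\<close>

lemma conc_left_add:
  assumes "y \<in> tp q"
  shows "conc_left (us @ (v + w) # vs) y = conc_left (us @ v # vs) y + conc_left (us @ w # vs) y"
proof -
  have l: "lin q (\<lambda>y. conc_left (us @ v # vs) y + conc_left (us @ w # vs) y)"
    using conc_left_linear by (simp add: Vector_Spaces.linear_iff linear_on_tpow_def T.scale_right_distrib)
  show ?thesis
    by (rule lin_eqI[OF linear_on_tpow_linear[OF conc_left_linear] l _ assms])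
      (simp add: conc_left_pure pure_add)
qed

lemma conc_left_scale:
  assumes "y \<in> tp q"
  shows "conc_left (us @ scale c v # vs) y = tscale c (conc_left (us @ v # vs) y)"
proof -
  have l: "lin q (\<lambda>y. tscale c (conc_left (us @ v # vs) y))"
    using conc_left_linear
    by (simp add: Vector_Spaces.linear_iff linear_on_tpow_def T.scale_right_distrib mult.commute)
  show ?thesis
    by (rule lin_eqI[OF linear_on_tpow_linear[OF conc_left_linear] l _ assms])
      (simp add: conc_left_pure pure_scale)
qed

abbreviation conc (infixr "\<odot>" 70) where "conc \<equiv> tconc scale"

lemma conc_pure_left:
  assumes y: "y \<in> tp q"
  shows "pu us \<odot> y = conc_left us y"
    and conc_linear_left: "Vector_Spaces.linear tscale tscale (\<lambda>x. x \<odot> y)"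
proof -
  have ml: "multilinear scale tscale n (\<lambda>us. conc_left us y)" for n
    unfolding multilinear_iff[OF vector_space_tscale]
    using conc_left_add[OF y] conc_left_scale[OF y] by simp
  have *: "tconc scale x y = lift scale tscale UNIV (\<lambda>us. conc_left us y) x" for x
    unfolding tconc_def conc_left_def ..
  show "pu us \<odot> y = conc_left us y"
    unfolding * using lift_pure[OF vector_space_scale vector_space_tscale ml] by simp
  show "Vector_Spaces.linear tscale tscale (\<lambda>x. x \<odot> y)"
    unfolding * using linear_lift[OF vector_space_scale vector_space_tscale ml] by simp
qed

lemma conc_pure: "pu us \<odot> pu vs = pu (us @ vs)"
  using conc_pure_left[OF pure_in_tpow[OF refl]] conc_left_pure by simp

lemma conc_add_left: "y \<in> tp q \<Longrightarrow> (x + x') \<odot> y = x \<odot> y + x' \<odot> y"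
  and conc_scale_left: "y \<in> tp q \<Longrightarrow> tscale c x \<odot> y = tscale c (x \<odot> y)"
  and conc_zero_left: "y \<in> tp q \<Longrightarrow> 0 \<odot> y = 0"
  using conc_linear_left[of y q] linear_on_tpow_zero[OF linear_on_tpow_linear[OF conc_linear_left] vector_space_tscale]
  by (auto simp: Vector_Spaces.linear_iff)

lemma conc_add_right:
  assumes "x \<in> tp p" "y \<in> tp q" "y' \<in> tp q"
  shows "x \<odot> (y + y') = x \<odot> y + x \<odot> y'"
proof (rule lin_eqI[OF _ _ _ assms(1)])
  show "lin p (\<lambda>x. x \<odot> (y + y'))" "lin p (\<lambda>x. x \<odot> y + x \<odot> y')"
    using conc_add_left[OF assms(2)] conc_scale_left[OF assms(2)]
      conc_add_left[OF assms(3)] conc_scale_left[OF assms(3)]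
      conc_add_left[OF tpow_closed(2)[OF assms(2,3)]] conc_scale_left[OF tpow_closed(2)[OF assms(2,3)]]
    by (auto simp: linear_on_tpow_def T.scale_right_distrib)
  show "pu vs \<odot> (y + y') = pu vs \<odot> y + pu vs \<odot> y'" for vs
    using assms(2,3) tpow_closed(2)[OF assms(2,3)] conc_left_linear
    by (simp add: conc_pure_left Vector_Spaces.linear_iff)
qed

lemma conc_scale_right:
  assumes "x \<in> tp p" "y \<in> tp q"
  shows "x \<odot> tscale c y = tscale c (x \<odot> y)"
proof (rule lin_eqI[OF _ _ _ assms(1)])
  show "lin p (\<lambda>x. x \<odot> tscale c y)" "lin p (\<lambda>x. tscale c (x \<odot> y))"
    using conc_add_left[OF assms(2)] conc_scale_left[OF assms(2)]
      conc_add_left[OF tpow_closed(3)[OF assms(2)]] conc_scale_left[OF tpow_closed(3)[OF assms(2)]]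
    by (auto simp: linear_on_tpow_def T.scale_right_distrib mult.commute)
  show "pu vs \<odot> tscale c y = tscale c (pu vs \<odot> y)" for vs
    using conc_left_linear
    by (simp add: conc_pure_left[OF assms(2)] conc_pure_left[OF tpow_closed(3)[OF assms(2)]]
        Vector_Spaces.linear_iff)
qed

lemma conc_zero_right: "x \<in> tp p \<Longrightarrow> x \<odot> 0 = 0"
  using conc_scale_right[of x p 0 0 0] tpow_closed(1) by simp

lemma conc_in_tpow:
  assumes "x \<in> tp p" "y \<in> tp q"
  shows "x \<odot> y \<in> tp (p + q)"
  using assms(1)
proof (induction rule: tpow_induct)
  case zero
  show ?case by (simp add: conc_zero_left[OF assms(2)] tpow_closed(1))
next
  case (step c us x)
  from assms(2) have "pu us \<odot> y \<in> tp (p + q)"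
  proof (induction rule: tpow_induct)
    case zero
    then show ?case using conc_zero_right[OF pure_in_tpow[OF refl]] tpow_closed(1) by simp
  next
    case (step d vs y)
    then show ?case
      using conc_add_right[OF pure_in_tpow[OF refl] tpow_closed(3)[OF pure_in_tpow[OF step(1)]] step(2)]
        conc_scale_right[OF pure_in_tpow[OF refl] pure_in_tpow[OF step(1)]] \<open>length us = p\<close>
      by (auto simp: conc_pure intro!: tpow_closed pure_in_tpow)
  qed
  then show ?case
    using step assms(2) by (auto simp: conc_add_left conc_scale_left intro!: tpow_closed)
qed

lemma conc_linear_on_right: "x \<in> tp p \<Longrightarrow> lin q (\<lambda>y. x \<odot> y)"
  by (auto simp: linear_on_tpow_def conc_add_right conc_scale_right)

lemma conc_linear_on_left: "y \<in> tp q \<Longrightarrow> lin p (\<lambda>x. x \<odot> y)"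
  by (auto simp: linear_on_tpow_def conc_add_left conc_scale_left)

lemma lin_comp: 
  assumes "lin m f" "lin n g" "\<And>x. x \<in> tp m \<Longrightarrow> f x \<in> tp n"
  shows "lin m (\<lambda>x. g (f x))"
  using assms by (auto simp: linear_on_tpow_def)

lemma lin_cong: "(\<And>x. x \<in> tp m \<Longrightarrow> f x = g x) \<Longrightarrow> lin m f = lin m g"
  by (auto simp: linear_on_tpow_def tpow_closed)

lemma conc_assoc:
  assumes "x \<in> tp p" "y \<in> tp q" "z \<in> tp r"
  shows "(x \<odot> y) \<odot> z = x \<odot> (y \<odot> z)"
proof (rule lin_eqI[OF _ _ _ assms(1)])
  show "lin p (\<lambda>x. (x \<odot> y) \<odot> z)" 
    using lin_comp[OF conc_linear_on_left conc_linear_on_left conc_in_tpow] assms by blast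
  show "lin p (\<lambda>x. x \<odot> (y \<odot> z))" 
    using conc_linear_on_left[OF conc_in_tpow] assms by blast
  fix us :: "'v list" assume us: "length us = p"
  note us' = pure_in_tpow[OF us]
  show "(pu us \<odot> y) \<odot> z = pu us \<odot> (y \<odot> z)"
  proof (rule lin_eqI[OF _ _ _ assms(2)])
    show "lin q (\<lambda>y. (pu us \<odot> y) \<odot> z)" 
      using lin_comp[OF conc_linear_on_right conc_linear_on_left conc_in_tpow] us' assms by blast
    show "lin q (\<lambda>y. pu us \<odot> (y \<odot> z))" 
      using lin_comp[OF conc_linear_on_left conc_linear_on_right conc_in_tpow] us' assms by blast
    fix vs :: "'v list" assume vs: "length vs = q"
    note vs' = pure_in_tpow[OF vs]
    show "(pu us \<odot> pu vs) \<odot> z = pu us \<odot> (pu vs \<odot> z)"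
    proof (rule lin_eqI[OF _ _ _ assms(3)])
      show "lin r (\<lambda>z. (pu us \<odot> pu vs) \<odot> z)" 
        using conc_linear_on_right[OF conc_in_tpow] us' vs' by blast
      show "lin r (\<lambda>z. pu us \<odot> (pu vs \<odot> z))" 
        using lin_comp[OF conc_linear_on_right conc_linear_on_right conc_in_tpow] us' vs' by blast
    qed (simp add: conc_pure)
  qed
qed

lemma conc_unit_left: 
  assumes "x \<in> tp p" shows "pu [] \<odot> x = x"
  by (rule lin_eqI[OF conc_linear_on_right[OF pure_in_tpow[OF refl]] _ _ assms])
    (auto simp: linear_on_tpow_def conc_pure)

lemma conc_unit_right: 
  assumes "x \<in> tp p" shows "x \<odot> pu [] = x"
  by (rule lin_eqI[OF conc_linear_on_left[OF pure_in_tpow[OF refl]] _ _ assms])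
    (auto simp: linear_on_tpow_def conc_pure)

end

section \<open>Linear maps between tensor powers\<close>

text \<open>All tensor powers sit in one type, so a map has to carry its degrees. \<open>mor\<close>
  itself imposes nothing and \<open>\<cdot>\<close> does not compare the inner degrees; the
  conditions are in \<open>arr\<close>, and associativity of \<open>\<cdot>\<close> is free.\<close>

datatype 't mor = Mor (src: nat) (tgt: nat) (app: "'t \<Rightarrow> 't")

definition mcomp :: "'t mor \<Rightarrow> 't mor \<Rightarrow> 't mor" (infixl "\<cdot>" 70) where
  "g \<cdot> f = Mor (src f) (tgt g) (\<lambda>x. app g (app f x))"

text \<open>Explicit degrees give the empty sum, that is the zero map, a source and a
  target.\<close>

definition lsum :: "nat \<Rightarrow> nat \<Rightarrow> 'i set \<Rightarrow> ('i \<Rightarrow> 't::comm_monoid_add mor) \<Rightarrow> 't mor" where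
  "lsum m n A F = Mor m n (\<lambda>x. \<Sum>a\<in>A. app (F a) x)"

definition mdiff :: "'t::group_add mor \<Rightarrow> 't mor \<Rightarrow> 't mor" where
  "mdiff f g = Mor (src f) (tgt f) (\<lambda>x. app f x - app g x)"

lemma src_tgt_simps [simp]:
  "src (g \<cdot> f) = src f" "tgt (g \<cdot> f) = tgt g" "src (lsum m n A F) = m" "tgt (lsum m n A F) = n"
  "src (mdiff f h) = src f" "tgt (mdiff f h) = tgt f"
  by (simp_all add: mcomp_def lsum_def mdiff_def)

lemma app_comp [simp]: "app (g \<cdot> f) x = app g (app f x)"
  by (simp add: mcomp_def)

lemma app_lsum: "app (lsum m n A F) x = (\<Sum>a\<in>A. app (F a) x)"
  by (simp add: lsum_def)

lemma app_mdiff: "app (mdiff f g) x = app f x - app g x"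
  by (simp add: mdiff_def)

lemma mcomp_assoc: "(h \<cdot> g) \<cdot> f = h \<cdot> (g \<cdot> f)"
  by (simp add: mcomp_def)

lemma lsum_comp_right: "lsum m n A F \<cdot> g = lsum (src g) n A (\<lambda>a. F a \<cdot> g)"
  by (simp add: mcomp_def lsum_def)

lemma lsum_cong:
  "m = m' \<Longrightarrow> n = n' \<Longrightarrow> A = B \<Longrightarrow> (\<And>a. a \<in> B \<Longrightarrow> F a = G a) \<Longrightarrow> lsum m n A F = lsum m' n' B G"
  by (simp add: lsum_def cong: sum.cong)

lemma lsum_Sigma:
  assumes "finite A" "\<And>a. a \<in> A \<Longrightarrow> finite (B a)"
  shows "lsum m n A (\<lambda>a. lsum m' n' (B a) (F a)) = lsum m n (Sigma A B) (\<lambda>(a, b). F a b)"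
  using assms by (simp add: lsum_def sum.Sigma split_beta)

lemma lsum_swap:
  "lsum m n A (\<lambda>a. lsum m n B (\<lambda>b. F a b)) = lsum m n B (\<lambda>b. lsum m n A (\<lambda>a. F a b))"
  unfolding lsum_def by (auto intro!: ext sum.swap)

lemma lsum_mono_neutral:
  assumes "finite B" "A \<subseteq> B" "\<And>a x. a \<in> B - A \<Longrightarrow> app (F a) x = 0"
  shows "lsum m n A F = lsum m n B F"
  unfolding lsum_def using assms by (auto intro!: ext sum.mono_neutral_left)

lemma lsum_single: "src (F a) = m \<Longrightarrow> tgt (F a) = n \<Longrightarrow> lsum m n {a} F = F a"
  by (cases "F a") (simp add: lsum_def)

context tensor_powers
begin

text \<open>
  An element of \<open>Hom(V\<^sup>\<otimes>\<^sup>m, V\<^sup>\<otimes>\<^sup>n)\<close> is represented by its extension by \<open>0\<close>, so that equality of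
  linear maps becomes equality in the type \<open>mor\<close>.
\<close>

definition arr :: "('k, 'v) tensor mor \<Rightarrow> bool" where
  "arr f \<longleftrightarrow> lin (src f) (app f) \<and> (\<forall>x\<in>tp (src f). app f x \<in> tp (tgt f)) \<and>
     (\<forall>x. x \<notin> tp (src f) \<longrightarrow> app f x = 0)"

definition restr :: "nat \<Rightarrow> nat \<Rightarrow> (('k, 'v) tensor \<Rightarrow> ('k, 'v) tensor) \<Rightarrow> ('k, 'v) tensor mor" where
  "restr m n f = Mor m n (\<lambda>x. if x \<in> tp m then f x else 0)"

definition idm :: "nat \<Rightarrow> ('k, 'v) tensor mor" where
  "idm n = restr n n id"

definition tens :: "('k, 'v) tensor mor \<Rightarrow> ('k, 'v) tensor mor \<Rightarrow> ('k, 'v) tensor mor"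
    (infixr "\<otimes>" 75) where
  "f \<otimes> g = restr (src f + src g) (tgt f + tgt g) (tmap scale (src f) (src g) (app f) (app g))"

lemma src_tgt_tens [simp]:
  "src (f \<otimes> g) = src f + src g" "tgt (f \<otimes> g) = tgt f + tgt g" "src (idm n) = n" "tgt (idm n) = n"
  "src (restr m n h) = m" "tgt (restr m n h) = n"
  by (simp_all add: tens_def restr_def idm_def)

lemma app_restr: "x \<in> tp m \<Longrightarrow> app (restr m n f) x = f x"
  by (simp add: restr_def)

lemma app_idm: "x \<in> tp n \<Longrightarrow> app (idm n) x = x"
  by (simp add: idm_def app_restr)

lemma arr_outside: "arr f \<Longrightarrow> x \<notin> tp (src f) \<Longrightarrow> app f x = 0"
  and arr_range: "arr f \<Longrightarrow> x \<in> tp (src f) \<Longrightarrow> app f x \<in> tp (tgt f)"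
  and arr_lin: "arr f \<Longrightarrow> lin (src f) (app f)"
  by (auto simp: arr_def)

lemma arr_zero: "arr f \<Longrightarrow> app f 0 = 0"
  by (rule lin_zero[OF arr_lin])

lemma arr_restr:
  assumes "lin m f" "\<And>vs. length vs = m \<Longrightarrow> f (pu vs) \<in> tp n"
  shows "arr (restr m n f)"
proof -
  have "lin m (app (restr m n f))"
    using assms(1) lin_cong[of m f "app (restr m n f)"] by (simp add: app_restr)
  then show ?thesis
    using lin_range[OF assms] by (simp add: arr_def restr_def)
qed

lemma arr_idm [simp]: "arr (idm n)"
  unfolding idm_def by (rule arr_restr) (auto simp: linear_on_tpow_def pure_in_tpow)

lemma arr_comp [simp]: "arr f \<Longrightarrow> arr g \<Longrightarrow> tgt f = src g \<Longrightarrow> arr (g \<cdot> f)"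
  using arr_zero[of g] lin_comp[of "src f" "app f" "src g" "app g"] unfolding arr_def by (simp add: mcomp_def)

lemma arr_sum_range: "(\<And>a. a \<in> A \<Longrightarrow> arr (F a) \<and> src (F a) = m \<and> tgt (F a) = n) \<Longrightarrow> x \<in> tp m \<Longrightarrow>
    (\<Sum>a\<in>A. app (F a) x) \<in> tp n"
  by (rule tpow_sum) (metis arr_range)

lemma arr_lsum [simp]:
  assumes "\<And>a. a \<in> A \<Longrightarrow> arr (F a)" "\<And>a. a \<in> A \<Longrightarrow> src (F a) = m" "\<And>a. a \<in> A \<Longrightarrow> tgt (F a) = n"
  shows "arr (lsum m n A F)"
proof -
  have l: "lin m (app (F a))" if "a \<in> A" for a
    using arr_lin assms that by metis
  have "lin m (app (lsum m n A F))"
    using l unfolding app_lsum linear_on_tpow_def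
    by (auto simp: sum.distrib T.scale_sum_right cong: sum.cong)
  moreover have "app (lsum m n A F) x \<in> tp n" if "x \<in> tp m" for x
    unfolding app_lsum using arr_sum_range[of A F m n] assms that by blast
  moreover have "app (lsum m n A F) x = 0" if "x \<notin> tp m" for x
    unfolding app_lsum using arr_outside assms that by (intro sum.neutral) metis
  ultimately show ?thesis by (simp add: arr_def)
qed

lemma arr_mdiff [simp]:
  assumes "arr f" "arr g" "src f = src g" "tgt f = tgt g"
  shows "arr (mdiff f g)"
proof -
  have "lin (src f) (app f)" "lin (src f) (app g)"
    using assms arr_lin by metis+
  then have "lin (src f) (\<lambda>x. app f x - app g x)"
    by (auto simp: linear_on_tpow_def algebra_simps T.scale_right_diff_distrib)
  moreover have "app f x - app g x \<in> tp (tgt f)" if "x \<in> tp (src f)" for x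
    using assms arr_range[of f x] arr_range[of g x] that by (auto intro: tpow_closed(4))
  moreover have "app f x - app g x = 0" if "x \<notin> tp (src f)" for x
    using assms arr_outside[of f x] arr_outside[of g x] that by simp
  ultimately show ?thesis
    unfolding arr_def by (simp add: mdiff_def)
qed

lemma mor_ext:
  assumes "arr f" "arr g" "src f = src g" "tgt f = tgt g"
    and "\<And>x. x \<in> tp (src f) \<Longrightarrow> app f x = app g x"
  shows "f = g"
proof (rule mor.expand, safe)
  show "app f = app g"
  proof
    fix x show "app f x = app g x"
      using assms arr_outside by (cases "x \<in> tp (src f)") metis+
  qed
qed (use assms in auto)

lemma mor_eqI:
  assumes "arr f" "arr g" "src f = src g" "tgt f = tgt g"
    and "\<And>vs. length vs = src f \<Longrightarrow> app f (pu vs) = app g (pu vs)"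
  shows "f = g"
  by (rule mor_ext[OF assms(1-4)], rule lin_eqI[OF arr_lin[OF assms(1)] _ assms(5)])
    (simp_all add: arr_lin[OF assms(2)] assms(3))

lemma comp_idm_right [simp]: "arr f \<Longrightarrow> src f = n \<Longrightarrow> f \<cdot> idm n = f"
  and comp_idm_left [simp]: "arr f \<Longrightarrow> tgt f = n \<Longrightarrow> idm n \<cdot> f = f"
  by (rule mor_ext; auto simp: app_idm arr_range)+

lemma lsum_comp_left:
  assumes "arr h" "src h = n" "\<And>a. a \<in> A \<Longrightarrow> arr (F a)" "\<And>a. a \<in> A \<Longrightarrow> src (F a) = m"
    "\<And>a. a \<in> A \<Longrightarrow> tgt (F a) = n"
  shows "h \<cdot> lsum m n A F = lsum m (tgt h) A (\<lambda>a. h \<cdot> F a)"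
proof (rule mor_ext)
  fix x assume "x \<in> tp (src (h \<cdot> lsum m n A F))"
  then have x: "x \<in> tp m" by simp
  have "app h (\<Sum>a\<in>A. app (F a) x) = (\<Sum>a\<in>A. app h (app (F a) x))"
    if "finite A"
    using that assms(3-5)
  proof (induction A)
    case (insert a A)
    then have "app (F a) x \<in> tp n" "(\<Sum>a\<in>A. app (F a) x) \<in> tp n"
      using x arr_range arr_sum_range[of A F m n x] by (metis insertI1, metis insertI2)
    then have "app h (app (F a) x + (\<Sum>a\<in>A. app (F a) x)) = app h (app (F a) x) + app h (\<Sum>a\<in>A. app (F a) x)"
      using arr_lin[OF assms(1)] assms(2) unfolding linear_on_tpow_def by blast
    with insert show ?case by simp
  qed (simp add: arr_zero[OF assms(1)])
  then show "app (h \<cdot> lsum m n A F) x = app (lsum m (tgt h) A (\<lambda>a. h \<cdot> F a)) x"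
    by (cases "finite A") (auto simp: app_lsum arr_zero[OF assms(1)])
qed (use assms in auto)

lemma mdiff_comp_left:
  assumes "arr h" "arr f" "arr g" "src f = src g" "tgt f = src h" "tgt g = src h"
  shows "h \<cdot> mdiff f g = mdiff (h \<cdot> f) (h \<cdot> g)"
proof (rule mor_ext)
  fix x assume "x \<in> tp (src (h \<cdot> mdiff f g))"
  then have x: "app f x \<in> tp (src h)" "app g x \<in> tp (src h)"
    using assms arr_range[of f] arr_range[of g] by simp_all
  \<comment> \<open>Linearity is stated for sums; the difference is reached by adding
    \<open>app g x\<close> back.\<close>
  then have "app h (app f x - app g x + app g x) = app h (app f x - app g x) + app h (app g x)"
    using arr_lin[OF assms(1)] tpow_closed(4) unfolding linear_on_tpow_def by blast
  then show "app (h \<cdot> mdiff f g) x = app (mdiff (h \<cdot> f) (h \<cdot> g)) x"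
    by (simp add: mdiff_def)
qed (use assms in auto)

lemma mdiff_comp_right: "mdiff f g \<cdot> h = mdiff (f \<cdot> h) (g \<cdot> h)"
  by (simp add: mdiff_def mcomp_def)

text \<open>The varied entry lies in one of the two parts of the word; the other part stays
  constant, and concatenation is bilinear.\<close>

lemma multilinear_tens:
  assumes f: "lin p f" "\<And>x. x \<in> tp p \<Longrightarrow> f x \<in> tp p'"
    and g: "lin q g" "\<And>x. x \<in> tp q \<Longrightarrow> g x \<in> tp q'"
  shows "multilinear scale tscale (p + q) (\<lambda>ws. f (pu (take p ws)) \<odot> g (pu (drop p ws)))"
proof -
  have *: "f (pu (take p (us @ (v + w) # vs))) \<odot> g (pu (drop p (us @ (v + w) # vs))) =
      f (pu (take p (us @ v # vs))) \<odot> g (pu (drop p (us @ v # vs))) +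
      f (pu (take p (us @ w # vs))) \<odot> g (pu (drop p (us @ w # vs))) \<and>
      f (pu (take p (us @ scale c v # vs))) \<odot> g (pu (drop p (us @ scale c v # vs))) =
      tscale c (f (pu (take p (us @ v # vs))) \<odot> g (pu (drop p (us @ v # vs))))"
    if len: "length us + 1 + length vs = p + q" for us vs v w c
  proof (cases "length us < p")
    case True
    \<comment> \<open>Number of letters of \<open>vs\<close> that still belong to the first
      factor.\<close>
    define k where "k = p - length us - 1"
    have k: "p - length us = Suc k" using True by (simp add: k_def)
    have t: "take p (us @ v # vs) = us @ v # take k vs" "drop p (us @ v # vs) = drop k vs" for v
      using k by simp_all
    have lt: "length us + 1 + length (take k vs) = p" using len True by (simp add: k_def)
    have "g (pu (drop k vs)) \<in> tp q'"
      by (rule g(2), rule pure_in_tpow) (use len True in \<open>simp add: k_def\<close>)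
    then show ?thesis
      unfolding t linear_on_tpow_pure[OF f(1) lt]
      by (simp add: conc_add_left conc_scale_left)
  next
    case False
    have t: "take p (us @ v # vs) = take p us" "drop p (us @ v # vs) = drop p us @ v # vs" for v
      using False by simp_all
    have lt: "length (drop p us) + 1 + length vs = q" using len False by simp
    have fx: "f (pu (take p us)) \<in> tp p'"
      by (rule f(2), rule pure_in_tpow) (use False in simp)
    have gx: "g (pu (drop p us @ v # vs)) \<in> tp q'" for v
      by (rule g(2), rule pure_in_tpow) (use lt in simp)
    show ?thesis
      unfolding t linear_on_tpow_pure[OF g(1) lt]
      using conc_add_right[OF fx gx gx] conc_scale_right[OF fx gx] by simp
  qed
  then show ?thesis
    unfolding multilinear_iff[OF vector_space_tscale] by blast
qed

lemma tmap_cong: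
  assumes "\<And>x. x \<in> tp p \<Longrightarrow> f x = f' x" "\<And>x. x \<in> tp q \<Longrightarrow> g x = g' x"
  shows "tmap scale p q f g = tmap scale p q f' g'"
  unfolding tmap_def by (rule lift_cong) (use assms in \<open>auto simp: pure_in_tpow\<close>)

lemma tmap_linear_pure:
  assumes f: "lin p f" "\<And>x. x \<in> tp p \<Longrightarrow> f x \<in> tp p'"
    and g: "lin q g" "\<And>x. x \<in> tp q \<Longrightarrow> g x \<in> tp q'"
  shows "lin (p + q) (tmap scale p q f g)"
    and "length us = p \<Longrightarrow> length vs = q \<Longrightarrow> tmap scale p q f g (pu (us @ vs)) = f (pu us) \<odot> g (pu vs)"
proof -
  have ml: "\<And>n. n \<in> {p + q} \<Longrightarrow> multilinear scale tscale n (\<lambda>ws. f (pu (take p ws)) \<odot> g (pu (drop p ws)))"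
    using multilinear_tens[OF f g] by auto
  note ll = linear_lift[OF vector_space_scale vector_space_tscale ml, of "{p + q}"]
    lift_pure[OF vector_space_scale vector_space_tscale ml, of "{p + q}"]
  from ll show "lin (p + q) (tmap scale p q f g)"
    and "length us = p \<Longrightarrow> length vs = q \<Longrightarrow> tmap scale p q f g (pu (us @ vs)) = f (pu us) \<odot> g (pu vs)"
    unfolding tmap_def by (auto intro: linear_on_tpow_linear)
qed

lemma pure_split: 
  assumes "length ws = p + q"
  obtains us vs where "ws = us @ vs" "length us = p" "length vs = q"
  using assms by (metis append_take_drop_id length_append length_drop add_diff_cancel_left' length_take
      min.absorb2 le_add1)

lemma arr_tens [simp]:
  assumes "arr f" "arr g"
  shows "arr (f \<otimes> g)"
  unfolding tens_def
proof (rule arr_restr)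
  note f = arr_lin[OF assms(1)] arr_range[OF assms(1)]
  note g = arr_lin[OF assms(2)] arr_range[OF assms(2)]
  show "lin (src f + src g) (tmap scale (src f) (src g) (app f) (app g))"
    by (rule tmap_linear_pure[OF f g])
  fix ws :: "'v list" assume "length ws = src f + src g"
  then obtain us vs where ws: "ws = us @ vs" "length us = src f" "length vs = src g"
    by (rule pure_split)
  show "tmap scale (src f) (src g) (app f) (app g) (pu ws) \<in> tp (tgt f + tgt g)"
    using conc_in_tpow[OF f(2)[OF pure_in_tpow[OF ws(2)]] g(2)[OF pure_in_tpow[OF ws(3)]]]
      tmap_linear_pure(2)[OF f g ws(2,3)] by (simp add: ws(1))
qed

lemma app_tens_pure:
  assumes "arr f" "arr g" "length us = src f" "length vs = src g"
  shows "app (f \<otimes> g) (pu (us @ vs)) = app f (pu us) \<odot> app g (pu vs)"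
  unfolding tens_def
  using tmap_linear_pure(2)[OF arr_lin[OF assms(1)] arr_range[OF assms(1)] arr_lin[OF assms(2)] arr_range[OF assms(2)]]
    assms(3,4) by (simp add: app_restr pure_in_tpow)

text \<open>Images of pure tensors are no longer pure, so composites need the rule for arbitrary
  tensors. It is extended from pure tensors by linearity, one factor at a time.\<close>

lemma app_tens:
  assumes f: "arr f" and g: "arr g" and x: "x \<in> tp (src f)" and y: "y \<in> tp (src g)"
  shows "app (f \<otimes> g) (x \<odot> y) = app f x \<odot> app g y"
proof (rule lin_eqI[OF _ _ _ x])
  have fg: "lin (src f + src g) (app (f \<otimes> g))" using arr_lin[OF arr_tens[OF f g]] by simp
  show "lin (src f) (\<lambda>x. app (f \<otimes> g) (x \<odot> y))"
    by (rule lin_comp[OF conc_linear_on_left[OF y] fg]) (rule conc_in_tpow[OF _ y])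
  show "lin (src f) (\<lambda>x. app f x \<odot> app g y)"
    by (rule lin_comp[OF arr_lin[OF f] conc_linear_on_left[OF arr_range[OF g y]] arr_range[OF f]])
  fix us :: "'v list" assume us: "length us = src f"
  note us' = pure_in_tpow[OF us]
  show "app (f \<otimes> g) (pu us \<odot> y) = app f (pu us) \<odot> app g y"
  proof (rule lin_eqI[OF _ _ _ y])
    show "lin (src g) (\<lambda>y. app (f \<otimes> g) (pu us \<odot> y))"
      by (rule lin_comp[OF conc_linear_on_right[OF us'] fg]) (rule conc_in_tpow[OF us'])
    show "lin (src g) (\<lambda>y. app f (pu us) \<odot> app g y)"
      by (rule lin_comp[OF arr_lin[OF g] conc_linear_on_right[OF arr_range[OF f us']] arr_range[OF g]])
  qed (simp add: conc_pure app_tens_pure f g us)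
qed

lemma mor_tens_eqI:
  assumes "arr f" "arr g" "src f = p + q" "src g = p + q" "tgt f = tgt g"
    and "\<And>us vs. length us = p \<Longrightarrow> length vs = q \<Longrightarrow> app f (pu (us @ vs)) = app g (pu (us @ vs))"
  shows "f = g"
proof (rule mor_eqI)
  fix ws :: "'v list" assume "length ws = src f"
  then obtain us vs where "ws = us @ vs" "length us = p" "length vs = q"
    using assms(3) pure_split by metis
  then show "app f (pu ws) = app g (pu ws)"
    using assms(6) by blast
qed (use assms in auto)

lemma interchange:
  assumes "arr f" "arr g" "arr f'" "arr g'" "tgt f' = src f" "tgt g' = src g"
  shows "(f \<otimes> g) \<cdot> (f' \<otimes> g') = (f \<cdot> f') \<otimes> (g \<cdot> g')"
proof (rule mor_tens_eqI[where p = "src f'" and q = "src g'"])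
  fix us vs :: "'v list" assume l: "length us = src f'" "length vs = src g'"
  have "app f' (pu us) \<in> tp (src f)" "app g' (pu vs) \<in> tp (src g)"
    using arr_range[OF assms(3) pure_in_tpow[OF l(1)]] arr_range[OF assms(4) pure_in_tpow[OF l(2)]] assms
    by simp_all
  then show "app ((f \<otimes> g) \<cdot> (f' \<otimes> g')) (pu (us @ vs)) = app ((f \<cdot> f') \<otimes> (g \<cdot> g')) (pu (us @ vs))"
    using assms l by (simp add: app_tens_pure app_tens)
qed (use assms in auto)

lemma tens_idm: "idm m \<otimes> idm n = idm (m + n)"
  by (rule mor_tens_eqI[where p = m and q = n])
    (auto simp: app_tens_pure app_idm pure_in_tpow conc_pure)

text \<open>No associator appears, since the product of elements of \<open>tp p\<close> and
  \<open>tp q\<close> lies literally in \<open>tp (p + q)\<close>. With \<open>interchange\<close>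
  and \<open>tens_unit\<close> the maps form a strict monoidal category.\<close>

lemma tens_assoc:
  assumes "arr f" "arr g" "arr h"
  shows "(f \<otimes> g) \<otimes> h = f \<otimes> g \<otimes> h"
proof (rule mor_tens_eqI[where p = "src f + src g" and q = "src h"])
  fix ws us :: "'v list" assume l: "length ws = src f + src g" "length us = src h"
  obtain vs vs' where ws: "ws = vs @ vs'" and v: "length vs = src f" "length vs' = src g"
    using pure_split[OF l(1)] .
  have "app ((f \<otimes> g) \<otimes> h) (pu (ws @ us)) = (app f (pu vs) \<odot> app g (pu vs')) \<odot> app h (pu us)"
    using assms l v by (simp add: app_tens_pure ws del: append_assoc)
  also have "\<dots> = app f (pu vs) \<odot> (app g (pu vs') \<odot> app h (pu us))"
    by (rule conc_assoc; rule arr_range; simp add: assms pure_in_tpow l v)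
  also have "\<dots> = app (f \<otimes> g \<otimes> h) (pu (ws @ us))"
    using assms l v by (simp add: app_tens_pure ws)
  finally show "app ((f \<otimes> g) \<otimes> h) (pu (ws @ us)) = app (f \<otimes> g \<otimes> h) (pu (ws @ us))" .
qed (use assms in auto)

lemma tens_unit [simp]:
  assumes "arr f"
  shows "idm 0 \<otimes> f = f" and "f \<otimes> idm 0 = f"
proof -
  have r: "app f (pu vs) \<in> tp (tgt f)" if "length vs = src f" for vs
    by (rule arr_range[OF assms]) (simp add: that pure_in_tpow)
  show "idm 0 \<otimes> f = f"
    by (rule mor_tens_eqI[where p = 0 and q = "src f"])
      (use assms conc_unit_left[OF r] app_tens_pure[of "idm 0" f "[]"] in
        \<open>auto simp: app_idm pure_in_tpow\<close>)
  show "f \<otimes> idm 0 = f"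
    by (rule mor_tens_eqI[where q = 0 and p = "src f"])
      (use assms conc_unit_right[OF r] app_tens_pure[of f "idm 0" _ "[]"] in
        \<open>auto simp: app_idm pure_in_tpow\<close>)
qed

lemma lsum_tens_left:
  assumes "arr h" "\<And>a. a \<in> A \<Longrightarrow> arr (F a)" "\<And>a. a \<in> A \<Longrightarrow> src (F a) = m" "\<And>a. a \<in> A \<Longrightarrow> tgt (F a) = n"
  shows "lsum m n A F \<otimes> h = lsum (m + src h) (n + tgt h) A (\<lambda>a. F a \<otimes> h)"
proof (rule mor_tens_eqI[where p = m and q = "src h"])
  fix us vs :: "'v list" assume l: "length us = m" "length vs = src h"
  have h: "app h (pu vs) \<in> tp (tgt h)" using l assms(1) by (simp add: arr_range pure_in_tpow)
  have "(\<Sum>a\<in>A. app (F a) (pu us)) \<odot> app h (pu vs) = (\<Sum>a\<in>A. app (F a) (pu us) \<odot> app h (pu vs))"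
    by (induction A rule: infinite_finite_induct) (auto simp: conc_zero_left[OF h] conc_add_left[OF h])
  also have "\<dots> = (\<Sum>a\<in>A. app (F a \<otimes> h) (pu (us @ vs)))"
    by (rule sum.cong) (use assms l in \<open>auto simp: app_tens_pure\<close>)
  finally show "app (lsum m n A F \<otimes> h) (pu (us @ vs)) = app (lsum (m + src h) (n + tgt h) A (\<lambda>a. F a \<otimes> h)) (pu (us @ vs))"
    using assms l by (simp add: app_tens_pure app_lsum)
qed (use assms in auto)

lemma lsum_tens_right:
  assumes "arr h" "\<And>a. a \<in> A \<Longrightarrow> arr (F a)" "\<And>a. a \<in> A \<Longrightarrow> src (F a) = m" "\<And>a. a \<in> A \<Longrightarrow> tgt (F a) = n"
  shows "h \<otimes> lsum m n A F = lsum (src h + m) (tgt h + n) A (\<lambda>a. h \<otimes> F a)"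
proof (rule mor_tens_eqI[where q = m and p = "src h"])
  fix us vs :: "'v list" assume l: "length vs = m" "length us = src h"
  have h: "app h (pu us) \<in> tp (tgt h)" using l assms(1) by (simp add: arr_range pure_in_tpow)
  have "app h (pu us) \<odot> (\<Sum>a\<in>A. app (F a) (pu vs)) = (\<Sum>a\<in>A. app h (pu us) \<odot> app (F a) (pu vs))"
    using assms(2-4)
  proof (induction A rule: infinite_finite_induct)
    case (insert a A)
    then have "app (F a) (pu vs) \<in> tp n" "(\<Sum>a\<in>A. app (F a) (pu vs)) \<in> tp n"
      using arr_range pure_in_tpow[OF l(1)] arr_sum_range[of A F m n "pu vs"]
      by (metis insertI1, metis insertI2)
    with insert show ?case by (simp add: conc_add_right[OF h])
  qed (auto simp: conc_zero_right[OF h])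
  also have "\<dots> = (\<Sum>a\<in>A. app (h \<otimes> F a) (pu (us @ vs)))"
    by (rule sum.cong) (use assms l in \<open>auto simp: app_tens_pure\<close>)
  finally show "app (h \<otimes> lsum m n A F) (pu (us @ vs)) = app (lsum (src h + m) (tgt h + n) A (\<lambda>a. h \<otimes> F a)) (pu (us @ vs))"
    using assms l by (simp add: app_tens_pure app_lsum)
qed (use assms in auto)

lemma mdiff_tens_left:
  assumes "arr f" "arr g" "src f = src g" "tgt f = tgt g" "arr h"
  shows "mdiff f g \<otimes> h = mdiff (f \<otimes> h) (g \<otimes> h)"
proof (rule mor_tens_eqI[where p = "src f" and q = "src h"])
  fix us vs :: "'v list" assume l: "length us = src f" "length vs = src h"
  have h: "app h (pu vs) \<in> tp (tgt h)" using l assms by (simp add: arr_range pure_in_tpow)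
  have "(app f (pu us) - app g (pu us) + app g (pu us)) \<odot> app h (pu vs) =
      (app f (pu us) - app g (pu us)) \<odot> app h (pu vs) + app g (pu us) \<odot> app h (pu vs)"
    by (rule conc_add_left[OF h])
  then show "app (mdiff f g \<otimes> h) (pu (us @ vs)) = app (mdiff (f \<otimes> h) (g \<otimes> h)) (pu (us @ vs))"
    using assms l by (simp add: app_tens_pure app_mdiff)
qed (use assms in auto)

lemma mdiff_tens_right:
  assumes "arr f" "arr g" "src f = src g" "tgt f = tgt g" "arr h"
  shows "h \<otimes> mdiff f g = mdiff (h \<otimes> f) (h \<otimes> g)"
proof (rule mor_tens_eqI[where q = "src f" and p = "src h"])
  fix us vs :: "'v list" assume l: "length vs = src f" "length us = src h"
  have h: "app h (pu us) \<in> tp (tgt h)" using l assms by (simp add: arr_range pure_in_tpow)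
  have f: "app f (pu vs) \<in> tp (tgt f)" "app g (pu vs) \<in> tp (tgt f)"
    using l assms pure_in_tpow arr_range by metis+
  have "app h (pu us) \<odot> (app f (pu vs) - app g (pu vs) + app g (pu vs)) =
      app h (pu us) \<odot> (app f (pu vs) - app g (pu vs)) + app h (pu us) \<odot> app g (pu vs)"
    by (rule conc_add_right[OF h tpow_closed(4)[OF f] f(2)])
  then show "app (h \<otimes> mdiff f g) (pu (us @ vs)) = app (mdiff (h \<otimes> f) (h \<otimes> g)) (pu (us @ vs))"
    using assms l by (simp add: app_tens_pure app_mdiff)
qed (use assms in auto)

text \<open>Bridge from the \<open>tmap\<close> of the definitions to \<open>\<otimes>\<close>.
  Agreement on tensor powers suffices because \<open>tmap\<close> evaluates its two maps only at
  pure tensors of lengths \<open>p\<close> and \<open>q\<close>.\<close>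

lemma tmap_eq_tens:
  assumes "\<And>x. x \<in> tp (src f) \<Longrightarrow> f' x = app f x" "\<And>x. x \<in> tp (src g) \<Longrightarrow> g' x = app g x"
    and "p = src f" "q = src g" "x \<in> tp (p + q)"
  shows "tmap scale p q f' g' x = app (f \<otimes> g) x"
  using tmap_cong[of p f' "app f" q g' "app g"] assms by (simp add: tens_def app_restr)

end

section \<open>Reduced expressions\<close>

definition inversions :: "nat \<Rightarrow> (nat \<Rightarrow> nat) \<Rightarrow> (nat \<times> nat) set" where
  "inversions n w = {(a, b). 1 \<le> a \<and> a < b \<and> b \<le> n \<and> w b < w a}"

abbreviation perm_length :: "nat \<Rightarrow> (nat \<Rightarrow> nat) \<Rightarrow> nat" where
  "perm_length n w \<equiv> card (inversions n w)"

lemma inversions_id [simp]: "inversions n id = {}" "inversions n (\<lambda>a. a) = {}"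
  by (auto simp: inversions_def)

lemma finite_inversions: "finite (inversions n w)"
  by (rule finite_subset[of _ "{1..n} \<times> {1..n}"]) (auto simp: inversions_def)

abbreviation adj :: "nat \<Rightarrow> nat \<Rightarrow> nat" where "adj i \<equiv> transpose i (Suc i)"

lemma s_permutes: "1 \<le> i \<Longrightarrow> i < n \<Longrightarrow> adj i permutes {1..n}"
  by (rule permutes_swap_id) auto

lemma s_comp_permutes: "1 \<le> i \<Longrightarrow> i < n \<Longrightarrow> w permutes {1..n} \<Longrightarrow> adj i \<circ> w permutes {1..n}"
  using s_permutes permutes_compose by blast

lemma s_s_comp [simp]: "adj i \<circ> (adj i \<circ> w) = w"
  by (simp add: fun_eq_iff)

lemma inv_s_comp: "w permutes A \<Longrightarrow> inv (adj i \<circ> w) x = inv w (adj i x)"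
  using permutes_bij[of w A] by (simp add: o_inv_distrib bij_is_inj bij_is_surj)

lemma s_less_iff: "\<not> (x = i \<and> y = Suc i) \<Longrightarrow> \<not> (x = Suc i \<and> y = i) \<Longrightarrow> adj i x < adj i y \<longleftrightarrow> x < y"
  by (auto simp: transpose_def)

text \<open>Left multiplication by \<open>adj i\<close> exchanges the values \<open>i\<close> and
  \<open>i + 1\<close>, which sit at the positions \<open>inv w i\<close> and
  \<open>inv w (Suc i)\<close>. Only this pair of positions changes its relative order.\<close>

lemma perm_length_ascent:
  assumes w: "w permutes {1..n}" and i: "1 \<le> i" "i < n" and asc: "inv w i < inv w (Suc i)"
  shows "perm_length n (adj i \<circ> w) = Suc (perm_length n w)"
proof -
  define a b where "a = inv w i" and "b = inv w (Suc i)"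
  have wa: "w x = i \<longleftrightarrow> x = a" and wb: "w x = Suc i \<longleftrightarrow> x = b" for x
    using permutes_inv_eq[OF w, of i x] permutes_inv_eq[OF w, of "Suc i" x] by (auto simp: a_def b_def)
  have "a \<in> {1..n}" "b \<in> {1..n}"
    using permutes_in_image[OF permutes_inv[OF w]] i by (auto simp: a_def b_def)
  moreover have ab: "a < b" using asc by (simp add: a_def b_def)
  moreover have "adj i (w b) < adj i (w a)" using wa[of a] wb[of b] by simp
  moreover have "adj i (w y) < adj i (w x) \<longleftrightarrow> w y < w x" if "x < y" "(x, y) \<noteq> (a, b)" for x y
    by (rule s_less_iff) (use that wa wb ab in auto)
  ultimately have "(x, y) \<in> inversions n (adj i \<circ> w) \<longleftrightarrow> (x, y) \<in> insert (a, b) (inversions n w)" for x y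
    by (cases "(x, y) = (a, b)") (auto simp: inversions_def)
  then have "inversions n (adj i \<circ> w) = insert (a, b) (inversions n w)"
    by auto
  moreover have "(a, b) \<notin> inversions n w"
    using wa[of a] wb[of b] by (simp add: inversions_def)
  ultimately show ?thesis
    by (simp add: finite_inversions)
qed

lemma perm_length_descent:
  assumes w: "w permutes {1..n}" and i: "1 \<le> i" "i < n" and desc: "inv w (Suc i) < inv w i"
  shows "perm_length n w = Suc (perm_length n (adj i \<circ> w))"
  using perm_length_ascent[OF s_comp_permutes[OF i w] i] desc by (simp add: inv_s_comp[OF w])

lemma ascent_or_descent:
  assumes "w permutes A"
  shows "inv w i < inv w (Suc i) \<or> inv w (Suc i) < inv w i"
  using permutes_inj[OF permutes_inv[OF assms], THEN injD, of i "Suc i"]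
  by (meson n_not_Suc_n nat_neq_iff)

text \<open>An increasing \<open>inv w\<close> on \<open>{1..n}\<close> satisfies
  \<open>k \<le> inv w k\<close> by upward and \<open>inv w k \<le> k\<close> by downward
  induction.\<close>

lemma permutes_no_descent:
  assumes w: "w permutes {1..n}" and "\<And>i. 1 \<le> i \<Longrightarrow> i < n \<Longrightarrow> inv w i < inv w (Suc i)"
  shows "w = id"
proof -
  note v = permutes_in_image[OF permutes_inv[OF w]]
  have ge: "k \<le> inv w k" if "1 \<le> k" "k \<le> n" for k
    using that
  proof (induction k rule: nat_induct_at_least)
    case base
    then show ?case using v[of 1] by simp
  next
    case (Suc k)
    then show ?case using assms(2)[of k] by simp
  qed
  have le: "inv w k \<le> k" if "k \<le> n" "1 \<le> k" for k
    using that
  proof (induction k rule: inc_induct)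
    case base
    then show ?case using v[of n] by simp
  next
    case (step k)
    then show ?case using assms(2)[of k] by simp
  qed
  have "inv w k = k" for k
  proof (cases "k \<in> {1..n}")
    case True
    then show ?thesis using ge[of k] le[of k] by simp
  next
    case False
    then show ?thesis using permutes_not_in[OF permutes_inv[OF w]] by blast
  qed
  then show "w = id"
    using permutes_inv_eq[OF w] by (metis eq_id_iff)
qed

lemma word_perm_simps [simp]:
  "word_perm [] = id" "word_perm (i # is) = adj i \<circ> word_perm is"
  by (simp_all add: word_perm_def)

lemma word_perm_append: "word_perm (is @ js) = word_perm is \<circ> word_perm js"
  by (induction "is") (simp_all add: fun_eq_iff)

lemma word_perm_permutes: "set is \<subseteq> {1..<n} \<Longrightarrow> word_perm is permutes {1..n}"
  by (induction "is") (auto simp: permutes_id intro!: s_comp_permutes[simplified])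

lemma perm_length_le: "set is \<subseteq> {1..<n} \<Longrightarrow> perm_length n (word_perm is) \<le> length is"
proof (induction "is")
  case Nil
  then show ?case by simp
next
  case (Cons i "is")
  then have "word_perm is permutes {1..n}" "1 \<le> i" "i < n"
    using word_perm_permutes[of "is" n] by simp_all
  from ascent_or_descent[OF this(1), of i] perm_length_ascent[OF this] perm_length_descent[OF this] Cons
  have "perm_length n (adj i \<circ> word_perm is) \<le> Suc (length is)" by auto
  then show ?case by (simp only: word_perm_simps list.size add_Suc_right add_0_right)
qed

text \<open>Reducedness as a count of inversions: one number replaces the comparison with all other
  words in \<open>reduced_expression\<close>.\<close>

definition tight :: "nat \<Rightarrow> nat list \<Rightarrow> bool" where
  "tight n is \<longleftrightarrow> set is \<subseteq> {1..<n} \<and> length is = perm_length n (word_perm is)"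

text \<open>A letter changes the number of inversions by one, up or down, and a word never has fewer
  letters than inversions. Equality for \<open>i # is\<close> thus forces equality for
  \<open>is\<close> and an increase at the letter \<open>i\<close>.\<close>

lemma tight_ConsD:
  assumes "tight n (i # is)"
  shows "tight n is" and "inv (word_perm (i # is)) (Suc i) < inv (word_perm (i # is)) i"
    and "1 \<le> i" "i < n"
proof -
  have i: "1 \<le> i" "i < n" and sub: "set is \<subseteq> {1..<n}"
    and len: "Suc (length is) = perm_length n (word_perm (i # is))"
    using assms by (auto simp: tight_def)
  have w: "word_perm is permutes {1..n}" by (rule word_perm_permutes[OF sub])
  have "\<not> inv (word_perm is) (Suc i) < inv (word_perm is) i"
    using perm_length_descent[OF w i] len perm_length_le[OF sub] by auto
  then have asc: "inv (word_perm is) i < inv (word_perm is) (Suc i)"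
    using ascent_or_descent[OF w] by blast
  then show "tight n is"
    using perm_length_ascent[OF w i] len sub by (simp add: tight_def)
  show "inv (word_perm (i # is)) (Suc i) < inv (word_perm (i # is)) i"
    using asc by (simp add: inv_s_comp[OF w])
  show "1 \<le> i" "i < n" by fact+
qed

lemma tight_exists_cons:
  assumes "w permutes {1..n}" "1 \<le> i" "i < n" "inv w (Suc i) < inv w i"
    and "tight n is" "word_perm is = adj i \<circ> w"
  shows "tight n (i # is)" "word_perm (i # is) = w"
  using assms perm_length_descent[OF assms(1-4)] by (auto simp: tight_def)

text \<open>Removing a left descent lowers the number of inversions; a permutation without left
  descents is the identity.\<close>

lemma tight_exists:
  assumes "w permutes {1..n}"
  obtains "is" where "tight n is" "word_perm is = w"
proof -
  have "\<exists>is. tight n is \<and> word_perm is = w"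
    using assms
  proof (induction "perm_length n w" arbitrary: w rule: less_induct)
    case less
    show ?case
    proof (cases "\<exists>i. 1 \<le> i \<and> i < n \<and> inv w (Suc i) < inv w i")
      case True
      then obtain i where i: "1 \<le> i" "i < n" "inv w (Suc i) < inv w i" by blast
      from less(1)[OF _ s_comp_permutes[OF i(1,2) less(2)]] perm_length_descent[OF less(2) i]
      obtain "is" where "tight n is" "word_perm is = adj i \<circ> w" by auto
      from tight_exists_cons[OF less(2) i this] show ?thesis by blast
    next
      case False
      then have "w = id"
        using permutes_no_descent[OF less(2)] ascent_or_descent[OF less(2)] by blast
      then have "tight n [] \<and> word_perm [] = w" by (simp add: tight_def)
      then show ?thesis by blast
    qed
  qed
  then show thesis using that by blast
qed

text \<open>The number of inversions bounds the length of every word from below, and by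
  \<open>tight_exists\<close> the bound is attained.\<close>

lemma reduced_expression_tight:
  assumes w: "w permutes {1..n}"
  shows "reduced_expression n w is \<longleftrightarrow> tight n is \<and> word_perm is = w"
proof
  assume r: "reduced_expression n w is"
  obtain js where js: "tight n js" "word_perm js = w"
    using tight_exists[OF w] .
  then have "length is \<le> length js"
    using r unfolding reduced_expression_def tight_def by blast
  then have "length is \<le> perm_length n w"
    using js by (simp add: tight_def)
  then show "tight n is \<and> word_perm is = w"
    using r perm_length_le[of "is" n] by (auto simp: reduced_expression_def tight_def)
next
  assume "tight n is \<and> word_perm is = w"
  then show "reduced_expression n w is"
    unfolding reduced_expression_def tight_def using perm_length_le by metis
qed

abbreviation eval_word :: "(nat \<Rightarrow> 'a \<Rightarrow> 'a) \<Rightarrow> nat list \<Rightarrow> 'a \<Rightarrow> 'a" where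
  "eval_word F is \<equiv> foldr (\<lambda>i f. F i \<circ> f) is id"

text \<open>Two distinct left descents \<open>i < j\<close> of \<open>w\<close> can be completed to the two
  sides of a commutation or braid relation, followed by a common reduced word.\<close>

lemma matsumoto:
  assumes comm: "\<And>i j. 1 \<le> i \<Longrightarrow> Suc i < j \<Longrightarrow> j < n \<Longrightarrow> F i \<circ> F j = F j \<circ> F i"
    and braid: "\<And>i. 1 \<le> i \<Longrightarrow> Suc i < n \<Longrightarrow> F i \<circ> F (Suc i) \<circ> F i = F (Suc i) \<circ> F i \<circ> F (Suc i)"
    and "tight n as" "tight n bs" "word_perm as = word_perm bs"
  shows "eval_word F as = eval_word F bs"
  using assms(3-5)
proof (induction "length as" arbitrary: as bs rule: less_induct)
  case less
  define w where "w = word_perm as"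
  have len: "length as = length bs"
    using less.prems by (simp add: tight_def)
  show ?case
  proof (cases as)
    case Nil
    then show ?thesis using len by simp
  next
    case (Cons i a)
    then obtain j b where bs: "bs = j # b"
      using len by (cases bs) auto
    note i = tight_ConsD[OF less.prems(1)[unfolded Cons]]
    note j = tight_ConsD[OF less.prems(2)[unfolded bs]]
    have w: "w permutes {1..n}"
      using less.prems(1) unfolding w_def tight_def by (blast intro: word_perm_permutes)
    have di: "inv w (Suc i) < inv w i" and dj: "inv w (Suc j) < inv w j"
      using i(2) j(2) less.prems(3) by (simp_all add: w_def Cons bs)
    have wa: "word_perm a = adj i \<circ> w" and wb: "word_perm b = adj j \<circ> w"
      using less.prems(3) by (simp_all add: w_def Cons bs) (metis s_s_comp)
    have IHa: "eval_word F a = eval_word F c" if "tight n c" "word_perm c = adj i \<circ> w" for c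
      by (rule less.hyps) (use that i wa Cons in auto)
    have IHb: "eval_word F c = eval_word F b" if "tight n c" "word_perm c = adj j \<circ> w" for c
      by (rule less.hyps) (use that j wb bs len Cons tight_def in \<open>auto simp: tight_def\<close>)
    \<comment> \<open>\<open>a'\<close> and \<open>b'\<close> enter only through the induction
      hypothesis, so that the case \<open>j < i\<close> is the same fact with the two words
      exchanged.\<close>
    have main: "F i \<circ> eval_word F a' = F j \<circ> eval_word F b'"
      if ij: "i < j" "1 \<le> i" "j < n"
        and d: "inv w (Suc i) < inv w i" "inv w (Suc j) < inv w j"
        and IHa: "\<And>c. tight n c \<Longrightarrow> word_perm c = adj i \<circ> w \<Longrightarrow> eval_word F a' = eval_word F c"
        and IHb: "\<And>c. tight n c \<Longrightarrow> word_perm c = adj j \<circ> w \<Longrightarrow> eval_word F b' = eval_word F c"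
      for i j a' b'
    proof -
      have i: "1 \<le> i" "i < n" and j: "1 \<le> j" "j < n" using ij by auto
      note wi = s_comp_permutes[OF i w] and wj = s_comp_permutes[OF j w]
      note wji = s_comp_permutes[OF j wi] and wij = s_comp_permutes[OF i wj]
      show ?thesis
      proof (cases "j = Suc i")
        case False
        have eq: "adj j \<circ> (adj i \<circ> w) = adj i \<circ> (adj j \<circ> w)"
          using False ij by (auto simp: fun_eq_iff transpose_def)
        obtain c where c: "tight n c" "word_perm c = adj j \<circ> (adj i \<circ> w)"
          using tight_exists[OF wji] .
        \<comment> \<open>\<open>adj i\<close> fixes \<open>j\<close> and \<open>j + 1\<close>, and
          \<open>adj j\<close> fixes \<open>i\<close> and \<open>i + 1\<close>, so each descent
          survives the removal of the other letter.\<close>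
        have d': "inv (adj i \<circ> w) (Suc j) < inv (adj i \<circ> w) j" "inv (adj j \<circ> w) (Suc i) < inv (adj j \<circ> w) i"
          using False ij d by (simp_all add: inv_s_comp[OF w] transpose_def)
        note t = tight_exists_cons[OF wi j d'(1) c]
          tight_exists_cons[OF wj i d'(2) c(1) c(2)[unfolded eq]]
        have "eval_word F a' = F j \<circ> eval_word F c" "eval_word F b' = F i \<circ> eval_word F c"
          using IHa[OF t(1,2)] IHb[OF t(3,4)] by simp_all
        moreover have "F i \<circ> F j = F j \<circ> F i"
          by (rule comm) (use False ij in auto)
        ultimately show ?thesis
          by (simp add: o_assoc)
      next
        case True
        note wiji = s_comp_permutes[OF i wji] and wjij = s_comp_permutes[OF j wij]
        have eq: "adj i \<circ> (adj j \<circ> (adj i \<circ> w)) = adj j \<circ> (adj i \<circ> (adj j \<circ> w))"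
          by (auto simp: fun_eq_iff transpose_def True)
        obtain c where c: "tight n c" "word_perm c = adj i \<circ> (adj j \<circ> (adj i \<circ> w))"
          using tight_exists[OF wiji] .
        have c': "word_perm c = adj j \<circ> (adj i \<circ> (adj j \<circ> w))" using c(2) eq by simp
        \<comment> \<open>The two descents give
          \<open>inv w (i + 2) < inv w (i + 1) < inv w i\<close>. All three are in reverse order, so
          each letter of either side of the braid relation, removed in turn from the left, is a
          descent.\<close>
        have d': "inv (adj j \<circ> (adj i \<circ> w)) (Suc i) < inv (adj j \<circ> (adj i \<circ> w)) i"
          "inv (adj i \<circ> w) (Suc j) < inv (adj i \<circ> w) j"
          "inv (adj i \<circ> (adj j \<circ> w)) (Suc j) < inv (adj i \<circ> (adj j \<circ> w)) j"
          "inv (adj j \<circ> w) (Suc i) < inv (adj j \<circ> w) i"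
          using d by (simp_all add: inv_s_comp[OF w] inv_s_comp[OF wi] inv_s_comp[OF wj[unfolded True]]
              transpose_def True)
        note t = tight_exists_cons[OF wi j d'(2) tight_exists_cons[OF wji i d'(1) c]]
          tight_exists_cons[OF wj i d'(4) tight_exists_cons[OF wij j d'(3) c(1) c']]
        have "eval_word F a' = F j \<circ> (F i \<circ> eval_word F c)" "eval_word F b' = F i \<circ> (F j \<circ> eval_word F c)"
          using IHa[OF t(1,2)] IHb[OF t(3,4)] by simp_all
        moreover have "F i \<circ> F j \<circ> F i = F j \<circ> F i \<circ> F j"
          unfolding True by (rule braid) (use True ij in auto)
        ultimately show ?thesis
          by (simp add: o_assoc)
      qed
    qed
    consider "i = j" | "i < j" | "j < i" by linarith
    then show ?thesis
    proof cases
      case 1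
      then show ?thesis using IHb[OF i(1)] wa by (simp add: Cons bs)
    next
      case 2
      then show ?thesis
        using main[OF 2 i(3) j(4) di dj, of a b] IHa IHb by (simp add: Cons bs)
    next
      case 3
      then show ?thesis
        using main[OF 3 j(3) i(4) dj di, of b a] IHa IHb by (simp add: Cons bs)
    qed
  qed
qed

section \<open>Reduced words of the block permutations \<open>chi\<close>\<close>

lemma chi_permutes: "chi i j permutes {1..i + j}"
proof (rule bij_imp_permutes)
  show "bij_betw (chi i j) {1..i + j} {1..i + j}"
    by (rule bij_betw_byWitness[where f' = "chi j i"]) (auto simp: chi_def)
qed (auto simp: chi_def)

lemma inversions_chi: "inversions (i + j) (chi i j) = {1..i} \<times> {i + 1..i + j}"
  by (auto simp: inversions_def chi_def split: if_splits)

lemma perm_length_chi: "perm_length (i + j) (chi i j) = i * j"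
  by (simp add: inversions_chi card_cartesian_product)

text \<open>Exactly the pairs with one position in each block are inverted, so a word for
  \<open>chi i j\<close> with \<open>i * j\<close> letters is reduced. This length criterion makes
  the concatenated words in the hexagons reduced without further argument.\<close>

lemma chi_word_exists:
  obtains "is" where "set is \<subseteq> {1..<i + j}" "word_perm is = chi i j" "length is = i * j"
proof -
  obtain "is" where "tight (i + j) is" "word_perm is = chi i j"
    using tight_exists[OF chi_permutes] .
  then show thesis using that[of "is"] by (simp add: tight_def perm_length_chi)
qed

lemma word_perm_shift:
  assumes "set is \<subseteq> {1..<n}"
  shows "word_perm (map ((+) c) is) x = (if x \<le> c then x else c + word_perm is (x - c))"
  using assms
proof (induction "is")
  case (Cons i "is")
  have "transpose (c + i) (Suc (c + i)) (if x \<le> c then x else c + y) = (if x \<le> c then x else c + adj i y)" for y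
    using Cons.prems by (simp add: transpose_def)
  then show ?case using Cons by (simp del: if_split)
qed simp

text \<open>The block of length \<open>j\<close> crosses the last \<open>k\<close> positions first,
  then the block of length \<open>i\<close> does.\<close>

lemma word_perm_chi_hexagon:
  assumes "set as \<subseteq> {1..<i + k}" "word_perm as = chi i k" "set bs \<subseteq> {1..<j + k}" "word_perm bs = chi j k"
  shows "word_perm (as @ map ((+) i) bs) = chi (i + j) k"
proof
  fix x
  have eq: "word_perm (as @ map ((+) i) bs) x = chi i k (if x \<le> i then x else i + chi j k (x - i))"
    by (simp add: word_perm_append word_perm_shift[OF assms(3)] assms(2,4))
  \<comment> \<open>The three blocks, and the fixed points 0 and beyond
    \<open>i + j + k\<close>.\<close>
  consider "x = 0" | "1 \<le> x" "x \<le> i" | y where "x = i + y" "1 \<le> y" "y \<le> j"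
    | y where "x = i + j + y" "1 \<le> y" "y \<le> k" | y where "x = i + j + k + y" "1 \<le> y"
    by atomize_elim presburger
  then show "word_perm (as @ map ((+) i) bs) x = chi (i + j) k x"
    
    using eq by cases (simp_all add: chi_def)
qed

text \<open>The block of length \<open>i\<close> first crosses the block of length \<open>j\<close>
  and then, shifted by \<open>j\<close>, the block of length \<open>k\<close>.\<close>

lemma word_perm_chi_hexagon':
  assumes "set as \<subseteq> {1..<i + k}" "word_perm as = chi i k" "set bs \<subseteq> {1..<i + j}" "word_perm bs = chi i j"
  shows "word_perm (map ((+) j) as @ bs) = chi i (j + k)"
proof
  fix x
  have eq: "word_perm (map ((+) j) as @ bs) x =
      (if chi i j x \<le> j then chi i j x else j + chi i k (chi i j x - j))"
    by (simp add: word_perm_append word_perm_shift[OF assms(1)] assms(2,4))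
  consider "x = 0" | "1 \<le> x" "x \<le> i" | y where "x = i + y" "1 \<le> y" "y \<le> j"
    | y where "x = i + j + y" "1 \<le> y" "y \<le> k" | y where "x = i + j + k + y" "1 \<le> y"
    by atomize_elim presburger
  then show "word_perm (map ((+) j) as @ bs) x = chi i (j + k) x"
    
    using eq by cases (simp_all add: chi_def)
qed

section \<open>The braiding of the tensor algebra\<close>

locale braided = tensor_powers scale for scale :: "'k::field_char_0 \<Rightarrow> 'v::ab_group_add \<Rightarrow> 'v" +
  fixes \<sigma> :: "('k, 'v) tensor \<Rightarrow> ('k, 'v) tensor"
  assumes braided: "braided_vector_space scale \<sigma>"
begin

definition sg :: "('k, 'v) tensor mor" where "sg = restr 2 2 \<sigma>"

definition Sg :: "nat \<Rightarrow> nat \<Rightarrow> ('k, 'v) tensor mor" where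
  "Sg n i = idm (i - 1) \<otimes> sg \<otimes> idm (n - 1 - i)"

lemma src_tgt_sg [simp]: "src sg = 2" "tgt sg = 2"
  by (simp_all add: sg_def)

lemma arr_sg [simp]: "arr sg"
  unfolding sg_def
proof (rule arr_restr)
  show "lin 2 \<sigma>" using braided by (simp add: braided_vector_space_def)
  show "\<sigma> (pu vs) \<in> tp 2" if "length vs = 2" for vs
    using braided pure_in_tpow[OF that] unfolding braided_vector_space_def bij_betw_def by blast
qed

lemma src_tgt_Sg [simp]: "1 \<le> i \<Longrightarrow> i < n \<Longrightarrow> src (Sg n i) = n" "1 \<le> i \<Longrightarrow> i < n \<Longrightarrow> tgt (Sg n i) = n"
  by (simp_all add: Sg_def)

lemma arr_Sg [simp]: "arr (Sg n i)"
  by (simp add: Sg_def)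

lemma sigma_at_Sg:
  assumes "1 \<le> i" "i < n" "x \<in> tp n"
  shows "sigma_at scale \<sigma> n i x = app (Sg n i) x"
  unfolding sigma_at_def Sg_def
proof (rule tmap_eq_tens)
  fix y assume "y \<in> tp (src (sg \<otimes> idm (n - 1 - i)))"
  then show "tmap scale 2 (n - 1 - i) \<sigma> id y = app (sg \<otimes> idm (n - 1 - i)) y"
    by (intro tmap_eq_tens) (auto simp: sg_def app_restr app_idm)
qed (use assms in \<open>auto simp: app_idm\<close>)

lemma Sg_pad_right: "1 \<le> i \<Longrightarrow> i < n \<Longrightarrow> Sg (n + m) i = Sg n i \<otimes> idm m"
  by (simp add: Sg_def tens_assoc tens_idm)

lemma Sg_pad_left: "1 \<le> i \<Longrightarrow> i < n \<Longrightarrow> Sg (m + n) (m + i) = idm m \<otimes> Sg n i"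
  by (simp add: Sg_def tens_idm tens_assoc[symmetric])

text \<open>Cutting after position \<open>j - 1\<close> puts the two crossings into different tensor
  factors.\<close>

lemma Sg_commute:
  assumes "1 \<le> i" "Suc i < j" "j < n"
  shows "Sg n i \<cdot> Sg n j = Sg n j \<cdot> Sg n i"
proof -
  have "Sg n i = Sg (j - 1) i \<otimes> idm (n - j + 1)"
    using Sg_pad_right[of i "j - 1" "n - j + 1"] assms by simp
  moreover have "Sg n j = idm (j - 1) \<otimes> Sg (n - j + 1) 1"
    using Sg_pad_left[of 1 "n - j + 1" "j - 1"] assms by simp
  ultimately show ?thesis
    using assms by (simp add: interchange)
qed

lemma Sg_braid_3: "Sg 3 1 \<cdot> (Sg 3 2 \<cdot> Sg 3 1) = Sg 3 2 \<cdot> (Sg 3 1 \<cdot> Sg 3 2)"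
proof (rule mor_ext)
  fix x assume "x \<in> tp (src (Sg 3 1 \<cdot> (Sg 3 2 \<cdot> Sg 3 1)))"
  then have x: "x \<in> tp 3" by simp
  have r: "app (Sg 3 i) y \<in> tp 3" if "y \<in> tp 3" "1 \<le> i" "i < 3" for y i
    using arr_range[OF arr_Sg, of y 3 i] that by simp
  have "sigma_at scale \<sigma> 3 1 (sigma_at scale \<sigma> 3 2 (sigma_at scale \<sigma> 3 1 x)) =
      sigma_at scale \<sigma> 3 2 (sigma_at scale \<sigma> 3 1 (sigma_at scale \<sigma> 3 2 x))"
    using braided x by (simp add: braided_vector_space_def)
  then show "app (Sg 3 1 \<cdot> (Sg 3 2 \<cdot> Sg 3 1)) x = app (Sg 3 2 \<cdot> (Sg 3 1 \<cdot> Sg 3 2)) x"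
    using x by (simp add: sigma_at_Sg r)
qed auto

lemma Sg_braid:
  assumes "1 \<le> i" "Suc i < n"
  shows "Sg n i \<cdot> (Sg n (Suc i) \<cdot> Sg n i) = Sg n (Suc i) \<cdot> (Sg n i \<cdot> Sg n (Suc i))"
proof -
  have 1: "Sg n (i - 1 + k) = idm (i - 1) \<otimes> Sg 3 k \<otimes> idm (n - i - 2)" if "1 \<le> k" "k < 3" for k
    using Sg_pad_left[of k "3 + (n - i - 2)" "i - 1"] Sg_pad_right[of k 3 "n - i - 2"] assms that
    by simp
  have "Sg n i = idm (i - 1) \<otimes> Sg 3 1 \<otimes> idm (n - i - 2)"
    "Sg n (Suc i) = idm (i - 1) \<otimes> Sg 3 2 \<otimes> idm (n - i - 2)"
    using 1[of 1] 1[of 2] assms by simp_all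
  then show ?thesis
    using Sg_braid_3 by (simp add: interchange)
qed

definition W :: "nat \<Rightarrow> nat list \<Rightarrow> ('k, 'v) tensor mor" where
  "W n is = foldr (\<lambda>i f. Sg n i \<cdot> f) is (idm n)"

lemma W_simps [simp]: "W n [] = idm n" "W n (i # is) = Sg n i \<cdot> W n is"
  by (simp_all add: W_def)

lemma arr_W:
  assumes "set is \<subseteq> {1..<n}"
  shows arr_W' [simp]: "arr (W n is)" and src_W [simp]: "src (W n is) = n" and tgt_W [simp]: "tgt (W n is) = n"
proof -
  have "arr (W n is) \<and> src (W n is) = n \<and> tgt (W n is) = n"
    using assms by (induction "is") auto
  then show "arr (W n is)" "src (W n is) = n" "tgt (W n is) = n" by simp_all
qed

lemma W_append:
  assumes "set as \<subseteq> {1..<n}" "set bs \<subseteq> {1..<n}"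
  shows "W n (as @ bs) = W n as \<cdot> W n bs"
  using assms by (induction as) (auto simp: mcomp_assoc)

lemma W_pad_right:
  assumes "set is \<subseteq> {1..<n}"
  shows "W (n + m) is = W n is \<otimes> idm m"
  using assms by (induction "is") (auto simp: tens_idm Sg_pad_right interchange)

lemma W_pad_left:
  assumes "set is \<subseteq> {1..<n}"
  shows "W (m + n) (map ((+) m) is) = idm m \<otimes> W n is"
  using assms by (induction "is") (auto simp: tens_idm Sg_pad_left interchange)

text \<open>The first form is the one in \<open>matsumoto\<close>, the second the one in
  \<open>T_perm\<close>.\<close>

lemma app_W:
  assumes "x \<in> tp n" "set is \<subseteq> {1..<n}"
  shows "app (W n is) x = eval_word (\<lambda>i. app (Sg n i)) is x"
    and "app (W n is) x = foldr (\<lambda>i f. sigma_at scale \<sigma> n i \<circ> f) is id x"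
proof -
  show "app (W n is) x = eval_word (\<lambda>i. app (Sg n i)) is x"
    using assms by (induction "is") (auto simp: app_idm)
  show "app (W n is) x = foldr (\<lambda>i f. sigma_at scale \<sigma> n i \<circ> f) is id x"
    using assms(2)
  proof (induction "is")
    case Nil
    then show ?case using assms(1) by (simp add: app_idm)
  next
    case (Cons i "is")
    then have "app (W n is) x \<in> tp n"
      using arr_range[OF arr_W', of "is" n x] assms(1) by simp
    then show ?case
      using Cons sigma_at_Sg by simp
  qed
qed

lemma W_tight_unique:
  assumes "tight n as" "tight n bs" "word_perm as = word_perm bs"
  shows "W n as = W n bs"
proof (rule mor_ext)
  have sub: "set as \<subseteq> {1..<n}" "set bs \<subseteq> {1..<n}"
    using assms by (auto simp: tight_def)
  have c: "app f \<circ> app g = app (f \<cdot> g)" for f g :: "('k, 'v) tensor mor" by auto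
  \<comment> \<open>Since \<open>app (Sg n i)\<close> is 0 off \<open>tp n\<close>, the relations
    hold between functions on the whole type, as \<open>matsumoto\<close> requires.\<close>
  have "eval_word (\<lambda>i. app (Sg n i)) as = eval_word (\<lambda>i. app (Sg n i)) bs"
  proof (rule matsumoto[OF _ _ assms])
    show "app (Sg n i) \<circ> app (Sg n j) = app (Sg n j) \<circ> app (Sg n i)"
      if "1 \<le> i" "Suc i < j" "j < n" for i j
      unfolding c Sg_commute[OF that] ..
    show "app (Sg n i) \<circ> app (Sg n (Suc i)) \<circ> app (Sg n i) =
        app (Sg n (Suc i)) \<circ> app (Sg n i) \<circ> app (Sg n (Suc i))"
      if "1 \<le> i" "Suc i < n" for i
      unfolding c mcomp_assoc Sg_braid[OF that] ..
  qed
  then show "app (W n as) x = app (W n bs) x" if "x \<in> tp (src (W n as))" for x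
    using app_W(1)[of x n] that sub by simp
  show "arr (W n as)" "arr (W n bs)" "src (W n as) = src (W n bs)" "tgt (W n as) = tgt (W n bs)"
    using sub by simp_all
qed

definition B :: "nat \<Rightarrow> nat \<Rightarrow> ('k, 'v) tensor mor" where
  "B i j = restr (i + j) (i + j) (beta scale \<sigma> i j)"

text \<open>By its length the word is reduced, so Matsumoto's theorem allows it to replace the word
  chosen by \<open>SOME\<close> in \<open>T_perm\<close>.\<close>

lemma B_word:
  assumes "set is \<subseteq> {1..<i + j}" "word_perm is = chi i j" "length is = i * j"
  shows "B i j = W (i + j) is"
proof -
  define js where "js = (SOME is. reduced_expression (i + j) (chi i j) is)"
  have t: "tight (i + j) is" using assms by (simp add: tight_def perm_length_chi)
  then have "reduced_expression (i + j) (chi i j) is"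
    using reduced_expression_tight[OF chi_permutes] assms(2) by blast
  then have "reduced_expression (i + j) (chi i j) js"
    unfolding js_def by (rule someI)
  then have js: "tight (i + j) js" "word_perm js = chi i j"
    using reduced_expression_tight[OF chi_permutes] by blast+
  then have sub: "set js \<subseteq> {1..<i + j}" by (simp add: tight_def)
  have "beta scale \<sigma> i j x = app (W (i + j) is) x" if x: "x \<in> tp (i + j)" for x
    using app_W(2)[OF x sub] W_tight_unique[OF t js(1)] js(2) assms(2)
    by (simp add: beta_def T_perm_def js_def)
  then have "app (B i j) x = app (W (i + j) is) x" for x
    using arr_outside[OF arr_W'[OF assms(1)]] assms(1) by (simp add: B_def restr_def)
  then show ?thesis
    using assms(1) by (intro mor.expand) (auto simp: B_def)
qed

lemma B_simps [simp]: "arr (B i j)" "src (B i j) = i + j" "tgt (B i j) = i + j"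
proof -
  obtain "is" where "set is \<subseteq> {1..<i + j}" "word_perm is = chi i j" "length is = i * j"
    using chi_word_exists .
  then show "arr (B i j)" "src (B i j) = i + j" "tgt (B i j) = i + j"
    using B_word by simp_all
qed

text \<open>The lengths add up to \<open>i * k + j * k = (i + j) * k\<close>, so the concatenation
  of words for the two crossings is a reduced word for \<open>chi (i + j) k\<close>.\<close>

lemma B_hexagon_left: "B (i + j) k = (B i k \<otimes> idm j) \<cdot> (idm i \<otimes> B j k)"
proof -
  obtain as where as: "set as \<subseteq> {1..<i + k}" "word_perm as = chi i k" "length as = i * k"
    using chi_word_exists .
  obtain bs where bs: "set bs \<subseteq> {1..<j + k}" "word_perm bs = chi j k" "length bs = j * k"
    using chi_word_exists .
  have sub: "set as \<subseteq> {1..<i + j + k}" "set (map ((+) i) bs) \<subseteq> {1..<i + j + k}"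
    using as(1) bs(1) by fastforce+
  have "B (i + j) k = W (i + j + k) (as @ map ((+) i) bs)"
    by (rule B_word) (use sub as bs word_perm_chi_hexagon[OF as(1,2) bs(1,2)] in
        \<open>auto simp: algebra_simps\<close>)
  also have "\<dots> = W (i + j + k) as \<cdot> W (i + j + k) (map ((+) i) bs)"
    by (rule W_append[OF sub])
  also have "W (i + j + k) as = B i k \<otimes> idm j"
    using W_pad_right[OF as(1), of j] B_word[OF as] by (simp add: algebra_simps)
  also have "W (i + j + k) (map ((+) i) bs) = idm i \<otimes> B j k"
    using W_pad_left[OF bs(1), of i] B_word[OF bs] by (simp add: algebra_simps)
  finally show ?thesis .
qed

lemma B_hexagon_right: "B i (j + k) = (idm j \<otimes> B i k) \<cdot> (B i j \<otimes> idm k)"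
proof -
  obtain as where as: "set as \<subseteq> {1..<i + k}" "word_perm as = chi i k" "length as = i * k"
    using chi_word_exists .
  obtain bs where bs: "set bs \<subseteq> {1..<i + j}" "word_perm bs = chi i j" "length bs = i * j"
    using chi_word_exists .
  have sub: "set (map ((+) j) as) \<subseteq> {1..<i + (j + k)}" "set bs \<subseteq> {1..<i + (j + k)}"
    using as(1) bs(1) by fastforce+
  have "B i (j + k) = W (i + (j + k)) (map ((+) j) as @ bs)"
    by (rule B_word) (use sub as bs word_perm_chi_hexagon'[OF as(1,2) bs(1,2)] in
        \<open>auto simp: algebra_simps\<close>)
  also have "\<dots> = W (i + (j + k)) (map ((+) j) as) \<cdot> W (i + (j + k)) bs"
    by (rule W_append[OF sub])
  also have "W (i + (j + k)) bs = B i j \<otimes> idm k"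
    using W_pad_right[OF bs(1), of k] B_word[OF bs] by (simp add: algebra_simps)
  also have "W (i + (j + k)) (map ((+) j) as) = idm j \<otimes> B i k"
    using W_pad_left[OF as(1), of j] B_word[OF as] by (simp add: algebra_simps)
  finally show ?thesis .
qed

lemma B_0_left [simp]: "B 0 n = idm n" and B_0_right [simp]: "B n 0 = idm n"
  using B_word[of "[]" 0 n] B_word[of "[]" n 0] by (auto simp: fun_eq_iff chi_def)

lemma B_1_1: "B 1 1 = sg"
proof -
  have "B 1 1 = W (1 + 1) [1]"
    by (rule B_word) (auto simp: fun_eq_iff chi_def transpose_def)
  also have "\<dots> = sg" by (simp add: Sg_def numeral_2_eq_2)
  finally show ?thesis .
qed

section \<open>Naturality with respect to the braiding\<close>

definition natural_left :: "nat \<Rightarrow> ('k, 'v) tensor mor \<Rightarrow> bool" where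
  "natural_left k f \<longleftrightarrow> B (tgt f) k \<cdot> (f \<otimes> idm k) = (idm k \<otimes> f) \<cdot> B (src f) k"

definition natural_right :: "nat \<Rightarrow> ('k, 'v) tensor mor \<Rightarrow> bool" where
  "natural_right k f \<longleftrightarrow> B k (tgt f) \<cdot> (idm k \<otimes> f) = (f \<otimes> idm k) \<cdot> B k (src f)"

definition natural :: "('k, 'v) tensor mor \<Rightarrow> bool" where
  "natural f \<longleftrightarrow> arr f \<and> (\<forall>k. natural_left k f \<and> natural_right k f)"

text \<open>The strands are crossed in two groups, first \<open>a\<close> and then \<open>b\<close>;
  the hexagon cuts the crossings on both sides accordingly.\<close>

lemma natural_left_add:
  assumes "arr f" "natural_left a f" "natural_left b f"
  shows "natural_left (a + b) f"
proof -
  let ?m = "src f" and ?n = "tgt f"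
  have "B ?n (a + b) \<cdot> (f \<otimes> idm (a + b)) =
      (idm a \<otimes> B ?n b) \<cdot> ((B ?n a \<otimes> idm b) \<cdot> ((f \<otimes> idm a) \<otimes> idm b))"
    using assms(1) by (simp add: B_hexagon_right mcomp_assoc tens_assoc tens_idm)
  also have "\<dots> = (idm a \<otimes> B ?n b) \<cdot> ((B ?n a \<cdot> (f \<otimes> idm a)) \<otimes> idm b)"
    using assms(1) by (simp add: interchange)
  \<comment> \<open>The factor \<open>idm b \<cdot> idm b\<close> is inserted in order to read
    \<open>interchange\<close> backwards; hence the removal of the identity rules in the next
    step.\<close>
  also have "\<dots> = (idm a \<otimes> B ?n b) \<cdot> (((idm a \<otimes> f) \<cdot> B ?m a) \<otimes> (idm b \<cdot> idm b))"
    using assms by (simp add: natural_left_def)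
  also have "\<dots> = (idm a \<otimes> B ?n b) \<cdot> ((idm a \<otimes> (f \<otimes> idm b)) \<cdot> (B ?m a \<otimes> idm b))"
    using assms(1) by (simp add: interchange[symmetric] tens_assoc del: comp_idm_left comp_idm_right)
  also have "\<dots> = (idm a \<otimes> (B ?n b \<cdot> (f \<otimes> idm b))) \<cdot> (B ?m a \<otimes> idm b)"
    using assms(1) by (simp add: interchange mcomp_assoc[symmetric])
  also have "\<dots> = (idm a \<otimes> ((idm b \<otimes> f) \<cdot> B ?m b)) \<cdot> (B ?m a \<otimes> idm b)"
    using assms(3) by (simp add: natural_left_def)
  also have "\<dots> = (idm a \<otimes> (idm b \<otimes> f)) \<cdot> ((idm a \<otimes> B ?m b) \<cdot> (B ?m a \<otimes> idm b))"
    using assms(1) by (simp add: interchange mcomp_assoc[symmetric])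
  also have "\<dots> = (idm (a + b) \<otimes> f) \<cdot> B ?m (a + b)"
    using assms(1) by (simp add: B_hexagon_right tens_idm[symmetric] tens_assoc)
  finally show ?thesis by (simp add: natural_left_def)
qed

lemma natural_right_add:
  assumes "arr f" "natural_right a f" "natural_right b f"
  shows "natural_right (a + b) f"
proof -
  let ?m = "src f" and ?n = "tgt f"
  have "B (a + b) ?n \<cdot> (idm (a + b) \<otimes> f) =
      (B a ?n \<otimes> idm b) \<cdot> ((idm a \<otimes> B b ?n) \<cdot> (idm a \<otimes> (idm b \<otimes> f)))"
    using assms(1) by (simp add: B_hexagon_left mcomp_assoc tens_assoc tens_idm[symmetric])
  also have "\<dots> = (B a ?n \<otimes> idm b) \<cdot> (idm a \<otimes> (B b ?n \<cdot> (idm b \<otimes> f)))"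
    using assms(1) by (simp add: interchange)
  also have "\<dots> = (B a ?n \<otimes> idm b) \<cdot> ((idm a \<cdot> idm a) \<otimes> ((f \<otimes> idm b) \<cdot> B b ?m))"
    using assms by (simp add: natural_right_def)
  also have "\<dots> = (B a ?n \<otimes> idm b) \<cdot> (((idm a \<otimes> f) \<otimes> idm b) \<cdot> (idm a \<otimes> B b ?m))"
    using assms(1) by (simp add: interchange[symmetric] tens_assoc del: comp_idm_left comp_idm_right)
  also have "\<dots> = ((B a ?n \<cdot> (idm a \<otimes> f)) \<otimes> idm b) \<cdot> (idm a \<otimes> B b ?m)"
    using assms(1) by (simp add: interchange mcomp_assoc[symmetric])
  also have "\<dots> = (((f \<otimes> idm a) \<cdot> B a ?m) \<otimes> idm b) \<cdot> (idm a \<otimes> B b ?m)"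
    using assms(2) by (simp add: natural_right_def)
  also have "\<dots> = ((f \<otimes> idm a) \<otimes> idm b) \<cdot> ((B a ?m \<otimes> idm b) \<cdot> (idm a \<otimes> B b ?m))"
    using assms(1) by (simp add: interchange mcomp_assoc[symmetric])
  also have "\<dots> = (f \<otimes> idm (a + b)) \<cdot> B (a + b) ?m"
    using assms(1) by (simp add: B_hexagon_left tens_idm[symmetric] tens_assoc)
  finally show ?thesis by (simp add: natural_right_def)
qed

text \<open>One strand is added at a time; no strands at all is trivial.\<close>

lemma naturalI:
  assumes "arr f" "natural_left 1 f" "natural_right 1 f"
  shows "natural f"
proof -
  have "natural_left k f \<and> natural_right k f" for k
  proof (induction k)
    case 0
    then show ?case using assms(1) by (simp add: natural_left_def natural_right_def)
  next
    case (Suc k)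
    then show ?case
      using natural_left_add[OF assms(1) assms(2), of k] natural_right_add[OF assms(1) assms(3), of k] by simp
  qed
  then show ?thesis using assms(1) by (simp add: natural_def)
qed

lemma natural_arr [simp]: "natural f \<Longrightarrow> arr f"
  by (simp add: natural_def)

lemma naturalD:
  assumes "natural f"
  shows "B (tgt f) k \<cdot> (f \<otimes> idm k) = (idm k \<otimes> f) \<cdot> B (src f) k"
    and "B k (tgt f) \<cdot> (idm k \<otimes> f) = (f \<otimes> idm k) \<cdot> B k (src f)"
  using assms by (auto simp: natural_def natural_left_def natural_right_def)

lemma natural_idm [simp]: "natural (idm n)"
  by (rule naturalI) (auto simp: natural_left_def natural_right_def tens_idm add.commute)

lemma natural_comp:
  assumes "natural f" "natural g" "tgt f = src g"
  shows "natural (g \<cdot> f)"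
proof (rule naturalI)
  have a: "arr f" "arr g" using assms by auto
  have "B (tgt g) 1 \<cdot> ((g \<otimes> idm 1) \<cdot> (f \<otimes> idm 1)) = (idm 1 \<otimes> g) \<cdot> ((idm 1 \<otimes> f) \<cdot> B (src f) 1)"
    using naturalD(1)[OF assms(1), of 1] naturalD(1)[OF assms(2), of 1] assms(3) by (metis mcomp_assoc)
  then show "natural_left 1 (g \<cdot> f)"
    using a assms(3) by (simp add: natural_left_def interchange mcomp_assoc[symmetric])
  have "B 1 (tgt g) \<cdot> ((idm 1 \<otimes> g) \<cdot> (idm 1 \<otimes> f)) = (g \<otimes> idm 1) \<cdot> ((f \<otimes> idm 1) \<cdot> B 1 (src f))"
    using naturalD(2)[OF assms(1), of 1] naturalD(2)[OF assms(2), of 1] assms(3) by (metis mcomp_assoc)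
  then show "natural_right 1 (g \<cdot> f)"
    using a assms(3) by (simp add: natural_right_def interchange mcomp_assoc[symmetric])
qed (use assms in auto)

text \<open>Against one strand, the hexagons let the two factors cross one after the other.\<close>

lemma natural_tens:
  assumes f: "natural f" and g: "natural g"
  shows "natural (f \<otimes> g)"
proof (rule naturalI)
  let ?m = "src f" and ?n = "tgt f" and ?m' = "src g" and ?n' = "tgt g"
  note a = natural_arr[OF f] natural_arr[OF g]
  have "B (?n + ?n') 1 \<cdot> ((f \<otimes> g) \<otimes> idm 1) = (B ?n 1 \<otimes> idm ?n') \<cdot> (f \<otimes> (B ?n' 1 \<cdot> (g \<otimes> idm 1)))"
    using a by (simp add: B_hexagon_left mcomp_assoc tens_assoc interchange)
  also have "\<dots> = (B ?n 1 \<otimes> idm ?n') \<cdot> ((f \<cdot> idm ?m) \<otimes> ((idm 1 \<otimes> g) \<cdot> B ?m' 1))"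
    using a by (simp add: naturalD[OF g])
  also have "\<dots> = (B ?n 1 \<otimes> idm ?n') \<cdot> (((f \<otimes> idm 1) \<otimes> g) \<cdot> (idm ?m \<otimes> B ?m' 1))"
    using a by (simp add: interchange[symmetric] tens_assoc del: comp_idm_left comp_idm_right)
  also have "\<dots> = ((B ?n 1 \<cdot> (f \<otimes> idm 1)) \<otimes> g) \<cdot> (idm ?m \<otimes> B ?m' 1)"
    using a by (simp add: interchange mcomp_assoc[symmetric])
  also have "\<dots> = (((idm 1 \<otimes> f) \<cdot> B ?m 1) \<otimes> (g \<cdot> idm ?m')) \<cdot> (idm ?m \<otimes> B ?m' 1)"
    using a by (simp add: naturalD[OF f])
  also have "\<dots> = (idm 1 \<otimes> (f \<otimes> g)) \<cdot> ((B ?m 1 \<otimes> idm ?m') \<cdot> (idm ?m \<otimes> B ?m' 1))"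
    using a by (simp add: interchange[symmetric] tens_assoc mcomp_assoc del: comp_idm_left comp_idm_right)
  finally show "natural_left 1 (f \<otimes> g)"
    by (simp add: natural_left_def B_hexagon_left)
  have "B 1 (?n + ?n') \<cdot> (idm 1 \<otimes> (f \<otimes> g)) = (idm ?n \<otimes> B 1 ?n') \<cdot> ((B 1 ?n \<cdot> (idm 1 \<otimes> f)) \<otimes> g)"
    using a by (simp add: B_hexagon_right mcomp_assoc tens_assoc[symmetric] interchange)
  also have "\<dots> = (idm ?n \<otimes> B 1 ?n') \<cdot> (((f \<otimes> idm 1) \<cdot> B 1 ?m) \<otimes> (g \<cdot> idm ?m'))"
    using a by (simp add: naturalD[OF f])
  also have "\<dots> = (idm ?n \<otimes> B 1 ?n') \<cdot> ((f \<otimes> (idm 1 \<otimes> g)) \<cdot> (B 1 ?m \<otimes> idm ?m'))"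
    using a by (simp add: interchange[symmetric] tens_assoc del: comp_idm_left comp_idm_right)
  also have "\<dots> = (f \<otimes> (B 1 ?n' \<cdot> (idm 1 \<otimes> g))) \<cdot> (B 1 ?m \<otimes> idm ?m')"
    using a by (simp add: interchange mcomp_assoc[symmetric])
  also have "\<dots> = ((f \<cdot> idm ?m) \<otimes> ((g \<otimes> idm 1) \<cdot> B 1 ?m')) \<cdot> (B 1 ?m \<otimes> idm ?m')"
    using a by (simp add: naturalD[OF g])
  also have "\<dots> = ((f \<otimes> g) \<otimes> idm 1) \<cdot> ((idm ?m \<otimes> B 1 ?m') \<cdot> (B 1 ?m \<otimes> idm ?m'))"
    using a by (simp add: interchange[symmetric] tens_assoc mcomp_assoc del: comp_idm_left comp_idm_right)
  finally show "natural_right 1 (f \<otimes> g)"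
    by (simp add: natural_right_def B_hexagon_right)
qed (use assms in auto)

lemma natural_lsum:
  assumes "\<And>a. a \<in> A \<Longrightarrow> natural (F a)" "\<And>a. a \<in> A \<Longrightarrow> src (F a) = m" "\<And>a. a \<in> A \<Longrightarrow> tgt (F a) = n"
  shows "natural (lsum m n A F)"
proof (rule naturalI)
  have a: "a \<in> A \<Longrightarrow> arr (F a)" for a using assms(1) by auto
  have "B n 1 \<cdot> (F a \<otimes> idm 1) = (idm 1 \<otimes> F a) \<cdot> B m 1"
    "B 1 n \<cdot> (idm 1 \<otimes> F a) = (F a \<otimes> idm 1) \<cdot> B 1 m" if "a \<in> A" for a
    using naturalD[OF assms(1)[OF that], of 1] assms(2,3) that by simp_all
  then show "natural_left 1 (lsum m n A F)" "natural_right 1 (lsum m n A F)"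
    using a assms(2,3) unfolding natural_left_def natural_right_def
    by (simp_all add: lsum_tens_left lsum_tens_right lsum_comp_right lsum_comp_left add.commute cong: lsum_cong)
qed (use assms in auto)

lemma natural_mdiff:
  assumes "natural f" "natural g" "src f = src g" "tgt f = tgt g"
  shows "natural (mdiff f g)"
proof (rule naturalI)
  have a: "arr f" "arr g" using assms by auto
  show "natural_left 1 (mdiff f g)" "natural_right 1 (mdiff f g)"
    using a assms(3,4) naturalD[OF assms(1), of 1] naturalD[OF assms(2), of 1]
    unfolding natural_left_def natural_right_def
    by (simp_all add: mdiff_tens_left mdiff_tens_right mdiff_comp_left mdiff_comp_right add.commute)
qed (use assms in auto)

text \<open>With \<open>B 2 1\<close> and \<open>B 1 2\<close> expanded by the hexagons, both
  conditions against one strand are the braid relation.\<close>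

lemma natural_sg: "natural sg"
proof (rule naturalI)
  have S: "sg \<otimes> idm 1 = Sg 3 1" "idm 1 \<otimes> sg = Sg 3 2"
    by (simp_all add: Sg_def)
  have B: "B 2 1 = Sg 3 1 \<cdot> Sg 3 2" "B 1 2 = Sg 3 2 \<cdot> Sg 3 1"
    using B_hexagon_left[of 1 1 1] B_hexagon_right[of 1 1 1] by (simp_all only: S B_1_1 one_add_one)
  show "natural_left 1 sg" "natural_right 1 sg"
    using Sg_braid_3 by (simp_all only: natural_left_def natural_right_def src_tgt_sg S B mcomp_assoc)
qed simp

lemma natural_W: "set is \<subseteq> {1..<n} \<Longrightarrow> natural (W n is)"
  by (induction "is") (auto intro!: natural_comp natural_tens simp: Sg_def natural_sg)

lemma natural_B [simp]: "natural (B i j)"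
proof -
  obtain "is" where "set is \<subseteq> {1..<i + j}" "word_perm is = chi i j" "length is = i * j"
    using chi_word_exists .
  then show ?thesis using B_word natural_W by simp
qed

end

section \<open>Components of the star product\<close>

definition is_zero :: "'t::zero mor \<Rightarrow> bool" where
  "is_zero f \<longleftrightarrow> (\<forall>x. app f x = 0)"

lemma is_zero_lsum: "(\<And>a. a \<in> A \<Longrightarrow> is_zero (F a)) \<Longrightarrow> is_zero (lsum m n A F)"
  by (simp add: is_zero_def lsum_def)

lemma is_zero_comp_right: "is_zero g \<Longrightarrow> is_zero (g \<cdot> f)"
  by (simp add: is_zero_def)

lemma is_zero_eq: "is_zero f \<Longrightarrow> is_zero g \<Longrightarrow> src f = src g \<Longrightarrow> tgt f = tgt g \<Longrightarrow> f = g"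
  by (auto simp: is_zero_def intro!: mor.expand)

text \<open>Reindexing of double sums. The inner degrees are arbitrary on both sides because the
  outer sum only uses the functions \<open>app\<close>.\<close>

lemma lsum_nested_bij:
  assumes "finite A" "\<And>a. a \<in> A \<Longrightarrow> finite (C a)" "finite D" "\<And>b. b \<in> D \<Longrightarrow> finite (E b)"
    and "bij_betw h (Sigma A C) (Sigma D E)"
    and "\<And>a c. a \<in> A \<Longrightarrow> c \<in> C a \<Longrightarrow> F a c = G (fst (h (a, c))) (snd (h (a, c)))"
  shows "lsum m n A (\<lambda>a. lsum (m1 a) (n1 a) (C a) (F a)) = lsum m n D (\<lambda>b. lsum (m2 b) (n2 b) (E b) (G b))"
proof -
  have "(\<Sum>a\<in>A. \<Sum>c\<in>C a. app (F a c) x) = (\<Sum>b\<in>D. \<Sum>d\<in>E b. app (G b d) x)" for x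
  proof -
    have "(\<Sum>a\<in>A. \<Sum>c\<in>C a. app (F a c) x) = (\<Sum>p\<in>Sigma A C. app (F (fst p) (snd p)) x)"
      using assms(1,2) by (subst sum.Sigma) (auto simp: split_beta)
    also have "\<dots> = (\<Sum>p\<in>Sigma A C. app (G (fst (h p)) (snd (h p))) x)"
      by (rule sum.cong) (use assms(6) in auto)
    also have "\<dots> = (\<Sum>q\<in>Sigma D E. app (G (fst q) (snd q)) x)"
      by (rule sum.reindex_bij_betw[OF assms(5)])
    also have "\<dots> = (\<Sum>b\<in>D. \<Sum>d\<in>E b. app (G b d) x)"
      using assms(3,4) by (subst sum.Sigma) (auto simp: split_beta)
    finally show ?thesis .
  qed
  then show ?thesis by (simp add: lsum_def)
qed

text \<open>Index set of deconcatenation in degree \<open>n\<close>.\<close>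

definition sp :: "nat \<Rightarrow> (nat \<times> nat) set" where
  "sp n = {(a, b). a + b = n}"

lemma in_sp [simp]: "(a, b) \<in> sp n \<longleftrightarrow> a + b = n"
  by (simp add: sp_def)

lemma finite_sp [simp]: "finite (sp n)"
  by (rule finite_subset[of _ "{..n} \<times> {..n}"]) (auto simp: sp_def)

context tensor_powers
begin

lemma is_zero_comp_left: "arr g \<Longrightarrow> is_zero f \<Longrightarrow> is_zero (g \<cdot> f)"
  by (simp add: is_zero_def arr_zero)

lemma is_zero_tens:
  assumes "arr f" "arr g" "is_zero f \<or> is_zero g"
  shows "is_zero (f \<otimes> g)"
proof -
  define z where "z = Mor (src (f \<otimes> g)) (tgt (f \<otimes> g)) (\<lambda>_. 0 :: ('k, 'v) tensor)"
  have z: "arr z" "src z = src f + src g" "tgt z = tgt f + tgt g"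
    by (simp_all add: z_def arr_def linear_on_tpow_def tpow_closed(1))
  have "f \<otimes> g = z"
  proof (rule mor_tens_eqI[where p = "src f" and q = "src g"])
    fix us vs :: "'v list" assume l: "length us = src f" "length vs = src g"
    have "app f (pu us) \<in> tp (tgt f)" "app g (pu vs) \<in> tp (tgt g)"
      using assms arr_range l pure_in_tpow by blast+
    then have "app f (pu us) \<odot> app g (pu vs) = 0"
      using assms(3) conc_zero_left conc_zero_right unfolding is_zero_def by metis
    then show "app (f \<otimes> g) (pu (us @ vs)) = app z (pu (us @ vs))"
      using assms l by (simp add: app_tens_pure) (simp add: z_def)
  qed (use assms z in auto)
  then show ?thesis by (simp add: is_zero_def z_def)
qed

end

lemma length_le_sums:
  "(0, 0) \<notin> set ps \<Longrightarrow> length ps \<le> fst_sum ps + snd_sum ps"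
  by (induction ps) force+

lemma finite_tuples [simp]: "finite (tuples r p q)"
proof (rule finite_subset)
  show "tuples r p q \<subseteq> {ps. set ps \<subseteq> {..p} \<times> {..q} \<and> length ps = r}"
    using member_le_sum_list by (force simp: tuples_def)
  show "finite {ps. set ps \<subseteq> {..p} \<times> {..q} \<and> length ps = r}"
    by (rule finite_lists_length_eq) simp
qed

section \<open>The braided coproduct on two copies of the tensor algebra\<close>

context braided
begin

definition CP :: "nat \<times> nat \<Rightarrow> nat \<times> nat \<Rightarrow> ('k, 'v) tensor mor" where
  "CP = (\<lambda>(a, b) (c, d). idm a \<otimes> B c b \<otimes> idm d)"

lemma CP_simps [simp]:
  "natural (CP (a, b) (c, d))" "src (CP (a, b) (c, d)) = a + c + b + d" "tgt (CP (a, b) (c, d)) = a + c + b + d"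
  by (auto simp: CP_def intro!: natural_tens)

lemma coprod_CP:
  assumes "x \<in> tp (a + c + b + d)"
  shows "coprod scale \<sigma> (a, b) (c, d) x = app (CP (a, b) (c, d)) x"
  unfolding coprod_def CP_def prod.case
proof (rule tmap_eq_tens)
  fix y assume "y \<in> tp (src (B c b \<otimes> idm d))"
  then show "tmap scale (c + b) d (beta scale \<sigma> c b) id y = app (B c b \<otimes> idm d) y"
    by (intro tmap_eq_tens) (simp_all, simp_all add: B_def app_restr app_idm)
qed (use assms in \<open>auto simp: app_idm add.assoc\<close>)

text \<open>Coassociativity on components. By the hexagons both sides consist of the crossings of
  \<open>c\<close> with \<open>b\<close>, \<open>g\<close> with \<open>b\<close> and
  \<open>g\<close> with \<open>d\<close>; the first and the last act on disjoint strands and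
  commute.\<close>

lemma CP_coassoc:
  "(CP (a, b) (c, d) \<otimes> idm (g + h)) \<cdot> CP (a + c, b + d) (g, h) =
   (idm (a + b) \<otimes> CP (c, d) (g, h)) \<cdot> CP (a, b) (c + g, d + h)"
proof -
  \<comment> \<open>The outer strands \<open>a\<close> and \<open>h\<close> are not touched;
    \<open>?Z1\<close> and \<open>?Z2\<close> act on the strands \<open>c\<close>, \<open>g\<close>,
    \<open>b\<close>, \<open>d\<close> between them.\<close>
  let ?Z1 = "(B c b \<otimes> idm (d + g)) \<cdot> (idm c \<otimes> B g (b + d))"
  let ?Z2 = "(idm (b + c) \<otimes> B g d) \<cdot> (B (c + g) b \<otimes> idm d)"
  have L: "(CP (a, b) (c, d) \<otimes> idm (g + h)) \<cdot> CP (a + c, b + d) (g, h) = idm a \<otimes> ?Z1 \<otimes> idm h"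
  proof -
    have "CP (a, b) (c, d) \<otimes> idm (g + h) = idm a \<otimes> (B c b \<otimes> idm (d + g)) \<otimes> idm h"
      by (simp add: CP_def tens_assoc tens_idm add.assoc)
    moreover have "CP (a + c, b + d) (g, h) = idm a \<otimes> (idm c \<otimes> B g (b + d)) \<otimes> idm h"
      by (simp add: CP_def tens_assoc tens_idm[symmetric])
    ultimately show ?thesis by (simp add: interchange)
  qed
  have R: "(idm (a + b) \<otimes> CP (c, d) (g, h)) \<cdot> CP (a, b) (c + g, d + h) = idm a \<otimes> ?Z2 \<otimes> idm h"
  proof -
    have "idm (a + b) \<otimes> CP (c, d) (g, h) = (idm (a + (b + c)) \<otimes> B g d) \<otimes> idm h"
      unfolding CP_def prod.case tens_idm[symmetric] by (simp add: tens_assoc)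
    also have "\<dots> = idm a \<otimes> (idm (b + c) \<otimes> B g d) \<otimes> idm h"
      unfolding tens_idm[symmetric] by (simp add: tens_assoc)
    finally have 1: "idm (a + b) \<otimes> CP (c, d) (g, h) = \<dots>" .
    have "CP (a, b) (c + g, d + h) = idm a \<otimes> (B (c + g) b \<otimes> idm d) \<otimes> idm h"
      by (simp add: CP_def tens_assoc tens_idm[symmetric])
    with 1 show ?thesis by (simp add: interchange)
  qed
  have "?Z1 = (B c b \<otimes> idm (d + g)) \<cdot> ((idm c \<otimes> idm b \<otimes> B g d) \<cdot> (idm c \<otimes> B g b \<otimes> idm d))"
    by (simp add: B_hexagon_right interchange)
  also have "\<dots> = ((B c b \<otimes> idm (d + g)) \<cdot> (idm (c + b) \<otimes> B g d)) \<cdot> (idm c \<otimes> B g b \<otimes> idm d)"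
    by (simp add: mcomp_assoc tens_idm tens_assoc[symmetric])
  also have "(B c b \<otimes> idm (d + g)) \<cdot> (idm (c + b) \<otimes> B g d) = (idm (b + c) \<otimes> B g d) \<cdot> (B c b \<otimes> idm (g + d))"
    by (simp add: interchange add.commute)
  also have "((idm (b + c) \<otimes> B g d) \<cdot> (B c b \<otimes> idm (g + d))) \<cdot> (idm c \<otimes> B g b \<otimes> idm d) =
      (idm (b + c) \<otimes> B g d) \<cdot> (((B c b \<otimes> idm g) \<otimes> idm d) \<cdot> ((idm c \<otimes> B g b) \<otimes> idm d))"
    by (simp add: mcomp_assoc tens_assoc tens_idm)
  also have "\<dots> = ?Z2"
    by (simp add: B_hexagon_left interchange)
  finally show ?thesis using L R by simp
qed

text \<open>The list of degrees is reversed, since \<open>iter_coprod\<close> recurses on its last entry.\<close>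

fun ICr :: "(nat \<times> nat) list \<Rightarrow> ('k, 'v) tensor mor" where
  "ICr [] = idm 0"
| "ICr ((c, d) # ps) = (ICr ps \<otimes> idm (c + d)) \<cdot> CP (fst_sum ps, snd_sum ps) (c, d)"

lemma ICr_natural [simp]:
  "natural (ICr ps)" "src (ICr ps) = fst_sum ps + snd_sum ps" "tgt (ICr ps) = fst_sum ps + snd_sum ps"
proof (induction ps)
  case (Cons p ps)
  obtain c d where p: "p = (c, d)" by (cases p)
  { case 1
    then show ?case using Cons by (auto simp: p intro!: natural_comp natural_tens) }
  { case 2
    then show ?case using Cons by (simp add: p) }
  { case 3
    then show ?case using Cons by (simp add: p) }
qed auto

lemma iter_coprod_ICr:
  "x \<in> tp (fst_sum ps + snd_sum ps) \<Longrightarrow> iter_coprod scale \<sigma> (rev ps) x = app (ICr ps) x"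
proof (induction ps arbitrary: x)
  case Nil
  then show ?case by (simp add: app_idm)
next
  case (Cons p ps)
  obtain c d where p: "p = (c, d)" by (cases p)
  have sums: "fst_sum (rev ps) = fst_sum ps" "snd_sum (rev ps) = snd_sum ps"
    by (simp_all add: rev_map[symmetric] sum_list_rev)
  let ?y = "app (CP (fst_sum ps, snd_sum ps) (c, d)) x"
  have x: "x \<in> tp (fst_sum ps + c + snd_sum ps + d)"
    using Cons.prems by (simp add: p ac_simps)
  then have y: "?y \<in> tp (fst_sum ps + snd_sum ps + (c + d))"
    using arr_range[of "CP (fst_sum ps, snd_sum ps) (c, d)" x] by (simp add: ac_simps)
  show ?case
  proof (cases "ps = []")
    \<comment> \<open>\<open>iter_coprod\<close> stops at one pair, \<open>ICr\<close> only at the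
      empty list; the additional factor \<open>CP (0, 0) (c, d)\<close> is the identity.\<close>
    case True
    then show ?thesis using Cons.prems by (simp add: p app_idm CP_def tens_idm)
  next
    case False
    have "tmap scale (fst_sum ps + snd_sum ps) (c + d) (iter_coprod scale \<sigma> (rev ps)) id ?y =
        app (ICr ps \<otimes> idm (c + d)) ?y"
      by (rule tmap_eq_tens) (use Cons.IH y in \<open>auto simp: app_idm\<close>)
    then show ?thesis
      using False coprod_CP[OF x] by (simp add: p sums iter_coprod.simps(3)[of "rev ps"])
  qed
qed

end

section \<open>The star product of a family of maps\<close>

locale brace_family = braided scale \<sigma>
  for scale :: "'k::field_char_0 \<Rightarrow> 'v::ab_group_add \<Rightarrow> 'v" and \<sigma> +
  fixes X :: "nat \<Rightarrow> nat \<Rightarrow> ('k, 'v) tensor mor"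
begin

fun MT :: "(nat \<times> nat) list \<Rightarrow> ('k, 'v) tensor mor" where
  "MT [] = idm 0"
| "MT ((i, j) # ps) = X i j \<otimes> MT ps"

text \<open>The component \<open>V\<^sup>\<otimes>\<^sup>p \<otimes> V\<^sup>\<otimes>\<^sup>q \<rightarrow> V\<^sup>\<otimes>\<^sup>r\<close> of the star product.\<close>

definition St :: "nat \<Rightarrow> nat \<Rightarrow> nat \<Rightarrow> ('k, 'v) tensor mor" where
  "St r p q = lsum (p + q) r (tuples r p q) (\<lambda>ps. MT ps \<cdot> ICr (rev ps))"

lemma St_src_tgt [simp]: "src (St r p q) = p + q" "tgt (St r p q) = r"
  by (simp_all add: St_def)

text \<open>The assumption concerns only the pairs in \<open>ps\<close>: while the brace maps are
  being constructed, naturality is known in lower degree only.\<close>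

lemma MT_natural:
  assumes "\<And>i j. (i, j) \<in> set ps \<Longrightarrow> natural (X i j) \<and> src (X i j) = i + j \<and> tgt (X i j) = 1"
  shows "natural (MT ps)" "src (MT ps) = fst_sum ps + snd_sum ps" "tgt (MT ps) = length ps"
proof -
  have "natural (MT ps) \<and> src (MT ps) = fst_sum ps + snd_sum ps \<and> tgt (MT ps) = length ps"
    using assms by (induction ps rule: MT.induct) (auto intro!: natural_tens)
  then show "natural (MT ps)" "src (MT ps) = fst_sum ps + snd_sum ps" "tgt (MT ps) = length ps"
    by simp_all
qed

lemma MT_zero:
  assumes "\<And>i j. (i, j) \<in> set ps \<Longrightarrow> arr (X i j)" "arr (X 0 0)" "is_zero (X 0 0)" "(0, 0) \<in> set ps"
  shows "is_zero (MT ps)"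
proof -
  have a: "arr (MT ps)" if "\<And>i j. (i, j) \<in> set ps \<Longrightarrow> arr (X i j)" for ps
    using that by (induction ps rule: MT.induct) auto
  show ?thesis
    using assms
  proof (induction ps rule: MT.induct)
    case (2 i j ps)
    show ?case
    proof (cases "(0, 0) \<in> set ps")
      case True
      then show ?thesis using 2 a[of ps] by (auto intro!: is_zero_tens)
    next
      case False
      then have "i = 0" "j = 0" using 2(5) by auto
      then show ?thesis using 2 a[of ps] by (auto intro!: is_zero_tens)
    qed
  qed auto
qed

end

locale natural_brace_family = brace_family scale \<sigma> X
  for scale :: "'k::field_char_0 \<Rightarrow> 'v::ab_group_add \<Rightarrow> 'v" and \<sigma> and X +
  assumes X_natural [simp]: "natural (X i j)"
    and X_src [simp]: "src (X i j) = i + j" and X_tgt [simp]: "tgt (X i j) = 1"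
    and X_0_0: "is_zero (X 0 0)"
begin

lemma MT_simps [simp]: "natural (MT ps)" "src (MT ps) = fst_sum ps + snd_sum ps" "tgt (MT ps) = length ps"
  using MT_natural[of ps] by auto

lemma MT_append: "MT (ps @ qs) = MT ps \<otimes> MT qs"
  by (induction ps rule: MT.induct) (simp_all add: tens_assoc)

lemma sums_rev [simp]: "fst_sum (rev ps) = fst_sum ps" "snd_sum (rev ps) = snd_sum ps"
  by (simp_all add: rev_map[symmetric] sum_list_rev)

lemma St_natural [simp]: "natural (St r p q)"
  unfolding St_def by (rule natural_lsum) (auto simp: tuples_def intro!: natural_comp)

text \<open>Compatibility with the counits: the only tuple of length 0 has both sums 0.\<close>

lemma St_0: "St 0 0 0 = idm 0" and St_0_zero: "p + q > 0 \<Longrightarrow> is_zero (St 0 p q)"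
proof -
  have "tuples 0 0 0 = {[]}" by (auto simp: tuples_def)
  then show "St 0 0 0 = idm 0" by (simp add: St_def lsum_single)
  show "is_zero (St 0 p q)" if "p + q > 0"
    unfolding St_def by (rule is_zero_lsum) (use that in \<open>auto simp: tuples_def\<close>)
qed

text \<open>More entries than total degree force an entry \<open>(0, 0)\<close>, where the family
  vanishes.\<close>

lemma St_zero: "p + q < r \<Longrightarrow> is_zero (St r p q)"
  unfolding St_def
proof (rule is_zero_lsum, rule is_zero_comp_right, rule MT_zero)
  fix ps assume "p + q < r" "ps \<in> tuples r p q"
  then show "(0, 0) \<in> set ps"
    using length_le_sums[of ps] by (auto simp: tuples_def)
qed (use X_0_0 in auto)

text \<open>The last pair of each tuple is split off, in step with the recursion of the iterated
  coproduct.\<close>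

lemma St_Suc:
  "St (Suc r) p q = lsum (p + q) (Suc r) (sp p \<times> sp q)
     (\<lambda>((a, c), (b, d)). (St r a b \<otimes> X c d) \<cdot> CP (a, b) (c, d))"
proof -
  have tm: "MT (ps @ [(c, d)]) \<cdot> ICr (rev (ps @ [(c, d)])) =
      ((MT ps \<cdot> ICr (rev ps)) \<otimes> X c d) \<cdot> CP (fst_sum ps, snd_sum ps) (c, d)" for ps c d
    by (simp add: MT_append mcomp_assoc[symmetric] interchange)
  \<comment> \<open>One-element inner sums bring the left side into the nested form of
    \<open>lsum_nested_bij\<close>.\<close>
  have "St (Suc r) p q = lsum (p + q) (Suc r) (tuples (Suc r) p q)
      (\<lambda>ps. lsum (p + q) (Suc r) {()} (\<lambda>_. MT ps \<cdot> ICr (rev ps)))"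
    unfolding St_def by (rule lsum_cong) (auto simp: lsum_def tuples_def intro!: mor.expand)
  also have "\<dots> = lsum (p + q) (Suc r) (sp p \<times> sp q) (\<lambda>u.
      lsum (p + q) (Suc r) (tuples r (fst (fst u)) (fst (snd u)))
        (\<lambda>ps. ((MT ps \<cdot> ICr (rev ps)) \<otimes> X (snd (fst u)) (snd (snd u))) \<cdot>
           CP (fst (fst u), fst (snd u)) (snd (fst u), snd (snd u))))"
    (is "_ = lsum _ _ _ (\<lambda>u. lsum _ _ (?E u) _)")
  proof (rule lsum_nested_bij)
    define h where "h = (\<lambda>(ps :: (nat \<times> nat) list, _ :: unit).
      (((fst_sum (butlast ps), fst (last ps)), (snd_sum (butlast ps), snd (last ps))), butlast ps))"
    define h' :: "((nat \<times> nat) \<times> nat \<times> nat) \<times> (nat \<times> nat) list \<Rightarrow> _" where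
      "h' = (\<lambda>(((a, c), (b, d)), ps). (ps @ [(c, d)], ()))"
    have snoc: "\<exists>qs c d. ps = qs @ [(c, d)]" if "length ps = Suc r" for ps :: "(nat \<times> nat) list"
      using that by (cases ps rule: rev_cases) auto
    show "bij_betw h (tuples (Suc r) p q \<times> {()}) (Sigma (sp p \<times> sp q) ?E)"
    proof (rule bij_betw_byWitness[where f' = h'])
      show "\<forall>a\<in>tuples (Suc r) p q \<times> {()}. h' (h a) = a"
        using snoc by (fastforce simp: h_def h'_def tuples_def)
      show "\<forall>a\<in>Sigma (sp p \<times> sp q) ?E. h (h' a) = a"
        by (auto simp: h_def h'_def tuples_def)
      show "h ` (tuples (Suc r) p q \<times> {()}) \<subseteq> Sigma (sp p \<times> sp q) ?E"
        using snoc by (fastforce simp: h_def tuples_def)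
      show "h' ` Sigma (sp p \<times> sp q) ?E \<subseteq> tuples (Suc r) p q \<times> {()}"
        by (auto simp: h'_def tuples_def)
    qed
    fix ps u assume "ps \<in> tuples (Suc r) p q"
    then obtain qs c d where "ps = qs @ [(c, d)]"
      using snoc[of ps] by (auto simp: tuples_def)
    then show "MT ps \<cdot> ICr (rev ps) =
        ((MT (snd (h (ps, u))) \<cdot> ICr (rev (snd (h (ps, u))))) \<otimes> X (snd (fst (fst (h (ps, u))))) (snd (snd (fst (h (ps, u)))))) \<cdot>
           CP (fst (fst (fst (h (ps, u)))), fst (snd (fst (h (ps, u))))) (snd (fst (fst (h (ps, u)))), snd (snd (fst (h (ps, u)))))"
      using tm[of qs c d] by (simp add: h_def)
  qed auto
  also have "\<dots> = lsum (p + q) (Suc r) (sp p \<times> sp q)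
     (\<lambda>((a, c), (b, d)). (St r a b \<otimes> X c d) \<cdot> CP (a, b) (c, d))"
  proof (rule lsum_cong)
    fix u assume "u \<in> sp p \<times> sp q"
    then obtain a b c d where u: "u = ((a, c), (b, d))" and pq: "a + c = p" "b + d = q" by auto
    show "lsum (p + q) (Suc r) (tuples r (fst (fst u)) (fst (snd u)))
        (\<lambda>ps. ((MT ps \<cdot> ICr (rev ps)) \<otimes> X (snd (fst u)) (snd (snd u))) \<cdot>
           CP (fst (fst u), fst (snd u)) (snd (fst u), snd (snd u))) =
      ((\<lambda>((a, c), (b, d)). (St r a b \<otimes> X c d) \<cdot> CP (a, b) (c, d)) u)"
      unfolding u St_def prod.case fst_conv snd_conv
      by (subst lsum_tens_left) (auto simp: tuples_def lsum_comp_right pq[symmetric] intro!: lsum_cong)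
  qed auto
  finally show ?thesis .
qed

lemma St_1 [simp]: "St 1 p q = X p q"
proof -
  have t: "tuples 1 p q = {[(p, q)]}"
    by (auto simp: tuples_def length_Suc_conv)
  have "MT [(p, q)] \<cdot> ICr (rev [(p, q)]) = X p q"
    by (simp add: CP_def tens_idm)
  then show ?thesis unfolding St_def t by (subst lsum_single) simp_all
qed

text \<open>The star product is a coalgebra map.\<close>

lemma St_split:
  "St (r + s) p q = lsum (p + q) (r + s) (sp p \<times> sp q)
     (\<lambda>((a, c), (b, d)). (St r a b \<otimes> St s c d) \<cdot> CP (a, b) (c, d))"
proof (induction s arbitrary: p q)
  case 0
  have "lsum (p + q) r (sp p \<times> sp q) (\<lambda>((a, c), (b, d)). (St r a b \<otimes> St 0 c d) \<cdot> CP (a, b) (c, d)) =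
      lsum (p + q) r {((p, 0), (q, 0))} (\<lambda>((a, c), (b, d)). (St r a b \<otimes> St 0 c d) \<cdot> CP (a, b) (c, d))"
  \<comment> \<open>\<open>St 0 c d\<close> vanishes in positive degree, so only the splitting with
    \<open>c = d = 0\<close> remains.\<close>
  proof (rule lsum_mono_neutral[symmetric])
    fix u x assume "u \<in> sp p \<times> sp q - {((p, 0), (q, 0))}"
    then obtain a b c d where u: "u = ((a, c), (b, d))" and pq: "c + d > 0" by fastforce
    have "is_zero ((\<lambda>((a, c), (b, d)). (St r a b \<otimes> St 0 c d) \<cdot> CP (a, b) (c, d)) u)"
      unfolding u prod.case by (intro is_zero_comp_right is_zero_tens disjI2 St_0_zero pq) auto
    then show "app ((\<lambda>((a, c), (b, d)). (St r a b \<otimes> St 0 c d) \<cdot> CP (a, b) (c, d)) u) x = 0"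
      by (simp add: is_zero_def)
  qed auto
  also have "\<dots> = (St r p q \<otimes> St 0 0 0) \<cdot> CP (p, q) (0, 0)"
    by (subst lsum_single) auto
  also have "\<dots> = St r p q" by (simp add: St_0 CP_def tens_idm)
  finally show ?case by simp
next
  case (Suc s)
  let ?n = "Suc (r + s)"
  have "St (r + Suc s) p q = lsum (p + q) ?n (sp p \<times> sp q)
     (\<lambda>((a, c), (b, d)). (St (r + s) a b \<otimes> X c d) \<cdot> CP (a, b) (c, d))"
    using St_Suc[of "r + s" p q] by simp
  also have "\<dots> = lsum (p + q) ?n (sp p \<times> sp q) (\<lambda>u. lsum (p + q) ?n (sp (fst (fst u)) \<times> sp (fst (snd u)))
      (\<lambda>v. (((St r (fst (fst v)) (fst (snd v)) \<otimes> St s (snd (fst v)) (snd (snd v))) \<cdot>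
         CP (fst (fst v), fst (snd v)) (snd (fst v), snd (snd v))) \<otimes> X (snd (fst u)) (snd (snd u)))
         \<cdot> CP (fst (fst u), fst (snd u)) (snd (fst u), snd (snd u))))"
  proof (rule lsum_cong)
    fix u assume "u \<in> sp p \<times> sp q"
    then obtain a b c d where u: "u = ((a, c), (b, d))" and pq: "a + c = p" "b + d = q" by auto
    show "((\<lambda>((a, c), (b, d)). (St (r + s) a b \<otimes> X c d) \<cdot> CP (a, b) (c, d)) u) =
      lsum (p + q) ?n (sp (fst (fst u)) \<times> sp (fst (snd u)))
      (\<lambda>v. (((St r (fst (fst v)) (fst (snd v)) \<otimes> St s (snd (fst v)) (snd (snd v))) \<cdot>
         CP (fst (fst v), fst (snd v)) (snd (fst v), snd (snd v))) \<otimes> X (snd (fst u)) (snd (snd u)))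
         \<cdot> CP (fst (fst u), fst (snd u)) (snd (fst u), snd (snd u)))"
      unfolding u prod.case fst_conv snd_conv Suc.IH
      by (subst lsum_tens_left) (auto simp: lsum_comp_right pq[symmetric] intro!: lsum_cong)
  qed auto
  also have "\<dots> = lsum (p + q) ?n (sp p \<times> sp q) (\<lambda>u. lsum (p + q) ?n (sp (snd (fst u)) \<times> sp (snd (snd u)))
      (\<lambda>v. (St r (fst (fst u)) (fst (snd u)) \<otimes> ((St s (fst (fst v)) (fst (snd v)) \<otimes> X (snd (fst v)) (snd (snd v))) \<cdot>
         CP (fst (fst v), fst (snd v)) (snd (fst v), snd (snd v))))
         \<cdot> CP (fst (fst u), fst (snd u)) (snd (fst u), snd (snd u))))"
  proof (rule lsum_nested_bij)
    \<comment> \<open>A splitting \<open>p = a + c + g\<close>, and likewise one of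
      \<open>q\<close>, is bracketed to the left on one side and to the right on the other;
      \<open>h\<close> passes between the two. The summands then agree by
      \<open>CP_coassoc\<close>.\<close>
    define h :: "((nat \<times> nat) \<times> (nat \<times> nat)) \<times> ((nat \<times> nat) \<times> (nat \<times> nat)) \<Rightarrow> _" where
      "h = (\<lambda>(((_, g), (_, h)), ((a, c), (b, d))). (((a, c + g), (b, d + h)), ((c, g), (d, h))))"
    define h' :: "((nat \<times> nat) \<times> (nat \<times> nat)) \<times> ((nat \<times> nat) \<times> (nat \<times> nat)) \<Rightarrow> _" where
      "h' = (\<lambda>(((a, _), (b, _)), ((c, g), (d, h))). (((a + c, g), (b + d, h)), ((a, c), (b, d))))"
    show "bij_betw h (Sigma (sp p \<times> sp q) (\<lambda>u. sp (fst (fst u)) \<times> sp (fst (snd u))))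
        (Sigma (sp p \<times> sp q) (\<lambda>u. sp (snd (fst u)) \<times> sp (snd (snd u))))"
      by (rule bij_betw_byWitness[where f' = h']) (auto simp: h_def h'_def)
    fix u v assume "u \<in> sp p \<times> sp q" and v: "v \<in> sp (fst (fst u)) \<times> sp (fst (snd u))"
    obtain x g y h0 where u: "u = ((x, g), (y, h0))" by (metis surj_pair)
    obtain a c b d where v': "v = ((a, c), (b, d))" by (metis surj_pair)
    have xy: "x = a + c" "y = b + d" using v by (auto simp: u v')
    have "(((St r a b \<otimes> St s c d) \<cdot> CP (a, b) (c, d)) \<otimes> X g h0) \<cdot> CP (a + c, b + d) (g, h0)
        = ((St r a b \<otimes> St s c d \<otimes> X g h0) \<cdot> (CP (a, b) (c, d) \<otimes> idm (g + h0))) \<cdot> CP (a + c, b + d) (g, h0)"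
      by (simp add: interchange tens_assoc[symmetric])
    also have "\<dots> = (St r a b \<otimes> (St s c d \<otimes> X g h0)) \<cdot> ((idm (a + b) \<otimes> CP (c, d) (g, h0)) \<cdot> CP (a, b) (c + g, d + h0))"
      by (simp add: mcomp_assoc CP_coassoc)
    also have "\<dots> = (St r a b \<otimes> ((St s c d \<otimes> X g h0) \<cdot> CP (c, d) (g, h0))) \<cdot> CP (a, b) (c + g, d + h0)"
      by (simp add: mcomp_assoc[symmetric] interchange)
    finally show "(((St r (fst (fst v)) (fst (snd v)) \<otimes> St s (snd (fst v)) (snd (snd v))) \<cdot>
         CP (fst (fst v), fst (snd v)) (snd (fst v), snd (snd v))) \<otimes> X (snd (fst u)) (snd (snd u)))
         \<cdot> CP (fst (fst u), fst (snd u)) (snd (fst u), snd (snd u)) =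
      (St r (fst (fst (fst (h (u, v))))) (fst (snd (fst (h (u, v))))) \<otimes>
         ((St s (fst (fst (snd (h (u, v))))) (fst (snd (snd (h (u, v))))) \<otimes>
           X (snd (fst (snd (h (u, v))))) (snd (snd (snd (h (u, v)))))) \<cdot>
         CP (fst (fst (snd (h (u, v)))), fst (snd (snd (h (u, v))))) (snd (fst (snd (h (u, v)))), snd (snd (snd (h (u, v)))))))
         \<cdot> CP (fst (fst (fst (h (u, v)))), fst (snd (fst (h (u, v))))) (snd (fst (fst (h (u, v)))), snd (snd (fst (h (u, v)))))"
      by (simp add: u v' h_def xy)
  qed auto
  also have "\<dots> = lsum (p + q) ?n (sp p \<times> sp q)
     (\<lambda>((a, c), (b, d)). (St r a b \<otimes> St (Suc s) c d) \<cdot> CP (a, b) (c, d))"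
  proof (rule lsum_cong)
    fix u assume "u \<in> sp p \<times> sp q"
    then obtain a b c d where u: "u = ((a, c), (b, d))" and pq: "a + c = p" "b + d = q" by auto
    show "lsum (p + q) ?n (sp (snd (fst u)) \<times> sp (snd (snd u)))
      (\<lambda>v. (St r (fst (fst u)) (fst (snd u)) \<otimes> ((St s (fst (fst v)) (fst (snd v)) \<otimes> X (snd (fst v)) (snd (snd v))) \<cdot>
         CP (fst (fst v), fst (snd v)) (snd (fst v), snd (snd v))))
         \<cdot> CP (fst (fst u), fst (snd u)) (snd (fst u), snd (snd u))) =
      ((\<lambda>((a, c), (b, d)). (St r a b \<otimes> St (Suc s) c d) \<cdot> CP (a, b) (c, d)) u)"
      unfolding u prod.case fst_conv snd_conv St_Suc
      by (subst lsum_tens_right) (auto simp: lsum_comp_right pq[symmetric] intro!: lsum_cong)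
  qed auto
  finally show ?case by simp
qed

end

section \<open>Triple star products\<close>

text \<open>Pairs with sum above \<open>N\<close> contribute 0, so the triangle of pairs with sum
  \<open>t \<le> N\<close> can be filled up to a square whose sides no longer depend on
  \<open>t\<close>. The two versions serve the two bracketings of a triple product.\<close>

lemma lsum_regroup:
  assumes "finite K" "\<And>u v x. N < fst u + snd u \<Longrightarrow> v \<in> K \<Longrightarrow> app (U u v) x = 0"
  shows "lsum m n {..N} (\<lambda>t. lsum (m1 t) (n1 t) (sp t \<times> K) (\<lambda>w. U (fst w) (snd w))) =
      lsum m n ({..N} \<times> {..N}) (\<lambda>u. lsum m n K (U u))"
    and "lsum m n {..N} (\<lambda>t. lsum (m1 t) (n1 t) (K \<times> sp t) (\<lambda>w. U (snd w) (fst w))) =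
      lsum m n ({..N} \<times> {..N}) (\<lambda>u. lsum m n K (U u))"
proof -
  define D where "D = {u \<in> {..N} \<times> {..N}. fst u + snd u \<le> N}"
  have ext: "lsum m n D (\<lambda>u. lsum m n K (U u)) = lsum m n ({..N} \<times> {..N}) (\<lambda>u. lsum m n K (U u))"
    by (rule lsum_mono_neutral) (auto simp: D_def app_lsum intro!: sum.neutral assms(2))
  have fin: "finite D" by (auto simp: D_def)
  have "lsum m n {..N} (\<lambda>t. lsum (m1 t) (n1 t) (sp t \<times> K) (\<lambda>w. U (fst w) (snd w))) =
      lsum m n D (\<lambda>u. lsum m n K (U u))"
  proof (rule lsum_nested_bij)
    show "bij_betw snd (SIGMA t:{..N}. sp t \<times> K) (D \<times> K)"
      by (rule bij_betw_byWitness[where f' = "\<lambda>w. (fst (fst w) + snd (fst w), w)"]) (auto simp: D_def)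
  qed (auto simp: assms(1) fin)
  then show "lsum m n {..N} (\<lambda>t. lsum (m1 t) (n1 t) (sp t \<times> K) (\<lambda>w. U (fst w) (snd w))) =
      lsum m n ({..N} \<times> {..N}) (\<lambda>u. lsum m n K (U u))"
    by (simp only: ext)
  have "lsum m n {..N} (\<lambda>t. lsum (m1 t) (n1 t) (K \<times> sp t) (\<lambda>w. U (snd w) (fst w))) =
      lsum m n D (\<lambda>u. lsum m n K (U u))"
  proof (rule lsum_nested_bij)
    show "bij_betw (\<lambda>w. (snd (snd w), fst (snd w))) (SIGMA t:{..N}. K \<times> sp t) (D \<times> K)"
      by (rule bij_betw_byWitness[where f' = "\<lambda>w. (fst (fst w) + snd (fst w), (snd w, fst w))"])
        (auto simp: D_def)
  qed (auto simp: assms(1) fin)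
  then show "lsum m n {..N} (\<lambda>t. lsum (m1 t) (n1 t) (K \<times> sp t) (\<lambda>w. U (snd w) (fst w))) =
      lsum m n ({..N} \<times> {..N}) (\<lambda>u. lsum m n K (U u))"
    by (simp only: ext)
qed

context tensor_powers
begin

lemma lsum_tens_both:
  assumes "finite A" "finite C"
    and "\<And>a. a \<in> A \<Longrightarrow> arr (F a)" "\<And>a. a \<in> A \<Longrightarrow> src (F a) = m" "\<And>a. a \<in> A \<Longrightarrow> tgt (F a) = n"
    and "\<And>c. c \<in> C \<Longrightarrow> arr (G c)" "\<And>c. c \<in> C \<Longrightarrow> src (G c) = m'" "\<And>c. c \<in> C \<Longrightarrow> tgt (G c) = n'"
  shows "lsum m n A F \<otimes> lsum m' n' C G =
    lsum (m + m') (n + n') (A \<times> C) (\<lambda>u. F (fst u) \<otimes> G (snd u))"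
proof -
  have "lsum m n A F \<otimes> lsum m' n' C G = lsum (m + m') (n + n') A (\<lambda>a. F a \<otimes> lsum m' n' C G)"
    using assms by (subst lsum_tens_left) auto
  also have "\<dots> = lsum (m + m') (n + n') A (\<lambda>a. lsum (m + m') (n + n') C (\<lambda>c. F a \<otimes> G c))"
    using assms by (intro lsum_cong) (auto simp: lsum_tens_right)
  also have "\<dots> = lsum (m + m') (n + n') (A \<times> C) (\<lambda>(a, c). F a \<otimes> G c)"
    using assms(1,2) by (rule lsum_Sigma)
  finally show ?thesis by (simp add: lsum_def split_beta)
qed

end

context braided
begin

text \<open>Naturality moves \<open>G\<close> through the crossing with the \<open>k1\<close>
  strands; \<open>F\<close> and the \<open>k2\<close> strands take no part in that crossing.\<close>

lemma slide_left:
  assumes "arr F" "natural G"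
  shows "((F \<otimes> idm k1) \<otimes> (G \<otimes> idm k2)) \<cdot> (idm (src F) \<otimes> B (src G) k1 \<otimes> idm k2) =
    (idm (tgt F) \<otimes> B (tgt G) k1 \<otimes> idm k2) \<cdot> ((F \<otimes> G) \<otimes> idm (k1 + k2))"
proof -
  note a = assms(1) natural_arr[OF assms(2)]
  have "((F \<otimes> idm k1) \<otimes> (G \<otimes> idm k2)) \<cdot> (idm (src F) \<otimes> B (src G) k1 \<otimes> idm k2) =
      (F \<otimes> (idm k1 \<otimes> G) \<otimes> idm k2) \<cdot> (idm (src F) \<otimes> B (src G) k1 \<otimes> idm k2)"
    using a by (simp add: tens_assoc)
  also have "\<dots> = F \<otimes> (B (tgt G) k1 \<cdot> (G \<otimes> idm k1)) \<otimes> idm k2"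
    using a by (simp add: interchange naturalD[OF assms(2)] add.commute)
  also have "\<dots> = (idm (tgt F) \<otimes> B (tgt G) k1 \<otimes> idm k2) \<cdot> (F \<otimes> (G \<otimes> idm k1) \<otimes> idm k2)"
    using a by (simp add: interchange)
  also have "F \<otimes> (G \<otimes> idm k1) \<otimes> idm k2 = (F \<otimes> G) \<otimes> idm (k1 + k2)"
    using a by (simp add: tens_assoc tens_idm)
  finally show ?thesis .
qed

lemma slide_right:
  assumes "natural F" "arr G"
  shows "((idm i1 \<otimes> F) \<otimes> (idm i2 \<otimes> G)) \<cdot> (idm i1 \<otimes> B i2 (src F) \<otimes> idm (src G)) =
    (idm i1 \<otimes> B i2 (tgt F) \<otimes> idm (tgt G)) \<cdot> (idm (i1 + i2) \<otimes> F \<otimes> G)"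
proof -
  note a = assms(2) natural_arr[OF assms(1)]
  have "((idm i1 \<otimes> F) \<otimes> (idm i2 \<otimes> G)) \<cdot> (idm i1 \<otimes> B i2 (src F) \<otimes> idm (src G)) =
      (idm i1 \<otimes> (F \<otimes> idm i2) \<otimes> G) \<cdot> (idm i1 \<otimes> B i2 (src F) \<otimes> idm (src G))"
    using a by (simp add: tens_assoc)
  also have "\<dots> = idm i1 \<otimes> (B i2 (tgt F) \<cdot> (idm i2 \<otimes> F)) \<otimes> G"
    using a by (simp add: interchange naturalD[OF assms(1)] add.commute)
  also have "\<dots> = (idm i1 \<otimes> B i2 (tgt F) \<otimes> idm (tgt G)) \<cdot> (idm i1 \<otimes> (idm i2 \<otimes> F) \<otimes> G)"
    using a by (simp add: interchange)
  also have "idm i1 \<otimes> (idm i2 \<otimes> F) \<otimes> G = idm (i1 + i2) \<otimes> F \<otimes> G"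
    using a by (simp add: tens_assoc tens_idm[symmetric])
  finally show ?thesis .
qed

text \<open>The component of the braided coproduct on \<open>T(V) \<otimes> T(V) \<otimes> T(V)\<close> with values in the product of
  the \<open>(i1, j1, k1)\<close> and the \<open>(i2, j2, k2)\<close> component.\<close>

definition CP3 :: "nat \<times> nat \<Rightarrow> nat \<times> nat \<Rightarrow> nat \<times> nat \<Rightarrow> ('k, 'v) tensor mor" where
  "CP3 = (\<lambda>(i1, i2) (j1, j2) (k1, k2).
     (idm (i1 + j1) \<otimes> B (i2 + j2) k1 \<otimes> idm k2) \<cdot> (CP (i1, j1) (i2, j2) \<otimes> idm (k1 + k2)))"

lemma CP3_simps [simp]:
  "arr (CP3 (i1, i2) (j1, j2) (k1, k2))" "src (CP3 (i1, i2) (j1, j2) (k1, k2)) = i1 + i2 + j1 + j2 + k1 + k2"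
  "tgt (CP3 (i1, i2) (j1, j2) (k1, k2)) = i1 + i2 + j1 + j2 + k1 + k2"
  by (simp_all add: CP3_def)

text \<open>\<open>CP3\<close> is bracketed for \<open>(x \<star> y) \<star> z\<close>; this is the
  bracketing for \<open>x \<star> (y \<star> z)\<close>. By the hexagons both consist of the
  crossings of \<open>i2\<close> with \<open>j1\<close>, \<open>i2\<close> with \<open>k1\<close>
  and \<open>j2\<close> with \<open>k1\<close>.\<close>

lemma CP3_right:
  "CP3 (i1, i2) (j1, j2) (k1, k2) =
     (idm i1 \<otimes> B i2 (j1 + k1) \<otimes> idm (j2 + k2)) \<cdot> (idm (i1 + i2) \<otimes> CP (j1, k1) (j2, k2))"
proof -
  let ?Z1 = "(idm j1 \<otimes> B (i2 + j2) k1) \<cdot> (B i2 j1 \<otimes> idm (j2 + k1))"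
  let ?Z2 = "(B i2 (j1 + k1) \<otimes> idm j2) \<cdot> (idm (i2 + j1) \<otimes> B j2 k1)"
  have "idm (i1 + j1) \<otimes> B (i2 + j2) k1 \<otimes> idm k2 = idm i1 \<otimes> (idm j1 \<otimes> B (i2 + j2) k1) \<otimes> idm k2"
    by (simp add: tens_assoc tens_idm[symmetric])
  moreover have "CP (i1, j1) (i2, j2) \<otimes> idm (k1 + k2) = idm i1 \<otimes> (B i2 j1 \<otimes> idm (j2 + k1)) \<otimes> idm k2"
    by (simp add: CP_def tens_assoc tens_idm add.assoc)
  ultimately have L: "CP3 (i1, i2) (j1, j2) (k1, k2) = idm i1 \<otimes> ?Z1 \<otimes> idm k2"
    by (simp add: CP3_def interchange)
  have "idm i1 \<otimes> B i2 (j1 + k1) \<otimes> idm (j2 + k2) = idm i1 \<otimes> (B i2 (j1 + k1) \<otimes> idm j2) \<otimes> idm k2"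
    by (simp add: tens_assoc tens_idm)
  moreover have "idm (i1 + i2) \<otimes> CP (j1, k1) (j2, k2) = idm i1 \<otimes> (idm (i2 + j1) \<otimes> B j2 k1) \<otimes> idm k2"
    unfolding CP_def prod.case tens_idm[symmetric] by (simp add: tens_assoc)
  ultimately have R: "(idm i1 \<otimes> B i2 (j1 + k1) \<otimes> idm (j2 + k2)) \<cdot> (idm (i1 + i2) \<otimes> CP (j1, k1) (j2, k2)) =
      idm i1 \<otimes> ?Z2 \<otimes> idm k2"
    by (simp add: interchange)
  have "?Z1 = (idm j1 \<otimes> B i2 k1 \<otimes> idm j2) \<cdot> ((idm j1 \<otimes> idm i2 \<otimes> B j2 k1) \<cdot> (B i2 j1 \<otimes> idm (j2 + k1)))"
    by (simp add: B_hexagon_left interchange mcomp_assoc[symmetric])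
  also have "(idm j1 \<otimes> idm i2 \<otimes> B j2 k1) \<cdot> (B i2 j1 \<otimes> idm (j2 + k1)) =
      (idm (j1 + i2) \<otimes> B j2 k1) \<cdot> (B i2 j1 \<otimes> idm (j2 + k1))"
    by (simp add: tens_idm tens_assoc[symmetric])
  also have "\<dots> = (B i2 j1 \<otimes> idm (k1 + j2)) \<cdot> (idm (i2 + j1) \<otimes> B j2 k1)"
    by (simp add: interchange add.commute)
  also have "(idm j1 \<otimes> B i2 k1 \<otimes> idm j2) \<cdot> \<dots> =
      (((idm j1 \<otimes> B i2 k1) \<otimes> idm j2) \<cdot> ((B i2 j1 \<otimes> idm k1) \<otimes> idm j2)) \<cdot> (idm (i2 + j1) \<otimes> B j2 k1)"
    by (simp add: mcomp_assoc tens_assoc tens_idm)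
  also have "\<dots> = ?Z2"
    by (simp add: B_hexagon_right interchange)
  finally show ?thesis using L R by simp
qed

end

context natural_brace_family
begin

lemma St_split':
  "St (r + s) p q = lsum (p + q) (r + s) (sp p \<times> sp q)
     (\<lambda>w. (St r (fst (fst w)) (fst (snd w)) \<otimes> St s (snd (fst w)) (snd (snd w))) \<cdot>
        CP (fst (fst w), fst (snd w)) (snd (fst w), snd (snd w)))"
  unfolding St_split by (rule lsum_cong) auto

text \<open>The components \<open>V\<^sup>\<otimes>\<^sup>i \<otimes> V\<^sup>\<otimes>\<^sup>j \<otimes> V\<^sup>\<otimes>\<^sup>k \<rightarrow> V\<^sup>\<otimes>\<^sup>r\<close> of \<open>(x \<star> y) \<star> z\<close> and of \<open>x \<star> (y \<star> z)\<close>.\<close>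

definition Lm :: "nat \<Rightarrow> nat \<Rightarrow> nat \<Rightarrow> nat \<Rightarrow> ('k, 'v) tensor mor" where
  "Lm r i j k = lsum (i + j + k) r {..i + j} (\<lambda>t. St r t k \<cdot> (St t i j \<otimes> idm k))"

definition Rm :: "nat \<Rightarrow> nat \<Rightarrow> nat \<Rightarrow> nat \<Rightarrow> ('k, 'v) tensor mor" where
  "Rm r i j k = lsum (i + j + k) r {..j + k} (\<lambda>t. St r i t \<cdot> (idm i \<otimes> St t j k))"

lemma LR_simps [simp]:
  "arr (Lm r i j k)" "src (Lm r i j k) = i + j + k" "tgt (Lm r i j k) = r"
  "arr (Rm r i j k)" "src (Rm r i j k) = i + j + k" "tgt (Rm r i j k) = r"
  by (auto simp: Lm_def Rm_def intro!: arr_lsum)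

text \<open>A padded range lets both tensor factors in \<open>Lm_split\<close> be summed over the
  same range, whatever their own degrees.\<close>

lemma Lm_extend:
  assumes "i + j \<le> N"
  shows "Lm r i j k = lsum (i + j + k) r {..N} (\<lambda>t. St r t k \<cdot> (St t i j \<otimes> idm k))"
  unfolding Lm_def
proof (rule lsum_mono_neutral)
  fix t x assume "t \<in> {..N} - {..i + j}"
  then have "is_zero (St r t k \<cdot> (St t i j \<otimes> idm k))"
    by (intro is_zero_comp_left is_zero_tens disjI1 St_zero) auto
  then show "app (St r t k \<cdot> (St t i j \<otimes> idm k)) x = 0" by (simp add: is_zero_def)
qed (use assms in auto)

lemma Rm_extend:
  assumes "j + k \<le> N"
  shows "Rm r i j k = lsum (i + j + k) r {..N} (\<lambda>t. St r i t \<cdot> (idm i \<otimes> St t j k))"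
  unfolding Rm_def
proof (rule lsum_mono_neutral)
  fix t x assume "t \<in> {..N} - {..j + k}"
  then have "is_zero (St r i t \<cdot> (idm i \<otimes> St t j k))"
    by (intro is_zero_comp_left is_zero_tens disjI2 St_zero) auto
  then show "app (St r i t \<cdot> (idm i \<otimes> St t j k)) x = 0" by (simp add: is_zero_def)
qed (use assms in auto)

text \<open>One summand of the coalgebra property. Naturality slides the inner star products through
  the crossing with \<open>k1\<close>, which turns it into the coproduct in front of the outer
  ones.\<close>

lemma Lm_term:
  "((St a s1 k1 \<cdot> (St s1 i1 j1 \<otimes> idm k1)) \<otimes> (St b s2 k2 \<cdot> (St s2 i2 j2 \<otimes> idm k2))) \<cdot>
      CP3 (i1, i2) (j1, j2) (k1, k2) =
   ((St a s1 k1 \<otimes> St b s2 k2) \<cdot> CP (s1, k1) (s2, k2)) \<cdot>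
     (((St s1 i1 j1 \<otimes> St s2 i2 j2) \<cdot> CP (i1, j1) (i2, j2)) \<otimes> idm (k1 + k2))"
proof -
  have CP: "CP (s1, k1) (s2, k2) = idm s1 \<otimes> B s2 k1 \<otimes> idm k2" by (simp add: CP_def)
  have "((St a s1 k1 \<cdot> (St s1 i1 j1 \<otimes> idm k1)) \<otimes> (St b s2 k2 \<cdot> (St s2 i2 j2 \<otimes> idm k2))) \<cdot>
      CP3 (i1, i2) (j1, j2) (k1, k2) =
    (St a s1 k1 \<otimes> St b s2 k2) \<cdot> ((((St s1 i1 j1 \<otimes> idm k1) \<otimes> (St s2 i2 j2 \<otimes> idm k2)) \<cdot>
      (idm (i1 + j1) \<otimes> B (i2 + j2) k1 \<otimes> idm k2)) \<cdot> (CP (i1, j1) (i2, j2) \<otimes> idm (k1 + k2)))"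
    by (simp add: interchange[symmetric] CP3_def mcomp_assoc)
  also have "\<dots> = (St a s1 k1 \<otimes> St b s2 k2) \<cdot> (CP (s1, k1) (s2, k2) \<cdot>
      (((St s1 i1 j1 \<otimes> St s2 i2 j2) \<otimes> idm (k1 + k2)) \<cdot> (CP (i1, j1) (i2, j2) \<otimes> idm (k1 + k2))))"
    using slide_left[of "St s1 i1 j1" "St s2 i2 j2" k1 k2] by (simp add: CP mcomp_assoc)
  also have "\<dots> = ((St a s1 k1 \<otimes> St b s2 k2) \<cdot> CP (s1, k1) (s2, k2)) \<cdot>
     (((St s1 i1 j1 \<otimes> St s2 i2 j2) \<cdot> CP (i1, j1) (i2, j2)) \<otimes> idm (k1 + k2))"
    by (simp add: interchange mcomp_assoc)
  finally show ?thesis .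
qed

lemma Rm_term:
  "((St a i1 s1 \<cdot> (idm i1 \<otimes> St s1 j1 k1)) \<otimes> (St b i2 s2 \<cdot> (idm i2 \<otimes> St s2 j2 k2))) \<cdot>
      CP3 (i1, i2) (j1, j2) (k1, k2) =
   ((St a i1 s1 \<otimes> St b i2 s2) \<cdot> CP (i1, s1) (i2, s2)) \<cdot>
     (idm (i1 + i2) \<otimes> ((St s1 j1 k1 \<otimes> St s2 j2 k2) \<cdot> CP (j1, k1) (j2, k2)))"
proof -
  have CP: "CP (i1, s1) (i2, s2) = idm i1 \<otimes> B i2 s1 \<otimes> idm s2" by (simp add: CP_def)
  have "((St a i1 s1 \<cdot> (idm i1 \<otimes> St s1 j1 k1)) \<otimes> (St b i2 s2 \<cdot> (idm i2 \<otimes> St s2 j2 k2))) \<cdot>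
      CP3 (i1, i2) (j1, j2) (k1, k2) =
    (St a i1 s1 \<otimes> St b i2 s2) \<cdot> ((((idm i1 \<otimes> St s1 j1 k1) \<otimes> (idm i2 \<otimes> St s2 j2 k2)) \<cdot>
      (idm i1 \<otimes> B i2 (j1 + k1) \<otimes> idm (j2 + k2))) \<cdot> (idm (i1 + i2) \<otimes> CP (j1, k1) (j2, k2)))"
    by (simp add: interchange[symmetric] CP3_right mcomp_assoc)
  also have "\<dots> = (St a i1 s1 \<otimes> St b i2 s2) \<cdot> (CP (i1, s1) (i2, s2) \<cdot>
      ((idm (i1 + i2) \<otimes> St s1 j1 k1 \<otimes> St s2 j2 k2) \<cdot> (idm (i1 + i2) \<otimes> CP (j1, k1) (j2, k2))))"
    using slide_right[of "St s1 j1 k1" "St s2 j2 k2" i1 i2] by (simp add: CP mcomp_assoc)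
  also have "\<dots> = ((St a i1 s1 \<otimes> St b i2 s2) \<cdot> CP (i1, s1) (i2, s2)) \<cdot>
     (idm (i1 + i2) \<otimes> ((St s1 j1 k1 \<otimes> St s2 j2 k2) \<cdot> CP (j1, k1) (j2, k2)))"
    by (simp add: interchange mcomp_assoc)
  finally show ?thesis .
qed

text \<open>A composite of coalgebra maps is a coalgebra map: the outer star product is split first,
  and this splits the intermediate degree \<open>t\<close>, along which the inner one is split next.
  The terms are matched by \<open>Lm_term\<close>.\<close>

lemma Lm_split:
  "Lm (a + b) i j k = lsum (i + j + k) (a + b) (sp i \<times> sp j \<times> sp k)
     (\<lambda>w. (Lm a (fst (fst w)) (fst (fst (snd w))) (fst (snd (snd w))) \<otimes>
           Lm b (snd (fst w)) (snd (fst (snd w))) (snd (snd (snd w)))) \<cdot>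
          CP3 (fst w) (fst (snd w)) (snd (snd w)))"
proof -
  let ?N = "i + j"
  \<comment> \<open>\<open>u\<close> splits the intermediate degree, \<open>v\<close> splits
    \<open>k\<close>, and \<open>w\<close> splits \<open>i\<close> and \<open>j\<close>.
    \<open>H\<close> is a summand of the outer star product and \<open>G\<close> one of the inner;
    in \<open>U\<close> the inner one is still unsplit.\<close>
  define H where "H u v = (St a (fst u) (fst v) \<otimes> St b (snd u) (snd v)) \<cdot> CP (fst u, fst v) (snd u, snd v)"
    for u v :: "nat \<times> nat"
  define G where "G u w = (St (fst u) (fst (fst w)) (fst (snd w)) \<otimes> St (snd u) (snd (fst w)) (snd (snd w))) \<cdot>
    CP (fst (fst w), fst (snd w)) (snd (fst w), snd (snd w))" for u :: "nat \<times> nat" and w :: "(nat \<times> nat) \<times> (nat \<times> nat)"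
  define U where "U u v = H u v \<cdot> (St (fst u + snd u) i j \<otimes> idm k)" for u v :: "nat \<times> nat"
  have H [simp]: "arr (H u v)" "src (H u v) = fst u + snd u + (fst v + snd v)" "tgt (H u v) = a + b" for u v
    by (simp_all add: H_def)
  have G: "arr (G u w)" "src (G u w) = i + j" "tgt (G u w) = fst u + snd u" if "w \<in> sp i \<times> sp j" for u w
    using that by (auto simp: G_def)
  have "Lm (a + b) i j k = lsum (i + j + k) (a + b) {..?N}
      (\<lambda>t. lsum (i + j + k) (a + b) (sp t \<times> sp k) (\<lambda>w. U (fst w) (snd w)))"
    unfolding Lm_def
    by (intro lsum_cong refl, subst St_split') (auto simp: lsum_comp_right U_def H_def intro!: lsum_cong)
  also have "\<dots> = lsum (i + j + k) (a + b) ({..?N} \<times> {..?N}) (\<lambda>u. lsum (i + j + k) (a + b) (sp k) (U u))"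
  proof (rule lsum_regroup(1))
    fix u v x assume "?N < fst u + snd u" "v \<in> sp k"
    then have "is_zero (U u v)"
      unfolding U_def by (intro is_zero_comp_left is_zero_tens disjI1 St_zero) auto
    then show "app (U u v) x = 0" by (simp add: is_zero_def)
  qed simp
  also have "\<dots> = lsum (i + j + k) (a + b) ({..?N} \<times> {..?N}) (\<lambda>u.
      lsum (i + j + k) (a + b) (sp k \<times> (sp i \<times> sp j)) (\<lambda>x. H u (fst x) \<cdot> (G u (snd x) \<otimes> idm k)))"
  proof (intro lsum_cong refl)
    fix u
    have "U u v = lsum (i + j + k) (a + b) (sp i \<times> sp j) (\<lambda>w. H u v \<cdot> (G u w \<otimes> idm k))" if "v \<in> sp k" for v
    proof -
      have "St (fst u + snd u) i j \<otimes> idm k =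
          lsum (i + j + k) (fst u + snd u + k) (sp i \<times> sp j) (\<lambda>w. G u w \<otimes> idm k)"
        unfolding St_split' using G by (subst lsum_tens_left) (auto simp: G_def)
      then show ?thesis
        unfolding U_def using that G by (simp add: lsum_comp_left split_beta sp_def)
    qed
    then have "lsum (i + j + k) (a + b) (sp k) (U u) = lsum (i + j + k) (a + b) (sp k)
        (\<lambda>v. lsum (i + j + k) (a + b) (sp i \<times> sp j) (\<lambda>w. H u v \<cdot> (G u w \<otimes> idm k)))"
      by (intro lsum_cong) auto
    also have "\<dots> = lsum (i + j + k) (a + b) (sp k \<times> (sp i \<times> sp j)) (\<lambda>x. H u (fst x) \<cdot> (G u (snd x) \<otimes> idm k))"
      by (subst lsum_Sigma) (auto intro!: lsum_cong)
    finally show "lsum (i + j + k) (a + b) (sp k) (U u) = \<dots>" .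
  qed
  also have "\<dots> = lsum (i + j + k) (a + b) (sp i \<times> sp j \<times> sp k) (\<lambda>w.
      lsum (i + j + k) (a + b) ({..?N} \<times> {..?N}) (\<lambda>u. H u (snd (snd w)) \<cdot> (G u (fst w, fst (snd w)) \<otimes> idm k)))"
  proof (rule lsum_nested_bij)
    show "bij_betw (\<lambda>x. ((fst (snd (snd x)), snd (snd (snd x)), fst (snd x)), fst x))
        (({..?N} \<times> {..?N}) \<times> (sp k \<times> (sp i \<times> sp j))) ((sp i \<times> sp j \<times> sp k) \<times> ({..?N} \<times> {..?N}))"
      by (rule bij_betw_byWitness[where f' = "\<lambda>x. (snd x, snd (snd (fst x)), fst (fst x), fst (snd (fst x)))"]) auto
  qed auto
  also have "\<dots> = lsum (i + j + k) (a + b) (sp i \<times> sp j \<times> sp k)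
     (\<lambda>w. (Lm a (fst (fst w)) (fst (fst (snd w))) (fst (snd (snd w))) \<otimes>
           Lm b (snd (fst w)) (snd (fst (snd w))) (snd (snd (snd w)))) \<cdot>
          CP3 (fst w) (fst (snd w)) (snd (snd w)))"
  proof (intro lsum_cong refl)
    fix w assume "w \<in> sp i \<times> sp j \<times> sp k"
    then obtain i1 i2 j1 j2 k1 k2 where w: "w = ((i1, i2), (j1, j2), (k1, k2))"
      and e: "i1 + i2 = i" "j1 + j2 = j" "k1 + k2 = k" by (cases w) auto
    have "Lm a i1 j1 k1 \<otimes> Lm b i2 j2 k2 = lsum (i1 + j1 + k1 + (i2 + j2 + k2)) (a + b) ({..?N} \<times> {..?N})
        (\<lambda>u. (St a (fst u) k1 \<cdot> (St (fst u) i1 j1 \<otimes> idm k1)) \<otimes> (St b (snd u) k2 \<cdot> (St (snd u) i2 j2 \<otimes> idm k2)))"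
      using e by (subst (1 2) Lm_extend[where N = ?N]) (auto intro!: lsum_tens_both)
    then show "lsum (i + j + k) (a + b) ({..?N} \<times> {..?N}) (\<lambda>u. H u (snd (snd w)) \<cdot> (G u (fst w, fst (snd w)) \<otimes> idm k)) =
      (Lm a (fst (fst w)) (fst (fst (snd w))) (fst (snd (snd w))) \<otimes>
           Lm b (snd (fst w)) (snd (fst (snd w))) (snd (snd (snd w)))) \<cdot>
          CP3 (fst w) (fst (snd w)) (snd (snd w))"
      using e by (simp add: w lsum_comp_right Lm_term H_def G_def) (intro lsum_cong; auto)
  qed
  finally show ?thesis .
qed

lemma Rm_split:
  "Rm (a + b) i j k = lsum (i + j + k) (a + b) (sp i \<times> sp j \<times> sp k)
     (\<lambda>w. (Rm a (fst (fst w)) (fst (fst (snd w))) (fst (snd (snd w))) \<otimes>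
           Rm b (snd (fst w)) (snd (fst (snd w))) (snd (snd (snd w)))) \<cdot>
          CP3 (fst w) (fst (snd w)) (snd (snd w)))"
proof -
  let ?N = "j + k"
  define H where "H u v = (St a (fst v) (fst u) \<otimes> St b (snd v) (snd u)) \<cdot> CP (fst v, fst u) (snd v, snd u)"
    for u v :: "nat \<times> nat"
  define G where "G u w = (St (fst u) (fst (fst w)) (fst (snd w)) \<otimes> St (snd u) (snd (fst w)) (snd (snd w))) \<cdot>
    CP (fst (fst w), fst (snd w)) (snd (fst w), snd (snd w))" for u :: "nat \<times> nat" and w :: "(nat \<times> nat) \<times> (nat \<times> nat)"
  define U where "U u v = H u v \<cdot> (idm i \<otimes> St (fst u + snd u) j k)" for u v :: "nat \<times> nat"
  have H [simp]: "arr (H u v)" "src (H u v) = fst v + snd v + (fst u + snd u)" "tgt (H u v) = a + b" for u v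
    by (simp_all add: H_def)
  have G: "arr (G u w)" "src (G u w) = j + k" "tgt (G u w) = fst u + snd u" if "w \<in> sp j \<times> sp k" for u w
    using that by (auto simp: G_def)
  have "Rm (a + b) i j k = lsum (i + j + k) (a + b) {..?N}
      (\<lambda>t. lsum (i + j + k) (a + b) (sp i \<times> sp t) (\<lambda>w. U (snd w) (fst w)))"
    unfolding Rm_def
    by (intro lsum_cong refl, subst St_split') (auto simp: lsum_comp_right U_def H_def intro!: lsum_cong)
  also have "\<dots> = lsum (i + j + k) (a + b) ({..?N} \<times> {..?N}) (\<lambda>u. lsum (i + j + k) (a + b) (sp i) (U u))"
  proof (rule lsum_regroup(2))
    fix u v x assume "?N < fst u + snd u" "v \<in> sp i"
    then have "is_zero (U u v)"
      unfolding U_def by (intro is_zero_comp_left is_zero_tens disjI2 St_zero) auto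
    then show "app (U u v) x = 0" by (simp add: is_zero_def)
  qed simp
  also have "\<dots> = lsum (i + j + k) (a + b) ({..?N} \<times> {..?N}) (\<lambda>u.
      lsum (i + j + k) (a + b) (sp i \<times> (sp j \<times> sp k)) (\<lambda>x. H u (fst x) \<cdot> (idm i \<otimes> G u (snd x))))"
  proof (intro lsum_cong refl)
    fix u
    have "U u v = lsum (i + j + k) (a + b) (sp j \<times> sp k) (\<lambda>w. H u v \<cdot> (idm i \<otimes> G u w))" if "v \<in> sp i" for v
    proof -
      have "idm i \<otimes> St (fst u + snd u) j k =
          lsum (i + j + k) (i + (fst u + snd u)) (sp j \<times> sp k) (\<lambda>w. idm i \<otimes> G u w)"
        unfolding St_split' using G by (subst lsum_tens_right) (auto simp: G_def add.assoc)
      then show ?thesis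
        unfolding U_def using that G by (simp add: lsum_comp_left split_beta sp_def)
    qed
    then have "lsum (i + j + k) (a + b) (sp i) (U u) = lsum (i + j + k) (a + b) (sp i)
        (\<lambda>v. lsum (i + j + k) (a + b) (sp j \<times> sp k) (\<lambda>w. H u v \<cdot> (idm i \<otimes> G u w)))"
      by (intro lsum_cong) auto
    also have "\<dots> = lsum (i + j + k) (a + b) (sp i \<times> (sp j \<times> sp k)) (\<lambda>x. H u (fst x) \<cdot> (idm i \<otimes> G u (snd x)))"
      by (subst lsum_Sigma) (auto intro!: lsum_cong)
    finally show "lsum (i + j + k) (a + b) (sp i) (U u) = \<dots>" .
  qed
  \<comment> \<open>An exchange of sums suffices: the splittings already come in the order
    \<open>i\<close>, \<open>j\<close>, \<open>k\<close>.\<close>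
  also have "\<dots> = lsum (i + j + k) (a + b) (sp i \<times> sp j \<times> sp k) (\<lambda>w.
      lsum (i + j + k) (a + b) ({..?N} \<times> {..?N}) (\<lambda>u. H u (fst w) \<cdot> (idm i \<otimes> G u (snd w))))"
    by (rule lsum_swap)
  also have "\<dots> = lsum (i + j + k) (a + b) (sp i \<times> sp j \<times> sp k)
     (\<lambda>w. (Rm a (fst (fst w)) (fst (fst (snd w))) (fst (snd (snd w))) \<otimes>
           Rm b (snd (fst w)) (snd (fst (snd w))) (snd (snd (snd w)))) \<cdot>
          CP3 (fst w) (fst (snd w)) (snd (snd w)))"
  proof (intro lsum_cong refl)
    fix w assume "w \<in> sp i \<times> sp j \<times> sp k"
    then obtain i1 i2 j1 j2 k1 k2 where w: "w = ((i1, i2), (j1, j2), (k1, k2))"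
      and e: "i1 + i2 = i" "j1 + j2 = j" "k1 + k2 = k" by (cases w) auto
    have "Rm a i1 j1 k1 \<otimes> Rm b i2 j2 k2 = lsum (i1 + j1 + k1 + (i2 + j2 + k2)) (a + b) ({..?N} \<times> {..?N})
        (\<lambda>u. (St a i1 (fst u) \<cdot> (idm i1 \<otimes> St (fst u) j1 k1)) \<otimes> (St b i2 (snd u) \<cdot> (idm i2 \<otimes> St (snd u) j2 k2)))"
      using e by (subst (1 2) Rm_extend[where N = ?N]) (auto intro!: lsum_tens_both)
    then show "lsum (i + j + k) (a + b) ({..?N} \<times> {..?N}) (\<lambda>u. H u (fst w) \<cdot> (idm i \<otimes> G u (snd w))) =
      (Rm a (fst (fst w)) (fst (fst (snd w))) (fst (snd (snd w))) \<otimes>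
           Rm b (snd (fst w)) (snd (fst (snd w))) (snd (snd (snd w)))) \<cdot>
          CP3 (fst w) (fst (snd w)) (snd (snd w))"
      using e by (simp add: w lsum_comp_right Rm_term H_def G_def) (intro lsum_cong; auto)
  qed
  finally show ?thesis .
qed

end

text \<open>\<open>P r\<close> stands for the \<open>r\<close>-fold product \<open>\<cdot>\<close> and \<open>mu\<close> for the product \<open>\<ast>\<close>.\<close>

locale product_brace_family = natural_brace_family scale \<sigma> X
  for scale :: "'k::field_char_0 \<Rightarrow> 'v::ab_group_add \<Rightarrow> 'v" and \<sigma> and X +
  fixes P :: "nat \<Rightarrow> ('k, 'v) tensor mor" and mu :: "('k, 'v) tensor mor"
  assumes X_1_0: "X 1 0 = idm 1" and X_0_1: "X 0 1 = idm 1"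
    and X_n_0: "n \<noteq> 1 \<Longrightarrow> is_zero (X n 0)" and X_0_n: "n \<noteq> 1 \<Longrightarrow> is_zero (X 0 n)"
    and P_simps [simp]: "arr (P r)" "src (P r) = r" "tgt (P r) = 1" and P_1: "P 1 = idm 1"
    and mu_simps [simp]: "arr mu" "src mu = 2" "tgt mu = 1"
    and mu_assoc: "mu \<cdot> (mu \<otimes> idm 1) = mu \<cdot> (idm 1 \<otimes> mu)"
    and P_St: "1 \<le> p \<Longrightarrow> 1 \<le> q \<Longrightarrow>
      lsum (p + q) 1 {1..p + q} (\<lambda>r. P r \<cdot> St r p q) = mu \<cdot> (P p \<otimes> P q)"
begin

text \<open>Unit law: by \<open>X_0_1\<close> and \<open>X_0_n\<close> only the tuple made of
  \<open>n\<close> pairs \<open>(0, 1)\<close> contributes. The zero map is written as an empty sum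
  so that it carries degrees.\<close>

lemma St_0_left: "St r 0 n = (if r = n then idm n else lsum n r {} (\<lambda>_ :: nat. idm 0))"
proof (induction r arbitrary: n)
  case 0
  then show ?case using St_0 St_0_zero[of 0 n] by (auto intro!: is_zero_eq is_zero_lsum)
next
  case (Suc r)
  have zero: "is_zero ((\<lambda>((a, c), (b, d)). (St r a b \<otimes> X c d) \<cdot> CP (a, b) (c, d)) w)"
    if w: "w \<in> sp 0 \<times> sp n" and ne: "w \<noteq> ((0, 0), (r, 1))" for w
  proof -
    obtain b d where e: "w = ((0, 0), (b, d))" "b + d = n" using w by auto
    have "is_zero (St r 0 b \<otimes> X 0 d)"
    proof (cases "d = 1")
      case True
      then have "r \<noteq> b" using ne e by auto
      then have "is_zero (St r 0 b)" unfolding Suc.IH by (auto intro!: is_zero_lsum)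
      then show ?thesis by (auto intro!: is_zero_tens)
    qed (auto intro!: is_zero_tens X_0_n)
    then show ?thesis by (simp add: e is_zero_comp_right)
  qed
  show ?case
  proof (cases "Suc r = n")
    case True
    have "St (Suc r) 0 n = lsum n (Suc r) {((0, 0), (r, 1))}
        (\<lambda>((a, c), (b, d)). (St r a b \<otimes> X c d) \<cdot> CP (a, b) (c, d))"
      unfolding St_Suc add_0
      by (rule lsum_mono_neutral[symmetric]) (use zero True in \<open>auto simp: is_zero_def\<close>)
    also have "\<dots> = (St r 0 r \<otimes> X 0 1) \<cdot> CP (0, r) (0, 1)"
      by (subst lsum_single) (use True in auto)
    also have "\<dots> = idm n"
      using True by (simp add: X_0_1[simplified] Suc.IH CP_def tens_idm)
    finally show ?thesis using True by simp
  next
    case False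
    have "is_zero (St (Suc r) 0 n)"
      unfolding St_Suc by (intro is_zero_lsum zero) (use False in auto)
    then show ?thesis using False by (auto intro!: is_zero_eq is_zero_lsum)
  qed
qed

lemma St_0_right: "St r n 0 = (if r = n then idm n else lsum n r {} (\<lambda>_ :: nat. idm 0))"
proof (induction r arbitrary: n)
  case 0
  then show ?case using St_0 St_0_zero[of n 0] by (auto intro!: is_zero_eq is_zero_lsum)
next
  case (Suc r)
  have zero: "is_zero ((\<lambda>((a, c), (b, d)). (St r a b \<otimes> X c d) \<cdot> CP (a, b) (c, d)) w)"
    if w: "w \<in> sp n \<times> sp 0" and ne: "w \<noteq> ((r, 1), (0, 0))" for w
  proof -
    obtain a c where e: "w = ((a, c), (0, 0))" "a + c = n" using w by auto
    have "is_zero (St r a 0 \<otimes> X c 0)"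
    proof (cases "c = 1")
      case True
      then have "r \<noteq> a" using ne e by auto
      then have "is_zero (St r a 0)" unfolding Suc.IH by (auto intro!: is_zero_lsum)
      then show ?thesis by (auto intro!: is_zero_tens)
    qed (auto intro!: is_zero_tens X_n_0)
    then show ?thesis by (simp add: e is_zero_comp_right)
  qed
  show ?case
  proof (cases "Suc r = n")
    case True
    have "St (Suc r) n 0 = lsum n (Suc r) {((r, 1), (0, 0))}
        (\<lambda>((a, c), (b, d)). (St r a b \<otimes> X c d) \<cdot> CP (a, b) (c, d))"
      unfolding St_Suc add_0_right
      by (rule lsum_mono_neutral[symmetric]) (use zero True in \<open>auto simp: is_zero_def\<close>)
    also have "\<dots> = (St r r 0 \<otimes> X 1 0) \<cdot> CP (r, 0) (1, 0)"
      by (subst lsum_single) (use True in auto)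
    also have "\<dots> = idm n"
      using True by (simp add: X_1_0[simplified] Suc.IH CP_def tens_idm)
    finally show ?thesis using True by simp
  next
    case False
    have "is_zero (St (Suc r) n 0)"
      unfolding St_Suc by (intro is_zero_lsum zero) (use False in auto)
    then show ?thesis using False by (auto intro!: is_zero_eq is_zero_lsum)
  qed
qed

lemma lsum_delta:
  assumes "finite A" "c \<in> A" "\<And>a. a \<in> A \<Longrightarrow> a \<noteq> c \<Longrightarrow> is_zero (F a)" "src (F c) = m" "tgt (F c) = n"
  shows "lsum m n A F = F c"
proof -
  have "lsum m n {c} F = lsum m n A F"
    by (rule lsum_mono_neutral) (use assms in \<open>auto simp: is_zero_def\<close>)
  then show ?thesis using assms(4,5) by (simp add: lsum_single)
qed

lemma St_0_is_zero: "r \<noteq> n \<Longrightarrow> is_zero (St r 0 n)" "r \<noteq> n \<Longrightarrow> is_zero (St r n 0)"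
  unfolding St_0_left St_0_right by (auto intro!: is_zero_lsum)

lemma St_0_idm: "St n 0 n = idm n" "St n n 0 = idm n"
  by (simp_all add: St_0_left St_0_right)

text \<open>A factor of degree 0 drops out by the unit laws. Together with \<open>Rm_0\<close> this
  settles \<open>Lm_eq_Rm\<close> when one of the degrees is 0.\<close>

lemma Lm_0: "Lm r 0 j k = St r j k" "Lm r i 0 k = St r i k" "Lm r i j 0 = St r i j"
proof -
  have "Lm r 0 j k = St r j k \<cdot> (St j 0 j \<otimes> idm k)"
    unfolding Lm_def
    by (rule lsum_delta) (auto intro!: is_zero_comp_left is_zero_tens St_0_is_zero)
  then show "Lm r 0 j k = St r j k" by (simp add: St_0_idm tens_idm)
  have "Lm r i 0 k = St r i k \<cdot> (St i i 0 \<otimes> idm k)"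
    unfolding Lm_def
    by (rule lsum_delta) (auto intro!: is_zero_comp_left is_zero_tens St_0_is_zero)
  then show "Lm r i 0 k = St r i k" by (simp add: St_0_idm tens_idm)
  show "Lm r i j 0 = St r i j"
  \<comment> \<open>The surviving summand is \<open>t = r\<close>, which is in range only if
    \<open>r \<le> i + j\<close>; beyond that both sides are 0.\<close>
  proof (cases "r \<le> i + j")
    case True
    have "Lm r i j 0 = St r r 0 \<cdot> (St r i j \<otimes> idm 0)"
      unfolding Lm_def
      by (rule lsum_delta) (use True in \<open>auto intro!: is_zero_comp_right St_0_is_zero\<close>)
    then show ?thesis by (simp add: St_0_idm)
  next
    case False
    have "is_zero (Lm r i j 0)"
      unfolding Lm_def by (rule is_zero_lsum) (use False in \<open>auto intro!: is_zero_comp_right St_0_is_zero\<close>)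
    then show ?thesis using St_zero[of i j r] False by (auto intro!: is_zero_eq)
  qed
qed

lemma Rm_0: "Rm r 0 j k = St r j k" "Rm r i 0 k = St r i k" "Rm r i j 0 = St r i j"
proof -
  have "Rm r i 0 k = St r i k \<cdot> (idm i \<otimes> St k 0 k)"
    unfolding Rm_def
    by (rule lsum_delta) (auto intro!: is_zero_comp_left is_zero_tens St_0_is_zero)
  then show "Rm r i 0 k = St r i k" by (simp add: St_0_idm tens_idm)
  have "Rm r i j 0 = St r i j \<cdot> (idm i \<otimes> St j j 0)"
    unfolding Rm_def
    by (rule lsum_delta) (auto intro!: is_zero_comp_left is_zero_tens St_0_is_zero)
  then show "Rm r i j 0 = St r i j" by (simp add: St_0_idm tens_idm)
  show "Rm r 0 j k = St r j k"
  proof (cases "r \<le> j + k")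
    case True
    have "Rm r 0 j k = St r 0 r \<cdot> (idm 0 \<otimes> St r j k)"
      unfolding Rm_def
      by (rule lsum_delta) (use True in \<open>auto intro!: is_zero_comp_right St_0_is_zero\<close>)
    then show ?thesis by (simp add: St_0_idm)
  next
    case False
    have "is_zero (Rm r 0 j k)"
      unfolding Rm_def by (rule is_zero_lsum) (use False in \<open>auto intro!: is_zero_comp_right St_0_is_zero\<close>)
    then show ?thesis using St_zero[of j k r] False by (auto intro!: is_zero_eq)
  qed
qed

text \<open>A bound that does not depend on \<open>p\<close> and \<open>q\<close> makes the sums
  over \<open>r\<close> and over the intermediate degree exchangeable in \<open>P_Lm\<close> and
  \<open>P_Rm\<close>.\<close>

lemma P_St_extend:
  assumes "1 \<le> p" "1 \<le> q" "p + q \<le> n"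
  shows "lsum (p + q) 1 {1..n} (\<lambda>r. P r \<cdot> St r p q) = mu \<cdot> (P p \<otimes> P q)"
proof -
  have "lsum (p + q) 1 {1..p + q} (\<lambda>r. P r \<cdot> St r p q) = lsum (p + q) 1 {1..n} (\<lambda>r. P r \<cdot> St r p q)"
  proof (rule lsum_mono_neutral)
    fix r x assume "r \<in> {1..n} - {1..p + q}"
    then have "is_zero (P r \<cdot> St r p q)"
      by (intro is_zero_comp_left St_zero) auto
    then show "app (P r \<cdot> St r p q) x = 0" by (simp add: is_zero_def)
  qed (use assms in auto)
  then show ?thesis using P_St[OF assms(1,2)] by simp
qed

text \<open>Multiplicativity is used twice: for the outer star product in each intermediate degree
  \<open>t\<close>, then for the inner one.\<close>

lemma P_Lm:
  assumes "1 \<le> i" "1 \<le> j" "1 \<le> k"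
  shows "lsum (i + j + k) 1 {1..i + j + k} (\<lambda>r. P r \<cdot> Lm r i j k) =
    mu \<cdot> ((mu \<cdot> (P i \<otimes> P j)) \<otimes> P k)"
proof -
  let ?n = "i + j + k"
  have "lsum ?n 1 {1..?n} (\<lambda>r. P r \<cdot> Lm r i j k) =
      lsum ?n 1 {1..?n} (\<lambda>r. lsum ?n 1 {..i + j} (\<lambda>t. (P r \<cdot> St r t k) \<cdot> (St t i j \<otimes> idm k)))"
    by (intro lsum_cong refl) (auto simp: Lm_def lsum_comp_left mcomp_assoc)
  also have "\<dots> = lsum ?n 1 {..i + j} (\<lambda>t. lsum ?n 1 {1..?n} (\<lambda>r. (P r \<cdot> St r t k) \<cdot> (St t i j \<otimes> idm k)))"
    by (rule lsum_swap)
  \<comment> \<open>\<open>P_St\<close> needs positive degrees; the summand \<open>t = 0\<close>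
    vanishes because \<open>i + j > 0\<close>.\<close>
  also have "\<dots> = lsum ?n 1 {1..i + j} (\<lambda>t. lsum ?n 1 {1..?n} (\<lambda>r. (P r \<cdot> St r t k) \<cdot> (St t i j \<otimes> idm k)))"
  proof (rule lsum_mono_neutral[symmetric])
    fix t x assume "t \<in> {..i + j} - {1..i + j}"
    then have t: "t = 0" by auto
    have "is_zero (lsum ?n 1 {1..?n} (\<lambda>r. (P r \<cdot> St r t k) \<cdot> (St t i j \<otimes> idm k)))"
      using assms by (intro is_zero_lsum is_zero_comp_left is_zero_tens disjI1) (auto simp: t intro!: St_0_zero)
    then show "app (lsum ?n 1 {1..?n} (\<lambda>r. (P r \<cdot> St r t k) \<cdot> (St t i j \<otimes> idm k))) x = 0"
      by (simp add: is_zero_def)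
  qed auto
  also have "\<dots> = lsum ?n 1 {1..i + j} (\<lambda>t. mu \<cdot> ((P t \<cdot> St t i j) \<otimes> P k))"
  proof (intro lsum_cong refl)
    fix t assume t: "t \<in> {1..i + j}"
    have "lsum ?n 1 {1..?n} (\<lambda>r. (P r \<cdot> St r t k) \<cdot> (St t i j \<otimes> idm k)) =
        lsum (t + k) 1 {1..?n} (\<lambda>r. P r \<cdot> St r t k) \<cdot> (St t i j \<otimes> idm k)"
      by (simp add: lsum_comp_right)
    also have "\<dots> = (mu \<cdot> (P t \<otimes> P k)) \<cdot> (St t i j \<otimes> idm k)"
      using t assms by (subst P_St_extend) auto
    also have "\<dots> = mu \<cdot> ((P t \<cdot> St t i j) \<otimes> P k)"
      by (simp add: mcomp_assoc interchange)
    finally show "lsum ?n 1 {1..?n} (\<lambda>r. (P r \<cdot> St r t k) \<cdot> (St t i j \<otimes> idm k)) = \<dots>" .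
  qed
  also have "\<dots> = mu \<cdot> (lsum (i + j) 1 {1..i + j} (\<lambda>t. P t \<cdot> St t i j) \<otimes> P k)"
    by (simp add: lsum_tens_left lsum_comp_left)
  also have "\<dots> = mu \<cdot> ((mu \<cdot> (P i \<otimes> P j)) \<otimes> P k)"
    using P_St[OF assms(1,2)] by simp
  finally show ?thesis .
qed

lemma P_Rm:
  assumes "1 \<le> i" "1 \<le> j" "1 \<le> k"
  shows "lsum (i + j + k) 1 {1..i + j + k} (\<lambda>r. P r \<cdot> Rm r i j k) =
    mu \<cdot> (P i \<otimes> (mu \<cdot> (P j \<otimes> P k)))"
proof -
  let ?n = "i + j + k"
  have "lsum ?n 1 {1..?n} (\<lambda>r. P r \<cdot> Rm r i j k) =
      lsum ?n 1 {1..?n} (\<lambda>r. lsum ?n 1 {..j + k} (\<lambda>t. (P r \<cdot> St r i t) \<cdot> (idm i \<otimes> St t j k)))"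
    by (intro lsum_cong refl) (auto simp: Rm_def lsum_comp_left mcomp_assoc)
  also have "\<dots> = lsum ?n 1 {..j + k} (\<lambda>t. lsum ?n 1 {1..?n} (\<lambda>r. (P r \<cdot> St r i t) \<cdot> (idm i \<otimes> St t j k)))"
    by (rule lsum_swap)
  also have "\<dots> = lsum ?n 1 {1..j + k} (\<lambda>t. lsum ?n 1 {1..?n} (\<lambda>r. (P r \<cdot> St r i t) \<cdot> (idm i \<otimes> St t j k)))"
  proof (rule lsum_mono_neutral[symmetric])
    fix t x assume "t \<in> {..j + k} - {1..j + k}"
    then have t: "t = 0" by auto
    have "is_zero (lsum ?n 1 {1..?n} (\<lambda>r. (P r \<cdot> St r i t) \<cdot> (idm i \<otimes> St t j k)))"
      using assms by (intro is_zero_lsum is_zero_comp_left is_zero_tens disjI2) (auto simp: t intro!: St_0_zero)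
    then show "app (lsum ?n 1 {1..?n} (\<lambda>r. (P r \<cdot> St r i t) \<cdot> (idm i \<otimes> St t j k))) x = 0"
      by (simp add: is_zero_def)
  qed auto
  also have "\<dots> = lsum ?n 1 {1..j + k} (\<lambda>t. mu \<cdot> (P i \<otimes> (P t \<cdot> St t j k)))"
  proof (intro lsum_cong refl)
    fix t assume t: "t \<in> {1..j + k}"
    have "lsum ?n 1 {1..?n} (\<lambda>r. (P r \<cdot> St r i t) \<cdot> (idm i \<otimes> St t j k)) =
        lsum (i + t) 1 {1..?n} (\<lambda>r. P r \<cdot> St r i t) \<cdot> (idm i \<otimes> St t j k)"
      by (simp add: lsum_comp_right add.assoc)
    also have "\<dots> = (mu \<cdot> (P i \<otimes> P t)) \<cdot> (idm i \<otimes> St t j k)"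
      using t assms by (subst P_St_extend) auto
    also have "\<dots> = mu \<cdot> (P i \<otimes> (P t \<cdot> St t j k))"
      by (simp add: mcomp_assoc interchange)
    finally show "lsum ?n 1 {1..?n} (\<lambda>r. (P r \<cdot> St r i t) \<cdot> (idm i \<otimes> St t j k)) = \<dots>" .
  qed
  also have "\<dots> = mu \<cdot> (P i \<otimes> lsum (j + k) 1 {1..j + k} (\<lambda>t. P t \<cdot> St t j k))"
    by (simp add: lsum_tens_right lsum_comp_left add.assoc)
  also have "\<dots> = mu \<cdot> (P i \<otimes> (mu \<cdot> (P j \<otimes> P k)))"
    using P_St[OF assms(2,3)] by simp
  finally show ?thesis .
qed

lemma P_Lm_Rm:
  assumes "1 \<le> i" "1 \<le> j" "1 \<le> k"
  shows "lsum (i + j + k) 1 {1..i + j + k} (\<lambda>r. P r \<cdot> Lm r i j k) =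
    lsum (i + j + k) 1 {1..i + j + k} (\<lambda>r. P r \<cdot> Rm r i j k)"
proof -
  have "mu \<cdot> ((mu \<cdot> (P i \<otimes> P j)) \<otimes> P k) = (mu \<cdot> (mu \<otimes> idm 1)) \<cdot> ((P i \<otimes> P j) \<otimes> P k)"
    by (simp add: mcomp_assoc interchange)
  also have "\<dots> = (mu \<cdot> (idm 1 \<otimes> mu)) \<cdot> (P i \<otimes> P j \<otimes> P k)"
    by (simp only: mu_assoc tens_assoc[OF P_simps(1) P_simps(1) P_simps(1)])
  also have "\<dots> = mu \<cdot> (P i \<otimes> (mu \<cdot> (P j \<otimes> P k)))"
    by (simp add: mcomp_assoc interchange)
  finally show ?thesis using P_Lm[OF assms] P_Rm[OF assms] by simp
qed

lemma Lm_eq_Rm: "Lm r i j k = Rm r i j k"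
proof (induction "i + j + k" arbitrary: i j k r rule: less_induct)
  case less
  show ?case
  proof (cases "i = 0 \<or> j = 0 \<or> k = 0")
    case True
    then show ?thesis using Lm_0 Rm_0 by metis
  next
    case False
    then have pos: "1 \<le> i" "1 \<le> j" "1 \<le> k" by auto
    \<comment> \<open>A factor that receives total degree 0 vanishes, since both factors have values
      in positive degree. Otherwise both have smaller total degree than \<open>i + j + k\<close>,
      and the induction hypothesis applies.\<close>
    have high: "Lm (1 + Suc s) i j k = Rm (1 + Suc s) i j k" for s
      unfolding Lm_split Rm_split
    proof (intro lsum_cong refl)
      fix w assume "w \<in> sp i \<times> sp j \<times> sp k"
      then obtain i1 i2 j1 j2 k1 k2 where w: "w = ((i1, i2), (j1, j2), (k1, k2))"
        and e: "i1 + i2 = i" "j1 + j2 = j" "k1 + k2 = k" by (cases w) auto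
      have z: "is_zero (Lm (Suc t) 0 0 0)" "is_zero (Rm (Suc t) 0 0 0)" for t
        unfolding Lm_0 Rm_0 by (simp_all add: St_zero)
      have "Lm 1 i1 j1 k1 \<otimes> Lm (Suc s) i2 j2 k2 = Rm 1 i1 j1 k1 \<otimes> Rm (Suc s) i2 j2 k2"
      proof (cases "i1 + j1 + k1 = 0 \<or> i2 + j2 + k2 = 0")
        case True
        then have "is_zero (Lm 1 i1 j1 k1 \<otimes> Lm (Suc s) i2 j2 k2)" "is_zero (Rm 1 i1 j1 k1 \<otimes> Rm (Suc s) i2 j2 k2)"
          using z[of 0] z[of s] by (auto intro!: is_zero_tens)
        then show ?thesis by (rule is_zero_eq) simp_all
      next
        case False
        then have "i1 + j1 + k1 < i + j + k" "i2 + j2 + k2 < i + j + k" using e by auto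
        then show ?thesis using less by metis
      qed
      then show "(Lm 1 (fst (fst w)) (fst (fst (snd w))) (fst (snd (snd w))) \<otimes>
           Lm (Suc s) (snd (fst w)) (snd (fst (snd w))) (snd (snd (snd w)))) \<cdot>
          CP3 (fst w) (fst (snd w)) (snd (snd w)) =
        (Rm 1 (fst (fst w)) (fst (fst (snd w))) (fst (snd (snd w))) \<otimes>
           Rm (Suc s) (snd (fst w)) (snd (fst (snd w))) (snd (snd (snd w)))) \<cdot>
          CP3 (fst w) (fst (snd w)) (snd (snd w))"
        by (simp add: w)
    qed
    \<comment> \<open>The full sums over \<open>r\<close> agree by \<open>P_Lm_Rm\<close> and their
      terms with \<open>r \<ge> 2\<close> agree by \<open>high\<close>; as \<open>P 1\<close> is the
      identity, what is left over are the components themselves.\<close>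
    have one: "Lm 1 i j k = Rm 1 i j k"
    proof (rule mor_ext)
      fix x assume "x \<in> tp (src (Lm 1 i j k))"
      have dec: "(\<Sum>r\<in>{1..i + j + k}. app (P r \<cdot> F r) x) =
          app (F 1) x + (\<Sum>r\<in>{2..i + j + k}. app (P r \<cdot> F r) x)"
        if "\<And>r. arr (F r) \<and> src (F r) = i + j + k \<and> tgt (F r) = r" for F
      proof -
        have "{1..i + j + k} = insert 1 {2..i + j + k}" using pos by auto
        moreover have "P 1 \<cdot> F 1 = F 1" using that[of 1] P_1 by simp
        ultimately show ?thesis by (simp del: app_comp)
      qed
      have "Lm r i j k = Rm r i j k" if "r \<in> {2..i + j + k}" for r
      proof -
        have "r = 1 + Suc (r - 2)" using that by auto
        then show ?thesis using high[of "r - 2"] by metis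
      qed
      then have "(\<Sum>r\<in>{2..i + j + k}. app (P r \<cdot> Lm r i j k) x) = (\<Sum>r\<in>{2..i + j + k}. app (P r \<cdot> Rm r i j k) x)"
        by simp
      moreover have "(\<Sum>r\<in>{1..i + j + k}. app (P r \<cdot> Lm r i j k) x) = (\<Sum>r\<in>{1..i + j + k}. app (P r \<cdot> Rm r i j k) x)"
        using P_Lm_Rm[OF pos] by (simp add: lsum_def fun_eq_iff)
      ultimately show "app (Lm 1 i j k) x = app (Rm 1 i j k) x"
        using dec[of "\<lambda>r. Lm r i j k"] dec[of "\<lambda>r. Rm r i j k"] by simp
    qed simp_all
    have zero: "Lm 0 i j k = Rm 0 i j k"
      using pos by (intro is_zero_eq)
        (auto simp: Lm_def Rm_def intro!: is_zero_lsum is_zero_comp_right St_0_zero)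
    consider "r = 0" | "r = 1" | q where "r = 1 + Suc q"
      by (metis One_nat_def add_Suc plus_1_eq_Suc old.nat.exhaust)
    then show ?thesis using high one zero by cases auto
  qed
qed

end

section \<open>The multi-brace structure of a 2-braided algebra\<close>

context tensor_powers
begin

text \<open>Inverse on \<open>tp 1\<close> of the map that sends \<open>v\<close> to
  \<open>pu [v]\<close>, in the form in which \<open>brace\<close> has it for \<open>M_10\<close>
  and \<open>M_01\<close>.\<close>

definition ev :: "('k, 'v) tensor \<Rightarrow> 'v" where
  "ev = lift scale scale {1} hd"

lemma ev_linear: "Vector_Spaces.linear tscale scale ev" and ev_pure [simp]: "ev (pu [v]) = v"
proof -
  have ml: "\<And>n. n \<in> {1} \<Longrightarrow> multilinear scale scale n hd"
    unfolding multilinear_iff[OF vector_space_scale] by auto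
  show "Vector_Spaces.linear tscale scale ev"
    unfolding ev_def by (rule linear_lift[OF vector_space_scale vector_space_scale ml])
  show "ev (pu [v]) = v"
    unfolding ev_def by (subst lift_pure[OF vector_space_scale vector_space_scale ml]) auto
qed

lemma pure_singleton_linear: "Vector_Spaces.linear scale tscale (\<lambda>v. pu [v])"
  using pure_add[of "[]" _ _ "[]"] pure_scale[of "[]" _ _ "[]"] vector_space_scale vector_space_tscale
  by (simp add: Vector_Spaces.linear_iff)

lemma pure_singleton_inject: "pu [v] = pu [w] \<Longrightarrow> v = w"
  by (metis ev_pure)

lemma to_tensor_lin:
  assumes "linear_on_tpow scale scale n f"
  shows "lin n (to_tensor scale f)"
  using assms pure_singleton_linear by (simp add: linear_on_tpow_def to_tensor_def Vector_Spaces.linear_iff)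

lemma arr_restr_to_tensor: "linear_on_tpow scale scale n f \<Longrightarrow> arr (restr n 1 (to_tensor scale f))"
  by (rule arr_restr[OF to_tensor_lin]) (simp_all add: to_tensor_def pure_in_tpow)

lemma linear_on_tpow_ev: "arr f \<Longrightarrow> src f = n \<Longrightarrow> linear_on_tpow scale scale n (\<lambda>x. ev (app f x))"
  using arr_lin[of f] ev_linear by (auto simp: linear_on_tpow_def Vector_Spaces.linear_iff)

lemma multilinear_cong:
  assumes "\<And>vs. length vs = n \<Longrightarrow> h vs = h' vs" "vector_space sW"
  shows "multilinear scale sW n h \<longleftrightarrow> multilinear scale sW n h'"
  using assms(1) unfolding multilinear_iff[OF assms(2)] by auto

end

section \<open>Products of braided algebras as natural maps\<close>

context braided
begin

definition mult :: "('v \<Rightarrow> 'v \<Rightarrow> 'v) \<Rightarrow> ('k, 'v) tensor mor" where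
  "mult m = restr 2 1 (to_tensor scale (mult_map scale m))"

lemma mult_src_tgt [simp]: "src (mult m) = 2" "tgt (mult m) = 1"
  by (simp_all add: mult_def)

context
  fixes m e
  assumes alg: "braided_algebra scale m e \<sigma>"
begin

lemma mult_map_multilinear: "\<And>n. n \<in> {2} \<Longrightarrow> multilinear scale scale n (\<lambda>vs. m (vs ! 0) (vs ! 1))"
proof -
  have l: "m a (b + c) = m a b + m a c" "m (b + c) a = m b a + m c a"
    "m a (scale x b) = scale x (m a b)" "m (scale x b) a = scale x (m b a)" for a b c x
    using alg by (simp_all add: braided_algebra_def unital_assoc_algebra_def Vector_Spaces.linear_iff)
  have "us = [] \<and> (\<exists>a. vs = [a]) \<or> (\<exists>a. us = [a]) \<and> vs = []" if "length us + 1 + length vs = 2"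
    for us vs :: "'v list"
    using that by (cases us; cases vs) auto
  then show "multilinear scale scale n (\<lambda>vs. m (vs ! 0) (vs ! 1))" if "n \<in> {2}" for n
    using that unfolding multilinear_iff[OF vector_space_scale] by (fastforce simp: l)
qed

lemma arr_mult: "arr (mult m)"
  unfolding mult_def mult_map_def
  by (rule arr_restr_to_tensor, rule linear_on_tpow_linear,
      rule linear_lift[OF vector_space_scale vector_space_scale mult_map_multilinear])

lemma mult_pure: "app (mult m) (pu [a, b]) = pu [m a b]"
proof -
  have "mult_map scale m (pu [a, b]) = m a b"
    unfolding mult_map_def
    by (subst lift_pure[OF vector_space_scale vector_space_scale mult_map_multilinear]) auto
  then show ?thesis by (simp add: mult_def app_restr pure_in_tpow to_tensor_def)
qed

text \<open>Against one strand, the two conditions are the axioms of a braided algebra that link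
  braiding and product; \<open>naturalI\<close> extends them to any number of strands.\<close>

lemma natural_mult: "natural (mult m)"
proof (rule naturalI)
  note a [simp] = arr_mult
  have B: "B 2 1 = Sg 3 1 \<cdot> Sg 3 2" "B 1 2 = Sg 3 2 \<cdot> Sg 3 1"
    using B_hexagon_left[of 1 1 1] B_hexagon_right[of 1 1 1]
    by (simp_all only: Sg_def B_1_1 one_add_one) (simp_all add: tens_assoc)
  have t: "tmap scale 2 1 (to_tensor scale (mult_map scale m)) id x = app (mult m \<otimes> idm 1) x"
    "tmap scale 1 2 id (to_tensor scale (mult_map scale m)) x = app (idm 1 \<otimes> mult m) x" if "x \<in> tp 3" for x
    by (rule tmap_eq_tens; use that in \<open>simp add: app_idm mult_def app_restr eval_nat_numeral\<close>)+
  have r: "app (Sg 3 i) y \<in> tp 3" if "y \<in> tp 3" "1 \<le> i" "i < 3" for y i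
    using arr_range[OF arr_Sg, of y 3 i] that by simp
  have sgx: "\<sigma> x = app sg x" if "x \<in> tp 2" for x
    using that by (simp add: sg_def app_restr)
  have m: "app (mult m \<otimes> idm 1) x \<in> tp 2" "app (idm 1 \<otimes> mult m) x \<in> tp 2" if "x \<in> tp 3" for x
    using arr_range[of "mult m \<otimes> idm 1" x] arr_range[of "idm 1 \<otimes> mult m" x] that
    by (simp_all add: eval_nat_numeral)
  have "sg \<cdot> (mult m \<otimes> idm 1) = (idm 1 \<otimes> mult m) \<cdot> (Sg 3 1 \<cdot> Sg 3 2)"
  proof (rule mor_ext)
    fix x assume "x \<in> tp (src (sg \<cdot> (mult m \<otimes> idm 1)))"
    then have x: "x \<in> tp 3" by simp
    then have "\<sigma> (tmap scale 2 1 (to_tensor scale (mult_map scale m)) id x) =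
        tmap scale 1 2 id (to_tensor scale (mult_map scale m)) (sigma_at scale \<sigma> 3 1 (sigma_at scale \<sigma> 3 2 x))"
      using alg by (simp add: braided_algebra_def)
    then show "app (sg \<cdot> (mult m \<otimes> idm 1)) x = app ((idm 1 \<otimes> mult m) \<cdot> (Sg 3 1 \<cdot> Sg 3 2)) x"
      using x by (simp add: sigma_at_Sg r t[simplified] m[simplified] sgx)
  qed auto
  then show "natural_left 1 (mult m)"
    by (simp only: natural_left_def mult_src_tgt B_1_1 B)
  have "sg \<cdot> (idm 1 \<otimes> mult m) = (mult m \<otimes> idm 1) \<cdot> (Sg 3 2 \<cdot> Sg 3 1)"
  proof (rule mor_ext)
    fix x assume "x \<in> tp (src (sg \<cdot> (idm 1 \<otimes> mult m)))"
    then have x: "x \<in> tp 3" by (simp add: eval_nat_numeral)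
    then have "\<sigma> (tmap scale 1 2 id (to_tensor scale (mult_map scale m)) x) =
        tmap scale 2 1 (to_tensor scale (mult_map scale m)) id (sigma_at scale \<sigma> 3 2 (sigma_at scale \<sigma> 3 1 x))"
      using alg by (simp add: braided_algebra_def)
    then show "app (sg \<cdot> (idm 1 \<otimes> mult m)) x = app ((mult m \<otimes> idm 1) \<cdot> (Sg 3 2 \<cdot> Sg 3 1)) x"
      using x by (simp add: sigma_at_Sg r t[simplified] m[simplified] sgx)
  qed auto
  then show "natural_right 1 (mult m)"
    by (simp only: natural_right_def mult_src_tgt B_1_1 B)
qed (rule arr_mult)

lemma mult_assoc: "mult m \<cdot> (mult m \<otimes> idm 1) = mult m \<cdot> (idm 1 \<otimes> mult m)"
proof (rule mor_eqI)
  note a [simp] = arr_mult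
  show "arr (mult m \<cdot> (mult m \<otimes> idm 1))" "arr (mult m \<cdot> (idm 1 \<otimes> mult m))" by simp_all
  fix vs :: "'v list" assume "length vs = src (mult m \<cdot> (mult m \<otimes> idm 1))"
  then have "length vs = 3" by simp
  then obtain a b c where vs: "vs = [a, b, c]"
    by (auto simp: numeral_3_eq_3 length_Suc_conv)
  have "app (mult m \<otimes> idm 1) (pu ([a, b] @ [c])) = pu [m a b, c]"
    by (subst app_tens_pure) (auto simp: mult_pure app_idm pure_in_tpow conc_pure)
  moreover have "app (idm 1 \<otimes> mult m) (pu ([a] @ [b, c])) = pu [a, m b c]"
    by (subst app_tens_pure) (auto simp: mult_pure app_idm pure_in_tpow conc_pure)
  moreover have "m (m a b) c = m a (m b c)"
    using alg by (simp add: braided_algebra_def unital_assoc_algebra_def)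
  ultimately show "app (mult m \<cdot> (mult m \<otimes> idm 1)) (pu vs) = app (mult m \<cdot> (idm 1 \<otimes> mult m)) (pu vs)"
    by (simp add: vs mult_pure)
qed simp_all

end

end

section \<open>The brace maps: recursion, naturality, multiplicativity\<close>

locale two_braided = braided scale \<sigma>
  for scale :: "'k::field_char_0 \<Rightarrow> 'v::ab_group_add \<Rightarrow> 'v" and \<sigma> +
  fixes ast dot :: "'v \<Rightarrow> 'v \<Rightarrow> 'v" and e :: 'v
  assumes two_braided: "unital_two_braided_algebra scale ast dot e \<sigma>"
begin

lemma ast_alg: "braided_algebra scale ast e \<sigma>" and dot_alg: "braided_algebra scale dot e \<sigma>"
  using two_braided by (simp_all add: unital_two_braided_algebra_def)

text \<open>Right-nested as in \<open>list_prod\<close>. \<open>P 0\<close> is filled with the zero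
  map so that degrees and naturality are right for every \<open>r\<close>.\<close>

fun P :: "nat \<Rightarrow> ('k, 'v) tensor mor" where
  "P 0 = lsum 0 1 {} (\<lambda>_ :: nat. idm 0)"
| "P (Suc 0) = idm 1"
| "P (Suc (Suc r)) = mult dot \<cdot> (idm 1 \<otimes> P (Suc r))"

lemma P_src_tgt [simp]: "src (P r) = r" "tgt (P r) = 1"
proof -
  have "src (P r) = r \<and> tgt (P r) = 1"
    by (induction r rule: P.induct) auto
  then show "src (P r) = r" "tgt (P r) = 1" by simp_all
qed

lemma P_natural [simp]: "natural (P r)"
  by (induction r rule: P.induct)
    (auto intro!: natural_comp natural_tens natural_lsum simp: natural_mult[OF dot_alg])

lemma P_pure: "vs \<noteq> [] \<Longrightarrow> app (P (length vs)) (pu vs) = pu [list_prod dot vs]"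
proof (induction vs rule: induct_list012)
  case (2 v)
  then show ?case by (simp add: app_idm pure_in_tpow)
next
  case (3 v w vs)
  have "app (P (length (v # w # vs))) (pu (v # w # vs)) =
      app (mult dot) (app (idm 1 \<otimes> P (length (w # vs))) (pu ([v] @ (w # vs))))"
    by simp
  also have "app (idm 1 \<otimes> P (length (w # vs))) (pu ([v] @ (w # vs))) = pu [v] \<odot> app (P (length (w # vs))) (pu (w # vs))"
    by (subst app_tens_pure) (auto simp: app_idm pure_in_tpow)
  also have "\<dots> = pu [v, list_prod dot (w # vs)]"
    using 3 by (simp add: conc_pure)
  finally show ?case by (simp add: mult_pure[OF dot_alg])
qed auto

text \<open>Bridge from the \<open>lift\<close> in \<open>iter_mult\<close>; that
  \<open>list_prod dot\<close> is multilinear follows from the linear map \<open>P r\<close>, whose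
  values on pure tensors it describes.\<close>

lemma iter_mult_P:
  assumes "1 \<le> r" "x \<in> tp r"
  shows "pu [iter_mult scale dot (r - 1) x] = app (P r) x"
proof -
  have r: "r - 1 + 1 = r" using assms(1) by simp
  have ml: "\<And>n. n \<in> {r} \<Longrightarrow> multilinear scale scale n (list_prod dot)"
  proof -
    fix n assume "n \<in> {r}"
    have "list_prod dot vs = ev (app (P r) (pu vs))" if "length vs = r" for vs
      using P_pure[of vs] that assms(1) by (cases vs) auto
    then have "multilinear scale scale r (list_prod dot)"
      using multilinear_linear_on_tpow[OF linear_on_tpow_ev[of "P r" r] vector_space_scale]
      by (subst multilinear_cong[of r _ "\<lambda>vs. ev (app (P r) (pu vs))"]) (auto simp: vector_space_scale)
    then show "multilinear scale scale n (list_prod dot)" using \<open>n \<in> {r}\<close> by simp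
  qed
  have "to_tensor scale (iter_mult scale dot (r - 1)) x = app (P r) x"
  proof (rule lin_eqI[OF to_tensor_lin _ _ assms(2)])
    show "linear_on_tpow scale scale r (iter_mult scale dot (r - 1))"
      unfolding iter_mult_def r
      by (rule linear_on_tpow_linear, rule linear_lift[OF vector_space_scale vector_space_scale ml])
    show "lin r (app (P r))" using arr_lin[of "P r"] by simp
    fix vs :: "'v list" assume l: "length vs = r"
    then have "iter_mult scale dot (r - 1) (pu vs) = list_prod dot vs"
      unfolding iter_mult_def r by (subst lift_pure[OF vector_space_scale vector_space_scale ml]) auto
    then show "to_tensor scale (iter_mult scale dot (r - 1)) (pu vs) = app (P r) (pu vs)"
      using P_pure[of vs] l assms(1) by (cases vs) (auto simp: to_tensor_def)
  qed
  then show ?thesis by (simp add: to_tensor_def)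
qed

abbreviation br :: "nat \<Rightarrow> nat \<Rightarrow> ('k, 'v) tensor \<Rightarrow> 'v" where
  "br \<equiv> brace scale ast dot \<sigma>"

definition Xm :: "nat \<Rightarrow> nat \<Rightarrow> ('k, 'v) tensor mor" where
  "Xm p q = restr (p + q) 1 (to_tensor scale (br p q))"

lemma Xm_src_tgt [simp]: "src (Xm p q) = p + q" "tgt (Xm p q) = 1"
  by (simp_all add: Xm_def)

lemma app_Xm: "x \<in> tp (p + q) \<Longrightarrow> app (Xm p q) x = pu [br p q x]"
  by (simp add: Xm_def app_restr to_tensor_def)

text \<open>Only the locale without assumptions is available here: the proof that \<open>Xm\<close>
  is natural already speaks of \<open>XF.MT\<close>. The stronger locales are entered once
  naturality and multiplicativity are known.\<close>

sublocale XF: brace_family scale \<sigma> Xm ..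

lemma src_MT: "src (XF.MT ps) = fst_sum ps + snd_sum ps"
  by (induction ps rule: XF.MT.induct) auto

lemma mtensor_MT: "x \<in> tp (fst_sum ps + snd_sum ps) \<Longrightarrow> mtensor scale br ps x = app (XF.MT ps) x"
proof (induction ps arbitrary: x rule: XF.MT.induct)
  case 1
  then show ?case by (simp add: app_idm)
next
  case (2 i j ps)
  have "tmap scale (i + j) (fst_sum ps + snd_sum ps) (to_tensor scale (br i j)) (mtensor scale br ps) x =
      app (Xm i j \<otimes> XF.MT ps) x"
    by (rule tmap_eq_tens) (use 2 in \<open>auto simp: src_MT app_Xm to_tensor_def ac_simps\<close>)
  then show ?case by simp
qed

definition proper_tuples :: "nat \<Rightarrow> nat \<Rightarrow> nat \<Rightarrow> (nat \<times> nat) list set" where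
  "proper_tuples k p q = {ps \<in> tuples k p q. (0, 0) \<notin> set ps}"

text \<open>As \<open>k \<ge> 2\<close>, a further pair is present, and it is not
  \<open>(0, 0)\<close>.\<close>

lemma proper_tuples_less:
  assumes "ps \<in> proper_tuples k p q" "2 \<le> k" "(i, j) \<in> set ps"
  shows "i + j < p + q"
proof -
  have len: "length ps \<ge> 2" and sums: "fst_sum ps = p" "snd_sum ps = q"
    and nz: "(0, 0) \<notin> set ps"
    using assms by (auto simp: proper_tuples_def tuples_def)
  obtain as bs where ps: "ps = as @ (i, j) # bs"
    using assms(3) by (meson split_list)
  have "length (as @ bs) \<le> fst_sum (as @ bs) + snd_sum (as @ bs)"
    by (rule length_le_sums) (use nz in \<open>simp add: ps\<close>)
  moreover have "length (as @ bs) \<ge> 1" using len by (simp add: ps)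
  ultimately show ?thesis using sums by (simp add: ps)
qed

text \<open>The sum that is subtracted in the recursion for \<open>M\<^sub>p\<^sub>q\<close>.\<close>

definition tail :: "nat \<Rightarrow> nat \<Rightarrow> ('k, 'v) tensor mor" where
  "tail p q = lsum (p + q) 1 (SIGMA k:{2..p + q}. proper_tuples k p q)
     (\<lambda>u. P (fst u) \<cdot> (XF.MT (snd u) \<cdot> ICr (rev (snd u))))"

text \<open>The values of a \<open>lift\<close> are known only once its argument \<open>h\<close> is
  multilinear. By the hypothesis the right-hand side of the recursion is a linear map
  \<open>G\<close>, and \<open>h\<close> agrees with \<open>G\<close> on pure tensors; so
  \<open>h\<close> is multilinear, and its \<open>lift\<close> is \<open>G\<close> up to the
  identification of \<open>V\<close> with \<open>tp 1\<close>.\<close>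

lemma Xm_step:
  assumes pq: "1 \<le> p" "1 \<le> q" and IH: "\<And>i j. i + j < p + q \<Longrightarrow> natural (Xm i j)"
  shows "linear_on_tpow scale scale (p + q) (br p q)"
    and "natural (tail p q)"
    and "Xm p q = mdiff (mult ast \<cdot> (P p \<otimes> P q)) (tail p q)"
proof -
  define G where "G = mdiff (mult ast \<cdot> (P p \<otimes> P q)) (tail p q)"
  note [simp] = arr_mult[OF ast_alg]
  have MT: "natural (XF.MT ps)" "tgt (XF.MT ps) = k" "src (XF.MT ps) = p + q"
    "fst_sum ps = p" "snd_sum ps = q"
    if "ps \<in> proper_tuples k p q" "2 \<le> k" for ps k
    using XF.MT_natural[of ps] IH proper_tuples_less[OF that] that
    by (auto simp: proper_tuples_def tuples_def)
  have sr: "fst_sum (rev ps) = fst_sum ps" "snd_sum (rev ps) = snd_sum ps" for ps :: "(nat \<times> nat) list"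
    by (simp_all add: rev_map[symmetric] sum_list_rev)
  show nt: "natural (tail p q)"
    unfolding tail_def by (rule natural_lsum) (auto simp: MT sr intro!: natural_comp)
  have st: "src (tail p q) = p + q" "tgt (tail p q) = 1" by (simp_all add: tail_def)
  have aG: "arr G" "src G = p + q" "tgt G = 1"
    using nt by (auto simp: G_def st)
  define h where "h = (\<lambda>ws. ast (list_prod dot (take p ws)) (list_prod dot (drop p ws))
        - (\<Sum>k=2..p+q. \<Sum>ps\<in>{ps \<in> tuples k p q. (0, 0) \<notin> set ps}.
             iter_mult scale dot (k - 1)
               (mtensor scale br ps (iter_coprod scale \<sigma> ps (pu ws)))))"
  interpret pl: Vector_Spaces.linear scale tscale "\<lambda>v. pu [v]"
    by (rule pure_singleton_linear)
  have hG: "pu [h ws] = app G (pu ws)" if ws: "length ws = p + q" for ws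
  proof -
    obtain us vs where uv: "ws = us @ vs" "length us = p" "length vs = q"
      using pure_split[OF ws] .
    have "app (P p \<otimes> P q) (pu (us @ vs)) = pu [list_prod dot us] \<odot> pu [list_prod dot vs]"
      using P_pure[of us] P_pure[of vs] uv pq by (cases us; cases vs; subst app_tens_pure) auto
    then have 1: "pu [ast (list_prod dot (take p ws)) (list_prod dot (drop p ws))] =
        app (mult ast \<cdot> (P p \<otimes> P q)) (pu ws)"
      using uv by (simp add: conc_pure mult_pure[OF ast_alg])
    have 2: "pu [iter_mult scale dot (k - 1) (mtensor scale br ps (iter_coprod scale \<sigma> ps (pu ws)))] =
        app (P k \<cdot> (XF.MT ps \<cdot> ICr (rev ps))) (pu ws)"
      if "ps \<in> proper_tuples k p q" "2 \<le> k" for ps k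
    proof -
      note M = MT[OF that]
      have x: "pu ws \<in> tp (p + q)" using ws by (rule pure_in_tpow)
      have ic: "iter_coprod scale \<sigma> ps (pu ws) = app (ICr (rev ps)) (pu ws)"
        using iter_coprod_ICr[of "pu ws" "rev ps"] x M by (simp add: sr)
      have y: "app (ICr (rev ps)) (pu ws) \<in> tp (p + q)"
        using arr_range[of "ICr (rev ps)" "pu ws"] x M by (simp add: sr)
      have z: "app (XF.MT ps) (app (ICr (rev ps)) (pu ws)) \<in> tp k"
        using arr_range[of "XF.MT ps"] y M by simp
      show ?thesis
        using mtensor_MT[of _ ps] iter_mult_P[OF _ z] y M that(2) by (simp add: ic)
    qed
    have fin: "finite (proper_tuples k p q)" for k by (simp add: proper_tuples_def)
    have "pu [h ws] = pu [ast (list_prod dot (take p ws)) (list_prod dot (drop p ws))] -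
        (\<Sum>k=2..p+q. \<Sum>ps\<in>proper_tuples k p q.
          pu [iter_mult scale dot (k - 1) (mtensor scale br ps (iter_coprod scale \<sigma> ps (pu ws)))])"
      unfolding h_def proper_tuples_def[symmetric] pl.diff pl.sum ..
    also have "\<dots> = app (mult ast \<cdot> (P p \<otimes> P q)) (pu ws) -
        (\<Sum>k=2..p+q. \<Sum>ps\<in>proper_tuples k p q. app (P k \<cdot> (XF.MT ps \<cdot> ICr (rev ps))) (pu ws))"
      unfolding 1 by (intro arg_cong2[where f = minus] refl sum.cong 2) auto
    also have "\<dots> = app G (pu ws)"
      using fin by (simp add: G_def app_mdiff tail_def app_lsum sum.Sigma split_beta)
    finally show ?thesis .
  qed
  have ml: "\<And>n. n \<in> {p + q} \<Longrightarrow> multilinear scale scale n h"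
  proof -
    fix n assume n: "n \<in> {p + q}"
    have "h ws = ev (app G (pu ws))" if "length ws = p + q" for ws
      using hG[OF that] ev_pure by metis
    then have "multilinear scale scale (p + q) h"
      using multilinear_linear_on_tpow[OF linear_on_tpow_ev[of G "p + q"] vector_space_scale] aG
      by (subst multilinear_cong[of "p + q" _ "\<lambda>vs. ev (app G (pu vs))"]) (auto simp: vector_space_scale)
    then show "multilinear scale scale n h" using n by simp
  qed
  have br: "br p q = lift scale scale {p + q} h"
    using pq unfolding h_def by (subst brace.simps) simp
  show lin: "linear_on_tpow scale scale (p + q) (br p q)"
    unfolding br by (rule linear_on_tpow_linear, rule linear_lift[OF vector_space_scale vector_space_scale ml])
  have brp: "br p q (pu ws) = h ws" if "length ws = p + q" for ws
    unfolding br using that by (subst lift_pure[OF vector_space_scale vector_space_scale ml]) auto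
  show "Xm p q = mdiff (mult ast \<cdot> (P p \<otimes> P q)) (tail p q)"
    unfolding G_def[symmetric]
    by (rule mor_eqI) (use aG lin in \<open>auto simp: Xm_def arr_restr_to_tensor[simplified] app_restr pure_in_tpow to_tensor_def brp hG\<close>)
qed

lemma br_0:
  assumes "p = 0 \<or> q = 0"
  shows "br p q = (if p + q = 1 then ev else (\<lambda>_. 0))"
  using assms by (subst brace.simps) (auto simp: ev_def)

lemma Xm_boundary:
  assumes "p = 0 \<or> q = 0"
  shows "linear_on_tpow scale scale (p + q) (br p q)"
    and "p + q = 1 \<Longrightarrow> Xm p q = idm 1" and "p + q \<noteq> 1 \<Longrightarrow> is_zero (Xm p q)"
    and "natural (Xm p q)"
proof -
  interpret pl: Vector_Spaces.linear scale tscale "\<lambda>v. pu [v]"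
    by (rule pure_singleton_linear)
  interpret V: vector_space scale by (rule vector_space_scale)
  show lin: "linear_on_tpow scale scale (p + q) (br p q)"
    unfolding br_0[OF assms]
    using linear_on_tpow_linear[OF ev_linear] by (auto simp: linear_on_tpow_def)
  then have a: "arr (Xm p q)" unfolding Xm_def by (rule arr_restr_to_tensor)
  show one: "Xm p q = idm 1" if pq: "p + q = 1"
  proof (rule mor_eqI)
    fix vs :: "'v list" assume "length vs = src (Xm p q)"
    then obtain v where "vs = [v]" using pq by (auto simp: length_Suc_conv)
    then show "app (Xm p q) (pu vs) = app (idm 1) (pu vs)"
      using pq br_0[OF assms] by (simp add: app_Xm app_idm pure_in_tpow)
  qed (use a that in auto)
  show zero: "is_zero (Xm p q)" if "p + q \<noteq> 1"
    using that br_0[OF assms] pl.zero by (auto simp: is_zero_def Xm_def restr_def to_tensor_def)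
  show "natural (Xm p q)"
  proof (cases "p + q = 1")
    case False
    \<comment> \<open>A zero map is an empty sum, and sums of natural maps are natural.\<close>
    then have "Xm p q = lsum (p + q) 1 {} (\<lambda>_ :: nat. idm 0)"
      using zero by (intro is_zero_eq is_zero_lsum) auto
    then show ?thesis by (simp only:) (rule natural_lsum, auto)
  qed (simp add: one)
qed

text \<open>Condition (2) by induction on \<open>p + q\<close>: the recursion builds
  \<open>Xm p q\<close> from the two products, the braiding and lower brace maps by operations that
  preserve naturality.\<close>

lemma natural_Xm: "natural (Xm p q)"
proof (induction "p + q" arbitrary: p q rule: less_induct)
  case less
  show ?case
  proof (cases "p = 0 \<or> q = 0")
    case True
    then show ?thesis by (rule Xm_boundary(4))
  next
    case False
    then have pq: "1 \<le> p" "1 \<le> q" by auto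
    have t: "natural (tail p q)"
      by (rule Xm_step(2)[OF pq]) (rule less)
    have eq: "Xm p q = mdiff (mult ast \<cdot> (P p \<otimes> P q)) (tail p q)"
      by (rule Xm_step(3)[OF pq]) (rule less)
    show ?thesis
      unfolding eq using t
      by (intro natural_mdiff natural_comp natural_tens natural_mult[OF ast_alg]) (auto simp: tail_def)
  qed
qed

lemma br_linear: "linear_on_tpow scale scale (p + q) (br p q)"
proof (cases "p = 0 \<or> q = 0")
  case True
  then show ?thesis by (rule Xm_boundary(1))
next
  case False
  then show ?thesis by (intro Xm_step(1) natural_Xm) auto
qed

sublocale XF: natural_brace_family scale \<sigma> Xm
  by unfold_locales (auto simp: natural_Xm intro!: Xm_boundary(3))

text \<open>The recursion with the subtracted sum on the other side: \<open>r = 1\<close> gives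
  \<open>Xm p q\<close>, and \<open>r \<ge> 2\<close> gives \<open>tail p q\<close> because tuples
  with an entry \<open>(0, 0)\<close> contribute 0.\<close>

lemma P_St:
  assumes pq: "1 \<le> p" "1 \<le> q"
  shows "lsum (p + q) 1 {1..p + q} (\<lambda>r. P r \<cdot> XF.St r p q) = mult ast \<cdot> (P p \<otimes> P q)"
proof (rule mor_ext)
  note [simp] = arr_mult[OF ast_alg]
  fix x assume "x \<in> tp (src (lsum (p + q) 1 {1..p + q} (\<lambda>r. P r \<cdot> XF.St r p q)))"
  have fin: "finite (proper_tuples k p q)" for k by (simp add: proper_tuples_def)
  have tm: "app (P r \<cdot> XF.St r p q) x =
      (\<Sum>ps\<in>proper_tuples r p q. app (P r \<cdot> (XF.MT ps \<cdot> ICr (rev ps))) x)" for r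
  proof -
    have "P r \<cdot> XF.St r p q = lsum (p + q) 1 (tuples r p q) (\<lambda>ps. P r \<cdot> (XF.MT ps \<cdot> ICr (rev ps)))"
      unfolding XF.St_def by (subst lsum_comp_left) (auto simp: tuples_def)
    also have "\<dots> = lsum (p + q) 1 (proper_tuples r p q) (\<lambda>ps. P r \<cdot> (XF.MT ps \<cdot> ICr (rev ps)))"
    proof (rule lsum_mono_neutral[symmetric])
      fix ps y assume "ps \<in> tuples r p q - proper_tuples r p q"
      then have "is_zero (P r \<cdot> (XF.MT ps \<cdot> ICr (rev ps)))"
        by (intro is_zero_comp_left is_zero_comp_right XF.MT_zero)
          (auto simp: proper_tuples_def natural_Xm XF.X_0_0)
      then show "app (P r \<cdot> (XF.MT ps \<cdot> ICr (rev ps))) y = 0" by (simp add: is_zero_def)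
    qed (auto simp: proper_tuples_def)
    finally show ?thesis by (simp add: app_lsum)
  qed
  have "app (lsum (p + q) 1 {1..p + q} (\<lambda>r. P r \<cdot> XF.St r p q)) x =
      (\<Sum>r\<in>insert 1 {2..p + q}. app (P r \<cdot> XF.St r p q) x)"
    unfolding app_lsum by (rule sum.cong) (use pq in auto)
  also have "\<dots> = app (P 1 \<cdot> XF.St 1 p q) x + (\<Sum>r=2..p+q. app (P r \<cdot> XF.St r p q) x)"
    by (subst sum.insert) auto
  also have "P 1 \<cdot> XF.St 1 p q = Xm p q"
    unfolding XF.St_1 using natural_Xm by simp
  also have "(\<Sum>r=2..p+q. app (P r \<cdot> XF.St r p q) x) = app (tail p q) x"
    unfolding tm tail_def app_lsum using fin by (simp add: sum.Sigma split_beta)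
  also have "app (Xm p q) x + app (tail p q) x = app (mult ast \<cdot> (P p \<otimes> P q)) x"
    using Xm_step(3)[OF pq natural_Xm] by (simp add: app_mdiff)
  finally show "app (lsum (p + q) 1 {1..p + q} (\<lambda>r. P r \<cdot> XF.St r p q)) x = app (mult ast \<cdot> (P p \<otimes> P q)) x" .
qed (auto simp: arr_mult[OF ast_alg] intro!: arr_lsum)

sublocale XF: product_brace_family scale \<sigma> Xm P "mult ast"
  by unfold_locales
    (auto simp: natural_Xm arr_mult[OF ast_alg] mult_assoc[OF ast_alg, simplified] P_St[simplified]
      intro!: Xm_boundary(2,3) Xm_boundary(2)[simplified])

section \<open>Return to the formulation of the definitions\<close>

lemma star_comp_St: "x \<in> tp (p + q) \<Longrightarrow> star_comp scale \<sigma> br r p q x = app (XF.St r p q) x"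
  unfolding star_comp_def XF.St_def app_lsum
proof (rule sum.cong)
  fix ps assume x: "x \<in> tp (p + q)" and ps: "ps \<in> tuples r p q"
  then have s: "fst_sum ps = p" "snd_sum ps = q" by (auto simp: tuples_def)
  have "iter_coprod scale \<sigma> ps x = app (ICr (rev ps)) x"
    using iter_coprod_ICr[of x "rev ps"] x s by simp
  moreover have "app (ICr (rev ps)) x \<in> tp (fst_sum ps + snd_sum ps)"
    using arr_range[of "ICr (rev ps)" x] x s by simp
  ultimately show "mtensor scale br ps (iter_coprod scale \<sigma> ps x) = app (XF.MT ps \<cdot> ICr (rev ps)) x"
    using mtensor_MT by simp
qed simp

lemma beta_B: "x \<in> tp (i + j) \<Longrightarrow> beta scale \<sigma> i j x = app (B i j) x"
  by (simp add: B_def app_restr)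

lemma tmap_Xm:
  assumes "x \<in> tp (i + j + k)"
  shows "tmap scale (i + j) k (to_tensor scale (br i j)) id x = app (Xm i j \<otimes> idm k) x"
    and "tmap scale k (i + j) id (to_tensor scale (br i j)) x = app (idm k \<otimes> Xm i j) x"
  by (rule tmap_eq_tens; use assms in \<open>simp add: app_Xm to_tensor_def app_idm ac_simps\<close>)+

lemma brace_braid_left:
  assumes x: "x \<in> tp (i + j + k)"
  shows "beta scale \<sigma> 1 k (tmap scale (i + j) k (to_tensor scale (br i j)) id x) =
    tmap scale k (i + j) id (to_tensor scale (br i j)) (beta scale \<sigma> (i + j) k x)"
proof -
  have "app (Xm i j \<otimes> idm k) x \<in> tp (1 + k)"
    using arr_range[of "Xm i j \<otimes> idm k" x] x natural_Xm by simp
  moreover have "app (B (i + j) k) x \<in> tp (i + j + k)"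
    using arr_range[of "B (i + j) k" x] x by simp
  moreover have "B 1 k \<cdot> (Xm i j \<otimes> idm k) = (idm k \<otimes> Xm i j) \<cdot> B (i + j) k"
    using naturalD(1)[OF natural_Xm, of i j k] by simp
  ultimately show ?thesis
    using x by (simp add: beta_B tmap_Xm mcomp_def fun_eq_iff)
qed

lemma brace_braid_right:
  assumes x: "x \<in> tp (i + j + k)"
  shows "beta scale \<sigma> i 1 (tmap scale i (j + k) id (to_tensor scale (br j k)) x) =
    tmap scale (j + k) i (to_tensor scale (br j k)) id (beta scale \<sigma> i (j + k) x)"
proof -
  have x': "x \<in> tp (j + k + i)" "x \<in> tp (i + (j + k))" using x by (simp_all add: ac_simps)
  have "app (idm i \<otimes> Xm j k) x \<in> tp (i + 1)"
    using arr_range[of "idm i \<otimes> Xm j k" x] x' natural_Xm by simp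
  moreover have "app (B i (j + k)) x \<in> tp (j + k + i)"
    using arr_range[of "B i (j + k)" x] x' by (simp add: ac_simps)
  moreover have "B i 1 \<cdot> (idm i \<otimes> Xm j k) = (Xm j k \<otimes> idm i) \<cdot> B i (j + k)"
    using naturalD(2)[OF natural_Xm, where k = i] by simp
  ultimately show ?thesis
    using x' by (simp add: beta_B tmap_Xm mcomp_def fun_eq_iff)
qed

text \<open>As \<open>St 1\<close> is the family of brace maps, both sides are the
  \<open>V\<close>-components of the triple products, equal by \<open>Lm_eq_Rm\<close>. The sums in
  \<open>Lm\<close> and \<open>Rm\<close> start at 0, but the additional summand vanishes because
  the degrees are positive.\<close>

lemma brace_assoc:
  assumes pos: "1 \<le> i" "1 \<le> j" "1 \<le> k" and x: "x \<in> tp (i + j + k)"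
  shows "(\<Sum>r=1..i+j. br r k (tmap scale (i + j) k (star_comp scale \<sigma> br r i j) id x)) =
    (\<Sum>l=1..j+k. br i l (tmap scale i (j + k) id (star_comp scale \<sigma> br l j k) x))"
proof (rule pure_singleton_inject)
  interpret pl: Vector_Spaces.linear scale tscale "\<lambda>v. pu [v]"
    by (rule pure_singleton_linear)
  have x': "x \<in> tp (i + (j + k))" using x by (simp add: add.assoc)
  have l: "pu [br r k (tmap scale (i + j) k (star_comp scale \<sigma> br r i j) id x)] =
      app (XF.St 1 r k \<cdot> (XF.St r i j \<otimes> idm k)) x" for r
  proof -
    have "tmap scale (i + j) k (star_comp scale \<sigma> br r i j) id x = app (XF.St r i j \<otimes> idm k) x"
      by (rule tmap_eq_tens) (use x in \<open>auto simp: star_comp_St app_idm\<close>)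
    moreover have "app (XF.St r i j \<otimes> idm k) x \<in> tp (r + k)"
      using arr_range[of "XF.St r i j \<otimes> idm k" x] x by simp
    ultimately show ?thesis using XF.St_1[of r k] by (simp add: app_Xm)
  qed
  have r: "pu [br i l (tmap scale i (j + k) id (star_comp scale \<sigma> br l j k) x)] =
      app (XF.St 1 i l \<cdot> (idm i \<otimes> XF.St l j k)) x" for l
  proof -
    have "tmap scale i (j + k) id (star_comp scale \<sigma> br l j k) x = app (idm i \<otimes> XF.St l j k) x"
      by (rule tmap_eq_tens) (use x' in \<open>auto simp: star_comp_St app_idm\<close>)
    moreover have "app (idm i \<otimes> XF.St l j k) x \<in> tp (i + l)"
      using arr_range[of "idm i \<otimes> XF.St l j k" x] x' by simp
    ultimately show ?thesis using XF.St_1[of i l] by (simp add: app_Xm)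
  qed
  have "(\<Sum>r=1..i+j. app (XF.St 1 r k \<cdot> (XF.St r i j \<otimes> idm k)) x) = app (XF.Lm 1 i j k) x"
    unfolding XF.Lm_def app_lsum
  proof (rule sum.mono_neutral_left)
    show "\<forall>r\<in>{..i + j} - {1..i + j}. app (XF.St 1 r k \<cdot> (XF.St r i j \<otimes> idm k)) x = 0"
    proof
      fix r assume "r \<in> {..i + j} - {1..i + j}"
      then have "r = 0" by auto
      then have "is_zero (XF.St 1 r k \<cdot> (XF.St r i j \<otimes> idm k))"
        using pos by (auto intro!: is_zero_comp_left is_zero_tens XF.St_0_zero)
      then show "app (XF.St 1 r k \<cdot> (XF.St r i j \<otimes> idm k)) x = 0" by (simp add: is_zero_def)
    qed
  qed auto
  moreover have "(\<Sum>l=1..j+k. app (XF.St 1 i l \<cdot> (idm i \<otimes> XF.St l j k)) x) = app (XF.Rm 1 i j k) x"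
    unfolding XF.Rm_def app_lsum
  proof (rule sum.mono_neutral_left)
    show "\<forall>l\<in>{..j + k} - {1..j + k}. app (XF.St 1 i l \<cdot> (idm i \<otimes> XF.St l j k)) x = 0"
    proof
      fix l assume "l \<in> {..j + k} - {1..j + k}"
      then have "l = 0" by auto
      then have "is_zero (XF.St 1 i l \<cdot> (idm i \<otimes> XF.St l j k))"
        using pos by (auto intro!: is_zero_comp_left is_zero_tens XF.St_0_zero)
      then show "app (XF.St 1 i l \<cdot> (idm i \<otimes> XF.St l j k)) x = 0" by (simp add: is_zero_def)
    qed
  qed auto
  ultimately show "pu [\<Sum>r=1..i+j. br r k (tmap scale (i + j) k (star_comp scale \<sigma> br r i j) id x)] =
    pu [\<Sum>l=1..j+k. br i l (tmap scale i (j + k) id (star_comp scale \<sigma> br l j k) x)]"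
    unfolding pl.sum l r using XF.Lm_eq_Rm by simp
qed

end

theorem theorem5p3:
  fixes scale :: "'k::field_char_0 \<Rightarrow> 'v::ab_group_add \<Rightarrow> 'v"
    and ast dot :: "'v \<Rightarrow> 'v \<Rightarrow> 'v"
    and e :: 'v
    and \<sigma> :: "('k, 'v) tensor \<Rightarrow> ('k, 'v) tensor"
  assumes "vector_space scale"
    and "unital_two_braided_algebra scale ast dot e \<sigma>"
  shows "quantum_multi_brace_algebra scale (brace scale ast dot \<sigma>) \<sigma>"
proof -
  have b: "braided_vector_space scale \<sigma>"
    using assms(2) by (simp add: unital_two_braided_algebra_def)
  interpret two_braided scale \<sigma> ast dot e
    by (intro two_braided.intro braided.intro tensor_powers.intro braided_axioms.intro
        two_braided_axioms.intro assms b)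
  show ?thesis
    unfolding quantum_multi_brace_algebra_def
    using b br_linear brace_braid_left brace_braid_right brace_assoc
    by (auto simp: br_0)
qed

end
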